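(* Let $K$ be a field, $S=K[x_1,\ldots,x_n]$ the standard graded polynomial ring, and $I\subset S$ a graded ideal with minimal system of homogeneous generators $f_1,\ldots,f_m$. Let $T=K[x_1,\ldots,x_n,y_1,\ldots,y_m]$ and let $J\subset T$ be the defining ideal of the Rees algebra $\mathcal{R}(I)=S[f_1t,\ldots,f_mt]\subset S[t]$, i.e. the kernel of the $K$-algebra homomorphism $T\to\mathcal{R}(I)$ with $x_i\mapsto x_i$ and $y_j\mapsto f_jt$. Let $<$ be the monomial order on $T$ induced by a monomial order $<'$ on $K[y_1,\ldots,y_m]$ and a monomial order $<_x$ on $K[x_1,\ldots,x_n]$. If $\mathrm{in}_{<}(J)$ is generated by quadratic monomials, then for any $k\geq 1$ the ideal $I^k$ has linear quotients with respect to a minimal generating set, and hence it is componentwise linear.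
   Context: The order $<$ on $T$ induced by $<'$ and $<_x$ is defined by: $\prod_{i=1}^n x_i^{a_i}\prod_{i=1}^m y_i^{b_i} < \prod_{i=1}^n x_i^{a'_i}\prod_{i=1}^m y_i^{b'_i}$ if either $\prod_{i=1}^m y_i^{b_i}<'\prod_{i=1}^m y_i^{b'_i}$, or $\prod_{i=1}^m y_i^{b_i}=\prod_{i=1}^m y_i^{b'_i}$ and $\prod_{i=1}^n x_i^{a_i}<_x\prod_{i=1}^n x_i^{a'_i}$. A quadratic monomial of $T$ is a monomial of total degree two when every variable $x_i$, $y_j$ is given degree one. A graded ideal has linear quotients with respect to a system of homogeneous generators $g_1,\ldots,g_s$ (in a suitable order) if each of the colon ideals $(g_1,\ldots,g_{j-1}):g_j$ is generated by linear forms (the zero ideal being allowed). A graded ideal $I\subset S$ is componentwise linear if for each integer $j$ the ideal generated by all homogeneous elements of degree $j$ in $I$ has a linear resolution. *)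

theory Defs
  imports
    "HOL-Library.Poly_Mapping"
    "HOL-Computational_Algebra.Polynomial"
    "Jordan_Normal_Form.Matrix_Kernel"
begin

text \<open>
  A monomial in variables of type \<open>'v\<close> is its exponent vector, so that products of monomials are
  sums and the monomial 1 is 0. A polynomial maps monomials to their coefficients. The ring
  \<open>K[x\<^sub>1,\<dots>,x\<^sub>n]\<close> is the full type \<open>('x, 'k) mpoly\<close> for a finite type \<open>'x\<close> with \<open>n\<close> elements.
\<close>

type_synonym 'v monomial = "'v \<Rightarrow>\<^sub>0 nat"

type_synonym ('v, 'k) mpoly = "'v monomial \<Rightarrow>\<^sub>0 'k"

definition mdeg :: "'v monomial \<Rightarrow> nat" where
  "mdeg \<mu> = (\<Sum>v\<in>Poly_Mapping.keys \<mu>. Poly_Mapping.lookup \<mu> v)"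

definition homogeneous :: "nat \<Rightarrow> ('v, 'k::zero) mpoly \<Rightarrow> bool" where
  "homogeneous d p \<longleftrightarrow> (\<forall>\<mu>\<in>Poly_Mapping.keys p. mdeg \<mu> = d)"


subsection \<open>Ideals\<close>

text \<open>Ideals are the submodules of a commutative ring regarded as a module over itself.\<close>

abbreviation is_ideal :: "'a::comm_ring_1 set \<Rightarrow> bool" where
  "is_ideal \<equiv> Modules.module.subspace (*)"

abbreviation ideal_gen :: "'a::comm_ring_1 set \<Rightarrow> 'a set" where
  "ideal_gen \<equiv> Modules.module.span (*)"

definition colon :: "'a::comm_ring_1 set \<Rightarrow> 'a \<Rightarrow> 'a set" where
  "colon A g = {r. r * g \<in> A}"

definition ideal_mult :: "'a::comm_ring_1 set \<Rightarrow> 'a set \<Rightarrow> 'a set" where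
  "ideal_mult A B = ideal_gen {a * b | a b. a \<in> A \<and> b \<in> B}"

primrec ideal_power :: "'a::comm_ring_1 set \<Rightarrow> nat \<Rightarrow> 'a set" where
  "ideal_power A 0 = UNIV"
| "ideal_power A (Suc k) = ideal_mult A (ideal_power A k)"

definition graded_ideal :: "('v, 'k::comm_ring_1) mpoly set \<Rightarrow> bool" where
  "graded_ideal A \<longleftrightarrow> is_ideal A \<and>
     (\<forall>p\<in>A. \<forall>d.
        (\<Sum>\<mu> | \<mu> \<in> Poly_Mapping.keys p \<and> mdeg \<mu> = d.
           Poly_Mapping.single \<mu> (Poly_Mapping.lookup p \<mu>)) \<in> A)"

text \<open>
  Minimality refers to positions in the list, so it also excludes repeated generators.
\<close>

definition min_hom_generators ::
    "('v, 'k::comm_ring_1) mpoly list \<Rightarrow> ('v, 'k) mpoly set \<Rightarrow> bool" where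
  "min_hom_generators gs A \<longleftrightarrow>
     (\<forall>g\<in>set gs. \<exists>d. homogeneous d g) \<and>
     ideal_gen (set gs) = A \<and>
     (\<forall>j<length gs. gs ! j \<notin> ideal_gen {gs ! i | i. i < length gs \<and> i \<noteq> j})"

definition linear_quotients :: "('v, 'k::comm_ring_1) mpoly list \<Rightarrow> bool" where
  "linear_quotients gs \<longleftrightarrow>
     (\<forall>j<length gs. \<exists>L. (\<forall>l\<in>L. homogeneous 1 l) \<and>
        colon (ideal_gen (set (take j gs))) (gs ! j) = ideal_gen L)"


subsection \<open>Linear resolutions and componentwise linear ideals\<close>

text \<open>
  A minimal graded free resolution
  \<open>\<cdots> \<rightarrow> F\<^sub>2 \<rightarrow> F\<^sub>1 \<rightarrow> F\<^sub>0 \<rightarrow> A \<rightarrow> 0\<close> of an ideal \<open>A\<close>, where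
  \<open>F\<^sub>i = S(-a i 0) \<oplus> \<dots> \<oplus> S(-a i (b i - 1))\<close>.
  The map from \<open>F\<^sub>0\<close> to \<open>A\<close> is the one-row matrix \<open>D 0\<close>, and \<open>D (Suc i)\<close> is the matrix of
  the map from \<open>F\<^bsub>i+1\<^esub>\<close> to \<open>F\<^sub>i\<close>. The maps preserve degrees, and minimality says that the
  entries of every \<open>D (Suc i)\<close> lie in the graded maximal ideal, i.e. have constant term zero.
\<close>

definition min_graded_free_resolution ::
    "('v, 'k::comm_ring_1) mpoly set \<Rightarrow> (nat \<Rightarrow> nat) \<Rightarrow> (nat \<Rightarrow> nat \<Rightarrow> nat)
       \<Rightarrow> (nat \<Rightarrow> ('v, 'k) mpoly mat) \<Rightarrow> bool" where
  "min_graded_free_resolution A b a D \<longleftrightarrow>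
     D 0 \<in> carrier_mat 1 (b 0) \<and>
     (\<forall>i. D (Suc i) \<in> carrier_mat (b i) (b (Suc i))) \<and>
     {(D 0 *\<^sub>v v) $ 0 | v. v \<in> carrier_vec (b 0)} = A \<and>
     (\<forall>i. mat_kernel (D i) = {D (Suc i) *\<^sub>v v | v. v \<in> carrier_vec (b (Suc i))}) \<and>
     (\<forall>c<b 0. homogeneous (a 0 c) (D 0 $$ (0, c))) \<and>
     (\<forall>i. \<forall>r<b i. \<forall>c<b (Suc i).
        D (Suc i) $$ (r, c) = 0 \<or>
        (\<exists>e. a (Suc i) c = a i r + e \<and> homogeneous e (D (Suc i) $$ (r, c)))) \<and>
     (\<forall>i. \<forall>r<b i. \<forall>c<b (Suc i). Poly_Mapping.lookup (D (Suc i) $$ (r, c)) 0 = 0)"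

definition has_linear_resolution :: "('v, 'k::comm_ring_1) mpoly set \<Rightarrow> bool" where
  "has_linear_resolution A \<longleftrightarrow>
     (\<exists>d b a D. min_graded_free_resolution A b a D \<and> (\<forall>i. \<forall>c<b i. a i c = d + i))"

definition componentwise_linear :: "('v, 'k::comm_ring_1) mpoly set \<Rightarrow> bool" where
  "componentwise_linear A \<longleftrightarrow> graded_ideal A \<and>
     (\<forall>j. has_linear_resolution (ideal_gen {p \<in> A. homogeneous j p}))"


subsection \<open>Polynomial subrings, monomial orders and initial ideals\<close>

definition monomials_in :: "'v set \<Rightarrow> 'v monomial set" where
  "monomials_in V = {\<mu>. Poly_Mapping.keys \<mu> \<subseteq> V}"

definition polys_in :: "'v set \<Rightarrow> ('v, 'k::zero) mpoly set" where
  "polys_in V = {p. Poly_Mapping.keys p \<subseteq> monomials_in V}"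

text \<open>The ideal generated by \<open>G\<close> in the subring \<open>polys_in V\<close>, for \<open>G\<close> contained in it.\<close>

definition ideal_gen_in :: "'v set \<Rightarrow> ('v, 'k::comm_ring_1) mpoly set \<Rightarrow> ('v, 'k) mpoly set" where
  "ideal_gen_in V G =
     {\<Sum>g\<in>F. c g * g | F c. finite F \<and> F \<subseteq> G \<and> (\<forall>g\<in>F. c g \<in> polys_in V)}"

text \<open>A monomial order on the monomials in the variables \<open>V\<close>, given as a strict order.\<close>

definition monomial_order :: "'v set \<Rightarrow> ('v monomial \<Rightarrow> 'v monomial \<Rightarrow> bool) \<Rightarrow> bool" where
  "monomial_order V lt \<longleftrightarrow>
     irreflp_on (monomials_in V) lt \<and> transp_on (monomials_in V) lt \<and>
     totalp_on (monomials_in V) lt \<and>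
     (\<forall>\<mu>\<in>monomials_in V. \<mu> \<noteq> 0 \<longrightarrow> lt 0 \<mu>) \<and>
     (\<forall>\<mu>\<in>monomials_in V. \<forall>\<nu>\<in>monomials_in V. \<forall>\<rho>\<in>monomials_in V.
        lt \<mu> \<nu> \<longrightarrow> lt (\<mu> + \<rho>) (\<nu> + \<rho>))"

definition initial_monomial ::
    "('v monomial \<Rightarrow> 'v monomial \<Rightarrow> bool) \<Rightarrow> ('v, 'k::zero) mpoly \<Rightarrow> 'v monomial" where
  "initial_monomial lt p =
     (THE \<mu>. \<mu> \<in> Poly_Mapping.keys p \<and>
        (\<forall>\<nu>\<in>Poly_Mapping.keys p. \<nu> \<noteq> \<mu> \<longrightarrow> lt \<nu> \<mu>))"

definition initial_ideal ::
    "'v set \<Rightarrow> ('v monomial \<Rightarrow> 'v monomial \<Rightarrow> bool)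
       \<Rightarrow> ('v, 'k::comm_ring_1) mpoly set \<Rightarrow> ('v, 'k) mpoly set" where
  "initial_ideal V lt J =
     ideal_gen_in V {Poly_Mapping.single (initial_monomial lt p) 1 | p. p \<in> J \<and> p \<noteq> 0}"

definition generated_by_quadratic_monomials ::
    "'v set \<Rightarrow> ('v, 'k::comm_ring_1) mpoly set \<Rightarrow> bool" where
  "generated_by_quadratic_monomials V A \<longleftrightarrow>
     (\<exists>Q \<subseteq> {\<mu> \<in> monomials_in V. mdeg \<mu> = 2}.
        A = ideal_gen_in V {Poly_Mapping.single \<mu> 1 | \<mu>. \<mu> \<in> Q})"


subsection \<open>The defining ideal of the Rees algebra\<close>

text \<open>
  The variables of \<open>T\<close> are \<open>Inl i\<close> for \<open>x\<^sub>i\<close> and \<open>Inr j\<close>, \<open>j < m\<close>, for \<open>y\<^bsub>j+1\<^esub>\<close>. Here \<open>m\<close> may be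
  zero (the zero ideal), so \<open>T\<close> is a subring of the polynomials in variables of type \<open>'x + nat\<close>.
\<close>

definition rees_vars :: "nat \<Rightarrow> ('x + nat) set" where
  "rees_vars m = UNIV <+> {..<m}"

text \<open>
  The homomorphism from \<open>T\<close> to \<open>S[t]\<close> with \<open>x\<^sub>i \<mapsto> x\<^sub>i\<close> and \<open>y\<^sub>j \<mapsto> f\<^sub>j t\<close>; elements of
  \<open>S[t]\<close> are univariate polynomials over \<open>S\<close>.
\<close>

definition rees_map ::
    "('x, 'k::comm_ring_1) mpoly list \<Rightarrow> ('x + nat, 'k) mpoly \<Rightarrow> ('x, 'k) mpoly poly" where
  "rees_map fs p =
     (\<Sum>\<mu>\<in>Poly_Mapping.keys p. [:Poly_Mapping.single 0 (Poly_Mapping.lookup p \<mu>):] *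
        (\<Prod>v\<in>Poly_Mapping.keys \<mu>.
           (case v of
              Inl i \<Rightarrow> [:Poly_Mapping.single (Poly_Mapping.single i 1) 1:]
            | Inr j \<Rightarrow> Polynomial.monom (fs ! j) 1) ^ Poly_Mapping.lookup \<mu> v))"

definition rees_ideal :: "('x, 'k::comm_ring_1) mpoly list \<Rightarrow> ('x + nat, 'k) mpoly set" where
  "rees_ideal fs = {p \<in> polys_in (rees_vars (length fs)). rees_map fs p = 0}"

definition induced_order ::
    "('y monomial \<Rightarrow> 'y monomial \<Rightarrow> bool) \<Rightarrow> ('x monomial \<Rightarrow> 'x monomial \<Rightarrow> bool)
       \<Rightarrow> ('x + 'y) monomial \<Rightarrow> ('x + 'y) monomial \<Rightarrow> bool" where
  "induced_order lty ltx \<mu> \<nu> \<longleftrightarrow>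
     (let x = Poly_Mapping.map_key Inl; y = Poly_Mapping.map_key Inr
      in lty (y \<mu>) (y \<nu>) \<or> y \<mu> = y \<nu> \<and> ltx (x \<mu>) (x \<nu>))"

end

theory Submission
  imports Defs
begin

text \<open>
  Write \<open>f^b\<close> for the product \<open>f\<^sub>1^b\<^sub>1 \<cdots> f\<^sub>m^b\<^sub>m\<close> attached to a monomial \<open>y^b\<close> of degree \<open>k\<close>. These
  products generate \<open>I^k\<close>, and they are added one after the other, in the order \<open><'\<close> of the monomials
  \<open>y^b\<close>. Products that already lie in the ideal \<open>P\<close> of the earlier ones are skipped.

  Suppose that \<open>f^b\<close> is not skipped and that \<open>r \<noteq> 0\<close> satisfies \<open>r f^b \<in> P\<close>. Moving everything to one side
  gives an element of \<open>J\<close> whose initial monomial is \<open>in(r) y^b\<close>, because \<open><\<close> compares the \<open>y\<close>-parts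
  first. So a quadratic monomial of \<open>in(J)\<close> divides \<open>in(r) y^b\<close>. It is not a monomial in \<open>x\<close> alone, as
  \<open>J\<close> contains no nonzero element of \<open>S\<close>; it is not a monomial in \<open>y\<close> alone, as this would put \<open>f^b\<close>
  into \<open>P\<close>. Hence it is some \<open>x\<^sub>i y\<^sub>l\<close>. A suitable graded component of an element of \<open>J\<close> with that
  initial monomial is a relation \<open>q f\<^sub>l = \<Sum> h\<^sub>j f\<^sub>j\<close>, the sum over \<open>y\<^sub>j <' y\<^sub>l\<close>, with \<open>q\<close> a linear form and
  \<open>in(q) = x\<^sub>i\<close>. Multiplied by the remaining factors of \<open>f^b\<close> it shows \<open>q f^b \<in> P\<close>
  (\<open>linear_relation\<close>). So every initial monomial of the colon ideal \<open>P : f^b\<close> is a multiple of the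
  initial monomial of a linear form in it, and by division the linear forms generate the colon
  ideal (\<open>ideal_gen_of_leading_terms\<close>). This gives linear quotients.

  The generators are minimal because the \<open>f\<^sub>j\<close> are: the coefficients \<open>h\<^sub>j\<close> have no constant term, so
  \<open>P : f^b\<close> multiplies \<open>f^b\<close> into \<open>\<mm> P\<close>, where \<open>\<mm>\<close> is the graded maximal ideal. Pushing a relation between
  the generators down from the last one then shows that all its coefficients lie in \<open>\<mm>\<close>
  (\<open>irredundant_if_irrelevant_quotients\<close>).

  An ideal \<open>A\<close> with linear quotients \<open>g\<^sub>1, \<dots>, g\<^sub>s\<close> with respect to minimal generators is componentwise
  linear, even when the degrees of the \<open>g\<^sub>i\<close> are not increasing. By minimality, dropping the
  generators of degree above \<open>j\<close> does not change the colon ideals of the others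
  (\<open>linear_quotients_filter_degree\<close>). The ideal of the elements of \<open>A\<close> of degree \<open>j\<close> is the part in degrees \<open>\<ge> j\<close>
  of the ideal of the remaining generators. Replacing a generator \<open>g\<close> of degree below \<open>j\<close> by
  \<open>x\<^sub>1 g, \<dots>, x\<^sub>n g\<close> keeps the quotients linear, since ideals generated by linear forms are prime, and
  leads to linear quotients by generators that all have degree \<open>j\<close>
  (\<open>linear_chain_truncation_insert\<close>). For such generators the relations, filtered by their last
  nonzero coordinate, again have linear quotients, now by relations with linear entries
  (\<open>linear_presentable_relations\<close>), and iterating this builds the linear resolution.
\<close>

section \<open>Ideals\<close>

interpretation ideal: Modules.module "(*) :: 'a::comm_ring_1 \<Rightarrow> 'a \<Rightarrow> 'a"
  by unfold_locales (simp_all add: algebra_simps)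

\<comment> \<open>For the module of a ring over itself this rule is reversed associativity and loops with
  \<open>mult.assoc\<close>.\<close>
declare ideal.scale_scale [simp del]

lemma is_idealI:
  assumes "0 \<in> A" "\<And>p q. p \<in> A \<Longrightarrow> q \<in> A \<Longrightarrow> p + q \<in> A" "\<And>r p. p \<in> A \<Longrightarrow> r * p \<in> A"
  shows "is_ideal A"
  using assms by (auto simp: ideal.subspace_def)

lemma ideal_gen_subset_iff: "is_ideal A \<Longrightarrow> ideal_gen G \<subseteq> A \<longleftrightarrow> G \<subseteq> A"
  using ideal.span_minimal ideal.span_superset by blast

lemma ideal_eq_UNIV: "is_ideal A \<Longrightarrow> 1 \<in> A \<Longrightarrow> A = UNIV"
  using ideal.subspace_scale[of A 1] by fastforce

lemma ideal_mult_right: "is_ideal A \<Longrightarrow> p \<in> A \<Longrightarrow> p * r \<in> A"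
  using ideal.subspace_scale[of A p r] by (simp add: mult.commute)

lemma is_ideal_colon:
  assumes "is_ideal A"
  shows "is_ideal (colon A g)"
proof (rule is_idealI)
  show "0 \<in> colon A g"
    using ideal.subspace_0[OF assms] by (simp add: colon_def)
  show "p + q \<in> colon A g" if "p \<in> colon A g" "q \<in> colon A g" for p q
    using ideal.subspace_add[OF assms] that by (simp add: colon_def distrib_right)
  show "r * p \<in> colon A g" if "p \<in> colon A g" for r p
    using ideal.subspace_scale[OF assms, of "p * g" r] that by (simp add: colon_def mult.assoc)
qed

lemma ideal_gen_image:
  assumes "finite B"
  shows "ideal_gen (f ` B) = {\<Sum>b\<in>B. c b * f b | c. True}"
proof
  have "is_ideal {\<Sum>b\<in>B. c b * f b | c. True}"
  proof (rule is_idealI)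
    show "0 \<in> {\<Sum>b\<in>B. c b * f b | c. True}"
      by (rule CollectI, rule exI[of _ "\<lambda>_. 0"]) simp
  next
    fix p q assume "p \<in> {\<Sum>b\<in>B. c b * f b | c. True}" "q \<in> {\<Sum>b\<in>B. c b * f b | c. True}"
    then obtain c d where "p = (\<Sum>b\<in>B. c b * f b)" "q = (\<Sum>b\<in>B. d b * f b)" by blast
    then have "p + q = (\<Sum>b\<in>B. (c b + d b) * f b)"
      by (simp add: sum.distrib algebra_simps)
    then show "p + q \<in> {\<Sum>b\<in>B. c b * f b | c. True}"
      by (intro CollectI exI[of _ "\<lambda>b. c b + d b"]) simp
  next
    fix r p assume "p \<in> {\<Sum>b\<in>B. c b * f b | c. True}"
    then obtain c where "p = (\<Sum>b\<in>B. c b * f b)" by blast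
    then have "r * p = (\<Sum>b\<in>B. (r * c b) * f b)"
      by (simp add: sum_distrib_left algebra_simps)
    then show "r * p \<in> {\<Sum>b\<in>B. c b * f b | c. True}"
      by (intro CollectI exI[of _ "\<lambda>b. r * c b"]) simp
  qed
  moreover have "f ` B \<subseteq> {\<Sum>b\<in>B. c b * f b | c. True}"
  proof
    fix p assume "p \<in> f ` B"
    then obtain b where b: "b \<in> B" "p = f b" by blast
    have "(\<Sum>b'\<in>B. (if b' = b then 1 else 0) * f b') = (\<Sum>b'\<in>B. if b' = b then f b' else 0)"
      by (rule sum.cong) auto
    also have "\<dots> = f b" using b assms by simp
    finally show "p \<in> {\<Sum>b\<in>B. c b * f b | c. True}"
      using b by (intro CollectI exI[of _ "\<lambda>b'. if b' = b then 1 else 0"]) simp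
  qed
  ultimately show "ideal_gen (f ` B) \<subseteq> {\<Sum>b\<in>B. c b * f b | c. True}"
    by (simp add: ideal_gen_subset_iff)
  show "{\<Sum>b\<in>B. c b * f b | c. True} \<subseteq> ideal_gen (f ` B)"
  proof
    fix p assume "p \<in> {\<Sum>b\<in>B. c b * f b | c. True}"
    then obtain c where "p = (\<Sum>b\<in>B. c b * f b)" by blast
    also have "\<dots> \<in> ideal_gen (f ` B)"
      by (intro ideal.span_sum ideal.span_scale ideal.span_base imageI)
    finally show "p \<in> ideal_gen (f ` B)" .
  qed
qed

lemma ideal_gen_list:
  "ideal_gen (set gs) = {\<Sum>i<length gs. c i * gs ! i | c. True}"
proof -
  have "set gs = (!) gs ` {..<length gs}"
    by (auto simp: set_conv_nth)
  then show ?thesis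
    by (simp add: ideal_gen_image)
qed

lemma set_take_conv_image: "n \<le> length gs \<Longrightarrow> set (take n gs) = (!) gs ` {..<n}"
  by (simp add: atLeast0LessThan flip: nth_image)

lemma ideal_gen_Un_eq:
  "ideal_gen (ideal_gen A \<union> B) = ideal_gen (A \<union> B)"
proof (rule subset_antisym)
  show "ideal_gen (ideal_gen A \<union> B) \<subseteq> ideal_gen (A \<union> B)"
    using ideal.span_superset[of "A \<union> B"] by (intro ideal.span_minimal) (simp_all add: ideal.span_mono)
  show "ideal_gen (A \<union> B) \<subseteq> ideal_gen (ideal_gen A \<union> B)"
    by (rule ideal.span_mono) (use ideal.span_superset in blast)
qed

section \<open>Degrees and graded parts\<close>

lemma mdeg_superset:
  assumes "finite V" "Poly_Mapping.keys \<mu> \<subseteq> V"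
  shows "mdeg \<mu> = (\<Sum>v\<in>V. Poly_Mapping.lookup \<mu> v)"
  unfolding mdeg_def using assms
  by (intro sum.mono_neutral_left) (auto simp: in_keys_iff)

lemma keys_plus_nat: "Poly_Mapping.keys (\<mu> + \<nu> :: 'v monomial) = Poly_Mapping.keys \<mu> \<union> Poly_Mapping.keys \<nu>"
  by (auto simp: in_keys_iff lookup_add)

lemma mdeg_plus [simp]: "mdeg (\<mu> + \<nu>) = mdeg \<mu> + mdeg \<nu>"
proof -
  let ?V = "Poly_Mapping.keys \<mu> \<union> Poly_Mapping.keys \<nu>"
  have "mdeg (\<mu> + \<nu>) = (\<Sum>v\<in>?V. Poly_Mapping.lookup (\<mu> + \<nu>) v)"
    by (simp add: mdeg_def keys_plus_nat)
  also have "\<dots> = mdeg \<mu> + mdeg \<nu>"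
    by (subst (1 2) mdeg_superset[of ?V]) (auto simp: lookup_add sum.distrib)
  finally show ?thesis .
qed

lemma mdeg_single [simp]: "mdeg (Poly_Mapping.single v n) = n"
  by (simp add: mdeg_def)

lemma mdeg_0 [simp]: "mdeg 0 = 0"
  by (simp add: mdeg_def)

lemma mdeg_eq_0_iff [simp]: "mdeg \<mu> = 0 \<longleftrightarrow> \<mu> = 0"
  by (auto simp: mdeg_def in_keys_iff simp flip: keys_eq_empty)

lemma monomial_remove_var:
  assumes "v \<in> Poly_Mapping.keys (\<mu> :: 'v monomial)"
  shows "\<mu> = Poly_Mapping.single v 1 + (\<mu> - Poly_Mapping.single v 1)"
  using assms by (intro poly_mapping_eqI)
    (auto simp: lookup_add lookup_minus lookup_single when_def in_keys_iff)

lemma mdeg_1_single: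
  assumes "mdeg \<mu> = 1"
  shows "\<exists>v. \<mu> = Poly_Mapping.single v 1"
proof -
  have "Poly_Mapping.keys \<mu> \<noteq> {}" using assms by auto
  then obtain v where "v \<in> Poly_Mapping.keys \<mu>" by blast
  from monomial_remove_var[OF this] have "\<mu> = Poly_Mapping.single v 1 + (\<mu> - Poly_Mapping.single v 1)" .
  moreover from this have "mdeg \<mu> = 1 + mdeg (\<mu> - Poly_Mapping.single v 1)"
    by (metis mdeg_plus mdeg_single)
  ultimately show ?thesis using assms by auto
qed

lemma finite_monomials:
  assumes "finite V"
  shows "finite {\<mu>. Poly_Mapping.keys \<mu> \<subseteq> V \<and> mdeg \<mu> \<le> d}"
proof -
  let ?M = "{\<mu>. Poly_Mapping.keys \<mu> \<subseteq> V \<and> mdeg \<mu> \<le> d}"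
  have "Poly_Mapping.lookup ` ?M \<subseteq> {f. \<forall>v. (v \<in> V \<longrightarrow> f v \<in> {..d}) \<and> (v \<notin> V \<longrightarrow> f v = 0)}"
  proof safe
    fix \<mu> v assume \<mu>: "Poly_Mapping.keys \<mu> \<subseteq> V" "mdeg \<mu> \<le> d"
    show "v \<in> V \<Longrightarrow> Poly_Mapping.lookup \<mu> v \<le> d"
      using \<mu> assms member_le_sum[of v V "Poly_Mapping.lookup \<mu>"] by (simp add: mdeg_superset)
    show "v \<notin> V \<Longrightarrow> Poly_Mapping.lookup \<mu> v = 0"
      using \<mu> by (auto simp: in_keys_iff)
  qed
  moreover have "finite {f. \<forall>v. (v \<in> V \<longrightarrow> f v \<in> {..d}) \<and> (v \<notin> V \<longrightarrow> f v = (0::nat))}"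
    using assms by (intro finite_set_of_finite_funs) auto
  ultimately have "finite (Poly_Mapping.lookup ` ?M)"
    by (rule finite_subset)
  then show ?thesis
    by (rule finite_imageD) (simp add: inj_on_def Poly_Mapping.lookup_inject)
qed

lemma poly_mapping_sum_singles:
  "p = (\<Sum>\<mu>\<in>Poly_Mapping.keys p. Poly_Mapping.single \<mu> (Poly_Mapping.lookup p \<mu>))"
proof (rule poly_mapping_eqI)
  fix k
  have "Poly_Mapping.lookup (\<Sum>\<mu>\<in>Poly_Mapping.keys p. Poly_Mapping.single \<mu> (Poly_Mapping.lookup p \<mu>)) k =
      (\<Sum>\<mu>\<in>Poly_Mapping.keys p. if \<mu> = k then Poly_Mapping.lookup p k else 0)"
    unfolding lookup_sum by (rule sum.cong) (simp_all add: lookup_single)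
  also have "\<dots> = Poly_Mapping.lookup p k"
    by (cases "k \<in> Poly_Mapping.keys p") (simp_all add: not_in_keys_iff_lookup_eq_zero)
  finally show "Poly_Mapping.lookup p k = Poly_Mapping.lookup
      (\<Sum>\<mu>\<in>Poly_Mapping.keys p. Poly_Mapping.single \<mu> (Poly_Mapping.lookup p \<mu>)) k"
    by (rule sym)
qed

lemma homogeneous_0 [simp]: "homogeneous d 0"
  by (simp add: homogeneous_def)

lemma homogeneous_1 [simp]: "homogeneous 0 (1 :: ('v, 'k::zero_neq_one) mpoly)"
  by (auto simp: homogeneous_def)

lemma homogeneous_add: "homogeneous d p \<Longrightarrow> homogeneous d q \<Longrightarrow> homogeneous d (p + q)"
  using keys_add[of p q] by (fastforce simp: homogeneous_def)

lemma homogeneous_mult: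
  "homogeneous d p \<Longrightarrow> homogeneous e q \<Longrightarrow> homogeneous (d + e) (p * q)"
  for p q :: "('v, 'k::comm_ring_1) mpoly"
  using keys_mult[of p q] by (fastforce simp: homogeneous_def)

lemma homogeneous_power:
  "homogeneous d p \<Longrightarrow> homogeneous (n * d) (p ^ n)" for p :: "('v, 'k::comm_ring_1) mpoly"
  by (induction n) (auto intro: homogeneous_mult)

lemma homogeneous_prod:
  "(\<And>i. i \<in> A \<Longrightarrow> homogeneous (d i) (f i)) \<Longrightarrow> homogeneous (sum d A) (prod f A)"
  for f :: "'i \<Rightarrow> ('v, 'k::comm_ring_1) mpoly"
  by (induction A rule: infinite_finite_induct) (auto intro: homogeneous_mult)

lemma homogeneous_deg0_const:
  assumes "homogeneous 0 p"
  shows "p = Poly_Mapping.single 0 (Poly_Mapping.lookup p 0)"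
proof (rule poly_mapping_eqI)
  fix k
  show "Poly_Mapping.lookup p k = Poly_Mapping.lookup (Poly_Mapping.single 0 (Poly_Mapping.lookup p 0)) k"
    using assms by (cases "k = 0") (auto simp: homogeneous_def in_keys_iff lookup_single)
qed

text \<open>
The part of \<open>p\<close> of degree \<open>W - d\<close>, and 0 if \<open>W < d\<close>. The offset \<open>d\<close> is meant to be the degree of a
cofactor: the coefficient of a generator of degree \<open>d\<close> in a relation of degree \<open>W\<close> is such a part.
\<close>

definition graded_part :: "nat \<Rightarrow> nat \<Rightarrow> ('v, 'k::zero) mpoly \<Rightarrow> ('v, 'k) mpoly" where
  "graded_part W d p = Poly_Mapping.mapp (\<lambda>\<mu> a. a when mdeg \<mu> + d = W) p"

lemma lookup_graded_part:
  "Poly_Mapping.lookup (graded_part W d p) \<mu> = (Poly_Mapping.lookup p \<mu> when mdeg \<mu> + d = W)"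
  by (auto simp: graded_part_def lookup_mapp when_def in_keys_iff)

lemma keys_graded_part:
  "Poly_Mapping.keys (graded_part W d p) = {\<mu>\<in>Poly_Mapping.keys p. mdeg \<mu> + d = W}"
  by (auto simp: in_keys_iff lookup_graded_part)

lemma graded_part_0 [simp]: "graded_part W d 0 = 0"
  by (rule poly_mapping_eqI) (simp add: lookup_graded_part)

lemma graded_part_add: "graded_part W d (p + q) = graded_part W d p + graded_part W d q"
  by (rule poly_mapping_eqI) (auto simp: lookup_graded_part lookup_add when_def)

lemma graded_part_sum: "graded_part W d (sum f A) = (\<Sum>i\<in>A. graded_part W d (f i))"
  by (induction A rule: infinite_finite_induct) (auto simp: graded_part_add)

lemma homogeneous_graded_part_weight: "d + n = W \<Longrightarrow> homogeneous n (graded_part W d p)"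
  by (auto simp: homogeneous_def keys_graded_part)

lemma graded_part_less: "W < d \<Longrightarrow> graded_part W d p = 0"
  by (rule poly_mapping_eqI) (auto simp: lookup_graded_part)

lemma graded_part_id: "homogeneous n p \<Longrightarrow> n + d = W \<Longrightarrow> graded_part W d p = p"
  by (rule poly_mapping_eqI) (auto simp: lookup_graded_part homogeneous_def in_keys_iff when_def)

lemma graded_part_eq_0: "\<forall>\<mu>\<in>Poly_Mapping.keys p. mdeg \<mu> + d \<noteq> W \<Longrightarrow> graded_part W d p = 0"
  by (rule poly_mapping_eqI) (auto simp: lookup_graded_part in_keys_iff when_def)

text \<open>
Taking the component of degree \<open>W\<close> of a relation between homogeneous elements only affects its
coefficients.
\<close>

lemma graded_part_mult:
  fixes p f :: "('v, 'k::comm_ring_1) mpoly"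
  assumes "homogeneous d f"
  shows "graded_part W e (p * f) = graded_part W (e + d) p * f"
proof -
  define g where "g = graded_part W (e + d) p"
  have "graded_part W e (g * f) = g * f"
  proof (rule poly_mapping_eqI)
    fix \<mu>
    show "Poly_Mapping.lookup (graded_part W e (g * f)) \<mu> = Poly_Mapping.lookup (g * f) \<mu>"
    proof (cases "\<mu> \<in> Poly_Mapping.keys (g * f)")
      case True
      then obtain a b where "\<mu> = a + b" "a \<in> Poly_Mapping.keys g" "b \<in> Poly_Mapping.keys f"
        using keys_mult[of g f] by blast
      then have "mdeg \<mu> + e = W"
        using assms by (auto simp: g_def keys_graded_part homogeneous_def)
      then show ?thesis by (simp add: lookup_graded_part)
    qed (simp add: lookup_graded_part in_keys_iff)
  qed
  moreover have "graded_part W e ((p - g) * f) = 0"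
  proof (rule graded_part_eq_0, rule ballI)
    fix \<mu> assume "\<mu> \<in> Poly_Mapping.keys ((p - g) * f)"
    then obtain a b where "\<mu> = a + b" "a \<in> Poly_Mapping.keys (p - g)" "b \<in> Poly_Mapping.keys f"
      using keys_mult[of "p - g" f] by blast
    then show "mdeg \<mu> + e \<noteq> W"
      using assms by (auto simp: g_def homogeneous_def in_keys_iff lookup_minus lookup_graded_part when_def
          split: if_splits)
  qed
  moreover have "p * f = g * f + (p - g) * f"
    by (simp add: algebra_simps)
  ultimately show ?thesis
    by (simp add: graded_part_add g_def)
qed

lemma graded_part_conv_sum:
  "(\<Sum>\<mu> | \<mu> \<in> Poly_Mapping.keys p \<and> mdeg \<mu> = d.
           Poly_Mapping.single \<mu> (Poly_Mapping.lookup p \<mu>)) = graded_part d 0 p"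
  by (rule poly_mapping_eqI)
     (auto simp: lookup_sum lookup_single when_def in_keys_iff lookup_graded_part)

lemma graded_ideal_iff:
  "graded_ideal A \<longleftrightarrow> is_ideal A \<and> (\<forall>p\<in>A. \<forall>d. graded_part d 0 p \<in> A)"
  by (simp add: graded_ideal_def graded_part_conv_sum)

lemma graded_ideal_gen:
  assumes "\<forall>g\<in>G. \<exists>d. homogeneous d (g :: ('v, 'k::comm_ring_1) mpoly)"
  shows "graded_ideal (ideal_gen G)"
  unfolding graded_ideal_iff
proof (intro conjI ballI allI)
  fix p d assume "p \<in> ideal_gen G"
  then show "graded_part d 0 p \<in> ideal_gen G"
  proof (induction rule: ideal.span_induct_alt)
    case base
    then show ?case by (simp add: ideal.span_zero)
  next
    case (step c g q)
    from step(1) assms obtain e where "homogeneous e g" by blast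
    then show ?case
      using step by (auto simp: graded_part_add graded_part_mult intro!: ideal.span_add ideal.span_scale
          intro: ideal.span_base)
  qed
qed (rule ideal.subspace_span)

section \<open>Monomial orders\<close>

lemma finite_strict_order_has_greatest:
  assumes "transp_on A lt" "totalp_on A lt" "finite K" "K \<noteq> {}" "K \<subseteq> A"
  shows "\<exists>\<mu>\<in>K. \<forall>\<nu>\<in>K. \<nu> \<noteq> \<mu> \<longrightarrow> lt \<nu> \<mu>"
  using assms(3-5)
proof (induction K rule: finite_ne_induct)
  case (insert x F)
  then obtain \<mu> where \<mu>: "\<mu> \<in> F" "\<forall>\<nu>\<in>F. \<nu> \<noteq> \<mu> \<longrightarrow> lt \<nu> \<mu>" by auto
  have "lt x \<mu> \<or> lt \<mu> x"
    using assms(2) \<mu> insert by (metis insert_subset subsetD totalp_onD)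
  then show ?case
  proof
    assume "lt x \<mu>" then show ?thesis using \<mu> by auto
  next
    assume *: "lt \<mu> x"
    have "lt \<nu> x" if "\<nu> \<in> F" for \<nu>
      using assms(1) \<mu> * that insert by (metis insert_subset subsetD transp_onD)
    then show ?thesis by auto
  qed
qed auto

lemma finite_strict_order_sorted_list:
  assumes "transp_on A lt" "totalp_on A lt" "finite K" "K \<subseteq> A"
  shows "\<exists>xs. set xs = K \<and> sorted_wrt lt xs"
  using assms(3,4)
proof (induction "card K" arbitrary: K)
  case 0
  then show ?case by (intro exI[of _ "[]"]) simp
next
  case (Suc n)
  then have "K \<noteq> {}" by auto
  then obtain \<mu> where \<mu>: "\<mu> \<in> K" "\<forall>\<nu>\<in>K. \<nu> \<noteq> \<mu> \<longrightarrow> lt \<nu> \<mu>"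
    using finite_strict_order_has_greatest[OF assms(1,2) Suc.prems(1) _ Suc.prems(2)] by blast
  obtain xs where xs: "set xs = K - {\<mu>}" "sorted_wrt lt xs"
  proof (rule exE[OF Suc.hyps(1)[of "K - {\<mu>}"]])
    show "n = card (K - {\<mu>})" using Suc.hyps(2)[symmetric] \<mu>(1) Suc.prems(1) by (simp add: card_Diff_singleton)
    show "finite (K - {\<mu>})" "K - {\<mu>} \<subseteq> A" using Suc.prems by auto
  qed auto
  then show ?case
    using \<mu> by (intro exI[of _ "xs @ [\<mu>]"]) (auto simp: sorted_wrt_append)
qed

lemma initial_monomial:
  assumes "irreflp_on A lt" "transp_on A lt" "totalp_on A lt" "Poly_Mapping.keys p \<subseteq> A" "p \<noteq> 0"
  shows "initial_monomial lt p \<in> Poly_Mapping.keys p"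
    and "\<And>\<nu>. \<nu> \<in> Poly_Mapping.keys p \<Longrightarrow> \<nu> \<noteq> initial_monomial lt p \<Longrightarrow> lt \<nu> (initial_monomial lt p)"
proof -
  have ne: "Poly_Mapping.keys p \<noteq> {}"
    using \<open>p \<noteq> 0\<close> by (metis ex_in_conv in_keys_iff poly_mapping_eqI lookup_zero)
  have "\<exists>!\<mu>. \<mu> \<in> Poly_Mapping.keys p \<and> (\<forall>\<nu>\<in>Poly_Mapping.keys p. \<nu> \<noteq> \<mu> \<longrightarrow> lt \<nu> \<mu>)"
  proof (rule ex_ex1I)
    show "\<exists>\<mu>. \<mu> \<in> Poly_Mapping.keys p \<and> (\<forall>\<nu>\<in>Poly_Mapping.keys p. \<nu> \<noteq> \<mu> \<longrightarrow> lt \<nu> \<mu>)"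
      using finite_strict_order_has_greatest[OF assms(2,3) finite_keys ne assms(4)] by blast
  next
    fix \<mu> \<nu>
    assume "\<mu> \<in> Poly_Mapping.keys p \<and> (\<forall>\<nu>\<in>Poly_Mapping.keys p. \<nu> \<noteq> \<mu> \<longrightarrow> lt \<nu> \<mu>)"
      "\<nu> \<in> Poly_Mapping.keys p \<and> (\<forall>\<mu>\<in>Poly_Mapping.keys p. \<mu> \<noteq> \<nu> \<longrightarrow> lt \<mu> \<nu>)"
    then show "\<mu> = \<nu>"
      using assms(1,2,4) by (metis irreflp_onD subsetD transp_onD)
  qed
  from theI'[OF this] show "initial_monomial lt p \<in> Poly_Mapping.keys p"
    and "\<And>\<nu>. \<nu> \<in> Poly_Mapping.keys p \<Longrightarrow> \<nu> \<noteq> initial_monomial lt p \<Longrightarrow> lt \<nu> (initial_monomial lt p)"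
    unfolding initial_monomial_def by blast+
qed

lemma initial_monomial_eqI:
  assumes "irreflp_on A lt" "transp_on A lt" "Poly_Mapping.keys p \<subseteq> A"
    and "\<mu> \<in> Poly_Mapping.keys p" "\<And>\<nu>. \<nu> \<in> Poly_Mapping.keys p \<Longrightarrow> \<nu> \<noteq> \<mu> \<Longrightarrow> lt \<nu> \<mu>"
  shows "initial_monomial lt p = \<mu>"
  unfolding initial_monomial_def
proof (rule the_equality)
  show "\<mu> \<in> Poly_Mapping.keys p \<and> (\<forall>\<nu>\<in>Poly_Mapping.keys p. \<nu> \<noteq> \<mu> \<longrightarrow> lt \<nu> \<mu>)"
    using assms by blast
next
  fix \<nu> assume "\<nu> \<in> Poly_Mapping.keys p \<and> (\<forall>\<mu>\<in>Poly_Mapping.keys p. \<mu> \<noteq> \<nu> \<longrightarrow> lt \<mu> \<nu>)"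
  then show "\<nu> = \<mu>"
    using assms by (metis irreflp_onD subsetD transp_onD)
qed

lemma monomials_in_UNIV [simp]: "monomials_in UNIV = UNIV"
  by (simp add: monomials_in_def)

lemma monomial_order_strict:
  assumes "monomial_order V lt" 
  shows "irreflp_on (monomials_in V) lt" "transp_on (monomials_in V) lt" "totalp_on (monomials_in V) lt"
  using assms by (auto simp: monomial_order_def)

lemma monomial_order_plus_right:
  assumes "monomial_order V lt" "lt \<mu> \<nu>" "\<mu> \<in> monomials_in V" "\<nu> \<in> monomials_in V" "\<rho> \<in> monomials_in V"
  shows "lt (\<mu> + \<rho>) (\<nu> + \<rho>)"
  using assms by (auto simp: monomial_order_def)

context
  fixes lt :: "'x monomial \<Rightarrow> 'x monomial \<Rightarrow> bool"
  assumes order: "monomial_order UNIV lt"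
begin

lemmas initial_monomial_UNIV =
  initial_monomial[OF monomial_order_strict[OF order], simplified]

lemma order_trans_UNIV: "lt a b \<Longrightarrow> lt b c \<Longrightarrow> lt a c"
  using order by (auto simp: monomial_order_def dest: transpD)

lemma order_irrefl_UNIV: "\<not> lt a a"
  using order by (auto simp: monomial_order_def irreflp_on_def)

lemma order_plus_UNIV: "lt a b \<Longrightarrow> lt (a + c) (b + c)" "lt a b \<Longrightarrow> lt (c + a) (c + b)"
  using monomial_order_plus_right[OF order] by (simp_all add: add.commute)

text \<open>
The product of the initial monomials occurs in \<open>p * q\<close>, since every other product of two occurring
monomials is smaller.
\<close>

lemma mpoly_no_zero_divisors:
  fixes p q :: "('x, 'k::idom) mpoly"
  assumes "p \<noteq> 0" "q \<noteq> 0"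
  shows "p * q \<noteq> 0"
proof -
  define a b where "a = initial_monomial lt p" and "b = initial_monomial lt q"
  define c d where "c = Poly_Mapping.lookup p a" and "d = Poly_Mapping.lookup q b"
  define p' q' where "p' = p - Poly_Mapping.single a c" and "q' = q - Poly_Mapping.single b d"
  have cd: "c \<noteq> 0" "d \<noteq> 0"
    using initial_monomial_UNIV(1)[OF assms(1)] initial_monomial_UNIV(1)[OF assms(2)]
    by (auto simp: c_def d_def a_def b_def in_keys_iff)
  have p': "lt \<mu> a" if "\<mu> \<in> Poly_Mapping.keys p'" for \<mu>
  proof -
    have "\<mu> \<noteq> a" "\<mu> \<in> Poly_Mapping.keys p"
      using that by (auto simp: p'_def in_keys_iff lookup_minus lookup_single c_def when_def split: if_splits)
    then show ?thesis using initial_monomial_UNIV(2)[OF assms(1)] by (simp add: a_def)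
  qed
  have q': "lt \<mu> b" if "\<mu> \<in> Poly_Mapping.keys q'" for \<mu>
  proof -
    have "\<mu> \<noteq> b" "\<mu> \<in> Poly_Mapping.keys q"
      using that by (auto simp: q'_def in_keys_iff lookup_minus lookup_single d_def when_def split: if_splits)
    then show ?thesis using initial_monomial_UNIV(2)[OF assms(2)] by (simp add: b_def)
  qed
  have "a + b \<notin> Poly_Mapping.keys (Poly_Mapping.single a c * q')"
  proof
    assume "a + b \<in> Poly_Mapping.keys (Poly_Mapping.single a c * q')"
    then obtain \<nu> where "a + b = a + \<nu>" "\<nu> \<in> Poly_Mapping.keys q'"
      using keys_mult[of "Poly_Mapping.single a c" q'] by (auto split: if_splits)
    then show False using q' order_irrefl_UNIV by auto
  qed
  moreover have "a + b \<notin> Poly_Mapping.keys (p' * q)"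
  proof
    assume "a + b \<in> Poly_Mapping.keys (p' * q)"
    then obtain \<mu> \<nu> where *: "a + b = \<mu> + \<nu>" "\<mu> \<in> Poly_Mapping.keys p'" "\<nu> \<in> Poly_Mapping.keys q"
      using keys_mult[of p' q] by auto
    have "lt (\<mu> + \<nu>) (a + \<nu>)" using p' * order_plus_UNIV by blast
    moreover have "\<nu> = b \<or> lt (a + \<nu>) (a + b)"
      using initial_monomial_UNIV(2)[OF assms(2) *(3)] order_plus_UNIV(2) unfolding b_def by blast
    ultimately show False using * order_irrefl_UNIV order_trans_UNIV by metis
  qed
  moreover have "p * q = Poly_Mapping.single (a + b) (c * d) + Poly_Mapping.single a c * q' + p' * q"
    by (simp add: p'_def q'_def algebra_simps mult_single)
  ultimately have "Poly_Mapping.lookup (p * q) (a + b) = c * d"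
    by (simp add: lookup_add in_keys_iff)
  then show ?thesis using cd by auto
qed

text \<open>
Division with remainder. Subtracting a multiple of a suitable \<open>q\<close> from \<open>r\<close> removes the initial
monomial of \<open>r\<close>. As the elements of \<open>L\<close> are homogeneous, the subtracted multiple lives in the
degree of that monomial, so no degree above those of \<open>r\<close> appears and the division takes place among
finitely many monomials, which is why it terminates.
\<close>

lemma ideal_gen_of_leading_terms:
  fixes C :: "('x, 'k::field) mpoly set"
  assumes fin: "finite (UNIV :: 'x set)" and C: "is_ideal C" "L \<subseteq> C" and hom: "\<forall>l\<in>L. \<exists>d. homogeneous d l"
    and lead: "\<And>r. r \<in> C \<Longrightarrow> r \<noteq> 0 \<Longrightarrow>
      \<exists>q\<in>L. q \<noteq> 0 \<and> (\<exists>a. initial_monomial lt r = a + initial_monomial lt q)"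
  shows "C = ideal_gen L"
proof
  show "ideal_gen L \<subseteq> C" using C by (simp add: ideal_gen_subset_iff)
  have "r \<in> ideal_gen L" if "r \<in> C" "\<forall>\<mu>\<in>Poly_Mapping.keys r. mdeg \<mu> \<le> D" for r D
    using that
  \<comment> \<open>The measure counts the monomials of degree at most \<open>D\<close> that do not exceed the initial monomial.\<close>
  proof (induction "card {\<mu>. mdeg \<mu> \<le> D \<and> (\<exists>\<nu>\<in>Poly_Mapping.keys r. \<mu> = \<nu> \<or> lt \<mu> \<nu>)}"
      arbitrary: r rule: less_induct)
    case less
    show ?case
    proof (cases "r = 0")
      case True
      then show ?thesis by (simp add: ideal.span_zero)
    next
      case False
      from lead[OF less(2) False] obtain q a where q: "q \<in> L" "q \<noteq> 0"
        and a: "initial_monomial lt r = a + initial_monomial lt q" by blast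
      from hom q obtain d where d: "homogeneous d q" by blast
      define u v where "u = initial_monomial lt q" and "v = initial_monomial lt r"
      have u: "u \<in> Poly_Mapping.keys q" "\<And>\<nu>. \<nu> \<in> Poly_Mapping.keys q \<Longrightarrow> \<nu> \<noteq> u \<Longrightarrow> lt \<nu> u"
        using initial_monomial_UNIV[OF q(2)] by (auto simp: u_def)
      have v: "v \<in> Poly_Mapping.keys r" "\<And>\<nu>. \<nu> \<in> Poly_Mapping.keys r \<Longrightarrow> \<nu> \<noteq> v \<Longrightarrow> lt \<nu> v"
        using initial_monomial_UNIV[OF False] by (auto simp: v_def)
      have vau: "v = a + u" using a by (simp add: u_def v_def)
      define c where "c = Poly_Mapping.lookup r v / Poly_Mapping.lookup q u"
      define s where "s = Poly_Mapping.single a c * q"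
      have lookup_s: "Poly_Mapping.lookup s v = Poly_Mapping.lookup r v"
      proof -
        define q' where "q' = q - Poly_Mapping.single u (Poly_Mapping.lookup q u)"
        have "v \<notin> Poly_Mapping.keys (Poly_Mapping.single a c * q')"
        proof
          assume "v \<in> Poly_Mapping.keys (Poly_Mapping.single a c * q')"
          then obtain \<nu> where \<nu>: "v = a + \<nu>" "\<nu> \<in> Poly_Mapping.keys q'"
            using keys_mult[of "Poly_Mapping.single a c" q'] by (auto split: if_splits)
          then have "u \<in> Poly_Mapping.keys q'" using vau by simp
          then show False by (simp add: q'_def in_keys_iff lookup_minus)
        qed
        moreover have "s = Poly_Mapping.single v (c * Poly_Mapping.lookup q u) + Poly_Mapping.single a c * q'"
          by (simp add: s_def q'_def algebra_simps mult_single vau)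
        ultimately show ?thesis
          using u by (simp add: lookup_add in_keys_iff c_def)
      qed
      have keys_s: "mdeg \<mu> \<le> D \<and> (\<mu> = v \<or> lt \<mu> v)" if \<mu>: "\<mu> \<in> Poly_Mapping.keys s" for \<mu>
      proof -
        from \<mu> obtain \<nu> where \<nu>: "\<mu> = a + \<nu>" "\<nu> \<in> Poly_Mapping.keys q"
          using keys_mult[of "Poly_Mapping.single a c" q] by (auto simp: s_def split: if_splits)
        have "mdeg \<mu> = mdeg v" using \<nu> d u(1) by (simp add: vau homogeneous_def)
        moreover have "mdeg v \<le> D" using less(3) v(1) by blast
        moreover have "\<mu> = v \<or> lt \<mu> v" using u(2)[OF \<nu>(2)] order_plus_UNIV(2) unfolding \<nu>(1) vau by blast
        ultimately show ?thesis by simp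
      qed
      define r' where "r' = r - s"
      have keys_r': "mdeg \<mu> \<le> D \<and> lt \<mu> v" if "\<mu> \<in> Poly_Mapping.keys r'" for \<mu>
      proof -
        have "\<mu> \<noteq> v" using that lookup_s by (auto simp: r'_def in_keys_iff lookup_minus)
        moreover have "\<mu> \<in> Poly_Mapping.keys r \<or> \<mu> \<in> Poly_Mapping.keys s"
          using that keys_diff by (auto simp: r'_def in_keys_iff lookup_minus)
        ultimately show ?thesis using keys_s v(2) less(3) by blast
      qed
      have s: "s \<in> ideal_gen L" unfolding s_def using q by (intro ideal.span_scale ideal.span_base)
      then have "s \<in> C" using \<open>ideal_gen L \<subseteq> C\<close> by blast
      then have "r' \<in> C" using less(2) C(1) by (auto simp: r'_def intro: ideal.subspace_diff)
      let ?F = "\<lambda>r. {\<mu>. mdeg \<mu> \<le> D \<and> (\<exists>\<nu>\<in>Poly_Mapping.keys r. \<mu> = \<nu> \<or> lt \<mu> \<nu>)}"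
      have "finite (?F r)"
        by (rule finite_subset[OF _ finite_monomials[OF fin, of D]]) auto
      moreover have "?F r' \<subseteq> ?F r"
        using keys_r' v(1) order_trans_UNIV by blast
      moreover have "v \<in> ?F r" using v(1) less(3) by blast
      moreover have "v \<notin> ?F r'"
        using keys_r' order_irrefl_UNIV order_trans_UNIV by blast
      ultimately have "card (?F r') < card (?F r)"
        by (metis (no_types, lifting) psubsetI psubset_card_mono)
      from less(1)[OF this \<open>r' \<in> C\<close>] keys_r' have "r' \<in> ideal_gen L" by blast
      moreover have "r = r' + s" by (simp add: r'_def)
      ultimately show ?thesis using s by (simp add: ideal.span_add)
    qed
  qed
  moreover have "\<exists>D. \<forall>\<mu>\<in>Poly_Mapping.keys r. mdeg \<mu> \<le> D" for r :: "('x, 'k) mpoly"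
    using finite_nat_set_iff_bounded_le[of "mdeg ` Poly_Mapping.keys r"] by auto
  ultimately show "C \<subseteq> ideal_gen L" by blast
qed

end

\<comment> \<open>Variables are the polynomials \<open>single (single v 1) 1\<close>; rewriting the exponent to \<open>Suc 0\<close> hides them
  from the lemmas about them.\<close>
declare One_nat_def [simp del]

section \<open>Ideals generated by linear forms\<close>

definition monomial_value :: "('v \<Rightarrow> 'r::comm_ring_1) \<Rightarrow> 'v monomial \<Rightarrow> 'r" where
  "monomial_value g \<mu> = (\<Prod>v\<in>Poly_Mapping.keys \<mu>. g v ^ Poly_Mapping.lookup \<mu> v)"

lemma monomial_value_superset:
  assumes "finite V" "Poly_Mapping.keys \<mu> \<subseteq> V"
  shows "monomial_value g \<mu> = (\<Prod>v\<in>V. g v ^ Poly_Mapping.lookup \<mu> v)"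
  unfolding monomial_value_def using assms
  by (intro prod.mono_neutral_left) (auto simp: in_keys_iff)

lemma monomial_value_plus:
  "monomial_value g (\<mu> + \<nu>) = monomial_value g \<mu> * monomial_value g \<nu>"
proof -
  let ?V = "Poly_Mapping.keys \<mu> \<union> Poly_Mapping.keys \<nu>"
  have "monomial_value g (\<mu> + \<nu>) = (\<Prod>v\<in>?V. g v ^ Poly_Mapping.lookup (\<mu> + \<nu>) v)"
    by (simp add: monomial_value_def keys_plus_nat)
  also have "\<dots> = (\<Prod>v\<in>?V. g v ^ Poly_Mapping.lookup \<mu> v) * (\<Prod>v\<in>?V. g v ^ Poly_Mapping.lookup \<nu> v)"
    by (simp add: lookup_add power_add prod.distrib)
  also have "\<dots> = monomial_value g \<mu> * monomial_value g \<nu>"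
    by (simp add: monomial_value_superset[of ?V])
  finally show ?thesis .
qed

lemma monomial_value_0 [simp]: "monomial_value g 0 = 1"
  by (simp add: monomial_value_def)

lemma monomial_value_single [simp]: "monomial_value g (Poly_Mapping.single v n) = g v ^ n"
  by (simp add: monomial_value_def)

abbreviation mconst :: "'k \<Rightarrow> ('v, 'k::zero) mpoly" where
  "mconst \<equiv> Poly_Mapping.single 0"

abbreviation mvar :: "'v \<Rightarrow> ('v, 'k::zero_neq_one) mpoly" where
  "mvar v \<equiv> Poly_Mapping.single (Poly_Mapping.single v 1) 1"

definition msubst :: "('v \<Rightarrow> ('w, 'k::comm_ring_1) mpoly) \<Rightarrow> ('v, 'k) mpoly \<Rightarrow> ('w, 'k) mpoly" where
  "msubst g p = (\<Sum>\<mu>\<in>Poly_Mapping.keys p. mconst (Poly_Mapping.lookup p \<mu>) * monomial_value g \<mu>)"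

lemma msubst_superset:
  assumes "finite K" "Poly_Mapping.keys p \<subseteq> K"
  shows "msubst g p = (\<Sum>\<mu>\<in>K. mconst (Poly_Mapping.lookup p \<mu>) * monomial_value g \<mu>)"
  unfolding msubst_def using assms
  by (intro sum.mono_neutral_left) (auto simp: in_keys_iff)

lemma msubst_add: "msubst g (p + q) = msubst g p + msubst g q"
proof -
  let ?K = "Poly_Mapping.keys p \<union> Poly_Mapping.keys q"
  have "Poly_Mapping.keys (p + q) \<subseteq> ?K" by (rule keys_add)
  then have "msubst g (p + q) = (\<Sum>\<mu>\<in>?K. mconst (Poly_Mapping.lookup (p + q) \<mu>) * monomial_value g \<mu>)"
    by (intro msubst_superset) auto
  also have "\<dots> = (\<Sum>\<mu>\<in>?K. mconst (Poly_Mapping.lookup p \<mu>) * monomial_value g \<mu>)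
      + (\<Sum>\<mu>\<in>?K. mconst (Poly_Mapping.lookup q \<mu>) * monomial_value g \<mu>)"
    by (simp add: lookup_add single_add distrib_right sum.distrib)
  also have "\<dots> = msubst g p + msubst g q"
    by (simp add: msubst_superset[of ?K])
  finally show ?thesis .
qed

lemma msubst_0 [simp]: "msubst g 0 = 0"
  by (simp add: msubst_def)

lemma msubst_sum: "msubst g (sum f A) = (\<Sum>i\<in>A. msubst g (f i))"
  by (induction A rule: infinite_finite_induct) (simp_all add: msubst_add)

lemma msubst_single: "msubst g (Poly_Mapping.single \<mu> a) = mconst a * monomial_value g \<mu>"
  by (cases "a = 0") (simp_all add: msubst_def)

text \<open>
With \<open>msubst_add\<close> and \<open>msubst_const\<close>: substituting polynomials for the variables is an algebra
homomorphism.
\<close>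

lemma msubst_mult: "msubst g (p * q) = msubst g p * msubst g q"
proof -
  have 1: "msubst g (Poly_Mapping.single \<mu> a * Poly_Mapping.single \<nu> b)
      = msubst g (Poly_Mapping.single \<mu> a) * msubst g (Poly_Mapping.single \<nu> b)" for \<mu> \<nu> a b
  proof -
    have "msubst g (Poly_Mapping.single \<mu> a * Poly_Mapping.single \<nu> b)
        = mconst (a * b) * (monomial_value g \<mu> * monomial_value g \<nu>)"
      by (simp add: mult_single msubst_single monomial_value_plus)
    also have "mconst (a * b) = mconst a * mconst b" by (simp add: mult_single)
    finally show ?thesis by (simp only: msubst_single ac_simps)
  qed
  have "p * q = (\<Sum>\<mu>\<in>Poly_Mapping.keys p. Poly_Mapping.single \<mu> (Poly_Mapping.lookup p \<mu>)) *
      (\<Sum>\<mu>\<in>Poly_Mapping.keys q. Poly_Mapping.single \<mu> (Poly_Mapping.lookup q \<mu>))"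
    by (simp flip: poly_mapping_sum_singles)
  also have "msubst g \<dots> =
      msubst g (\<Sum>\<mu>\<in>Poly_Mapping.keys p. Poly_Mapping.single \<mu> (Poly_Mapping.lookup p \<mu>)) *
      msubst g (\<Sum>\<mu>\<in>Poly_Mapping.keys q. Poly_Mapping.single \<mu> (Poly_Mapping.lookup q \<mu>))"
    by (simp add: sum_product msubst_sum 1)
  also have "\<dots> = msubst g p * msubst g q"
    by (simp flip: poly_mapping_sum_singles)
  finally show ?thesis .
qed

lemma msubst_const [simp]: "msubst g (mconst a) = mconst a"
  by (simp add: msubst_single)

lemma msubst_var [simp]: "msubst g (mvar v) = g v"
  by (simp add: msubst_single)

lemma single_conv_vars:
  "Poly_Mapping.single \<mu> a = mconst a * monomial_value mvar (\<mu> :: 'v monomial)" for a :: "'k::comm_ring_1"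
proof (induction "mdeg \<mu>" arbitrary: \<mu>)
  case 0
  then show ?case by simp
next
  case (Suc n)
  then have "Poly_Mapping.keys \<mu> \<noteq> {}" by auto
  then obtain v where "v \<in> Poly_Mapping.keys \<mu>" by blast
  then have \<mu>: "\<mu> = Poly_Mapping.single v 1 + (\<mu> - Poly_Mapping.single v 1)"
    by (rule monomial_remove_var)
  define \<nu> where "\<nu> = \<mu> - Poly_Mapping.single v 1"
  have \<mu>: "\<mu> = Poly_Mapping.single v 1 + \<nu>" using \<mu> by (simp add: \<nu>_def)
  have "Poly_Mapping.single \<nu> a = mconst a * monomial_value mvar \<nu>"
    by (rule Suc.hyps(1)) (use Suc.hyps(2) \<mu> in simp)
  moreover have "Poly_Mapping.single \<mu> a = mvar v * Poly_Mapping.single \<nu> a"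
    by (simp add: \<mu> mult_single)
  ultimately show ?case by (simp add: \<mu> monomial_value_plus ac_simps)
qed

lemma mpoly_induct [case_names const var add mult]:
  fixes p :: "('v, 'k::comm_ring_1) mpoly"
  assumes const: "\<And>a. P (mconst a)" and var: "\<And>v. P (mvar v)"
    and add: "\<And>p q. P p \<Longrightarrow> P q \<Longrightarrow> P (p + q)"
    and mult: "\<And>p q. P p \<Longrightarrow> P q \<Longrightarrow> P (p * q)"
  shows "P p"
proof -
  have P1: "P 1" using const[of 1] by simp
  have pow: "P (mvar v ^ n)" for v n
    by (induction n) (auto intro: P1 var mult)
  have prod: "P (\<Prod>v\<in>V. mvar v ^ f v)" for V f
    by (induction V rule: infinite_finite_induct) (auto intro: P1 mult pow)
  have single: "P (Poly_Mapping.single \<mu> a)" for \<mu> a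
    by (subst single_conv_vars) (unfold monomial_value_def, intro mult const prod)
  have P0: "P 0" using const[of 0] by simp
  have sum: "P (\<Sum>\<mu>\<in>M. Poly_Mapping.single \<mu> (c \<mu>))" for M c
    by (induction M rule: infinite_finite_induct) (auto intro: P0 add single)
  show ?thesis by (subst poly_mapping_sum_singles) (rule sum)
qed

lemma linear_form_sum_vars:
  fixes l :: "('x::finite, 'k::comm_ring_1) mpoly"
  assumes "homogeneous 1 l"
  shows "l = (\<Sum>v\<in>UNIV. mconst (Poly_Mapping.lookup l (Poly_Mapping.single v 1)) * mvar v)"
proof (rule poly_mapping_eqI)
  fix \<mu>
  let ?s = "\<Sum>v\<in>UNIV. mconst (Poly_Mapping.lookup l (Poly_Mapping.single v 1)) * mvar v"
  have s: "Poly_Mapping.lookup ?s \<mu> =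
      (\<Sum>v\<in>UNIV. if Poly_Mapping.single v 1 = \<mu> then Poly_Mapping.lookup l \<mu> else 0)"
    unfolding lookup_sum by (rule sum.cong) (auto simp: mult_single lookup_single)
  show "Poly_Mapping.lookup l \<mu> = Poly_Mapping.lookup ?s \<mu>"
  proof (cases "\<exists>v. \<mu> = Poly_Mapping.single v 1")
    case True
    then obtain w where w: "\<mu> = Poly_Mapping.single w 1" by blast
    have "Poly_Mapping.single v (1::nat) = \<mu> \<longleftrightarrow> v = w" for v
      unfolding w by (metis lookup_single_eq lookup_single_not_eq zero_neq_one)
    then show ?thesis by (simp add: s)
  next
    case False
    then have "mdeg \<mu> \<noteq> 1" using mdeg_1_single by blast
    then have "Poly_Mapping.lookup l \<mu> = 0"
      using assms by (auto simp: homogeneous_def in_keys_iff)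
    moreover have "Poly_Mapping.single v 1 \<noteq> \<mu>" for v using False by auto
    ultimately show ?thesis by (simp add: s)
  qed
qed

lemma homogeneous_const [simp]: "homogeneous 0 (mconst a)"
  by (auto simp: homogeneous_def split: if_splits)

lemma homogeneous_var [simp]: "homogeneous 1 (mvar v)"
  by (auto simp: homogeneous_def)

lemma homogeneous_const_mult: "homogeneous d p \<Longrightarrow> homogeneous d (mconst a * p)"
  for p :: "('v, 'k::comm_ring_1) mpoly"
  using homogeneous_mult[of 0 "mconst a" d p] by simp

lemma homogeneous_minus: "homogeneous d p \<Longrightarrow> homogeneous d (- p)"
  for p :: "('v, 'k::comm_ring_1) mpoly"
  by (simp add: homogeneous_def in_keys_iff)

lemma homogeneous_diff: "homogeneous d p \<Longrightarrow> homogeneous d q \<Longrightarrow> homogeneous d (p - q)"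
  for p q :: "('v, 'k::comm_ring_1) mpoly"
  using homogeneous_add[of d p "- q"] homogeneous_minus[of d q] by simp

lemma lookup_const_mult: "Poly_Mapping.lookup (mconst a * p) \<mu> = a * Poly_Mapping.lookup p \<mu>"
  for p :: "('v, 'k::comm_ring_1) mpoly"
  by (simp add: map.rep_eq when_def flip: mult_map_scale_conv_mult)

text \<open>
\<open>\<phi>\<close> plays the role of the quotient map modulo \<open>P\<close>: an endomorphism of the polynomial ring with kernel
\<open>P\<close> that moves no element out of its class modulo \<open>P\<close>. It arises by solving linear forms of \<open>P\<close> for
the variables in \<open>U\<close>, which then no longer occur in the images of linear forms.
\<close>

definition eliminates :: "'x set \<Rightarrow> (('x, 'k::comm_ring_1) mpoly \<Rightarrow> ('x, 'k) mpoly) \<Rightarrow> ('x, 'k) mpoly set \<Rightarrow> bool" where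
  "eliminates U \<phi> P \<longleftrightarrow>
     (\<forall>p q. \<phi> (p + q) = \<phi> p + \<phi> q) \<and> (\<forall>p q. \<phi> (p * q) = \<phi> p * \<phi> q) \<and>
     (\<forall>p. p - \<phi> p \<in> P) \<and> (\<forall>p\<in>P. \<phi> p = 0) \<and>
     (\<forall>l. homogeneous 1 l \<longrightarrow> homogeneous 1 (\<phi> l) \<and> (\<forall>u\<in>U. Poly_Mapping.lookup (\<phi> l) (Poly_Mapping.single u 1) = 0))"

text \<open>
The image \<open>\<phi> l\<close> is a nonzero linear form in variables outside \<open>U\<close>. Solving it for one of its
variables and substituting the result eliminates that variable.
\<close>

lemma eliminates_step:
  fixes l :: "('x::finite, 'k::field) mpoly"
  assumes elim: "eliminates U \<phi> P" and P: "is_ideal P" and l: "homogeneous 1 l" "l \<notin> P"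
  shows "\<exists>i \<psi>. i \<notin> U \<and> eliminates (insert i U) \<psi> (ideal_gen (insert l P))"
proof -
  define l' where "l' = \<phi> l"
  have add: "\<phi> (p + q) = \<phi> p + \<phi> q" and mult: "\<phi> (p * q) = \<phi> p * \<phi> q"
    and red: "p - \<phi> p \<in> P" and ker: "p \<in> P \<Longrightarrow> \<phi> p = 0" for p q
    using elim by (auto simp: eliminates_def)
  have lin: "homogeneous 1 h \<Longrightarrow> homogeneous 1 (\<phi> h)"
    "homogeneous 1 h \<Longrightarrow> u \<in> U \<Longrightarrow> Poly_Mapping.lookup (\<phi> h) (Poly_Mapping.single u 1) = 0" for h u
    using elim by (auto simp: eliminates_def)
  have "l' \<noteq> 0" using red[of l] l(2) by (auto simp: l'_def)
  have l'hom: "homogeneous 1 l'" using lin l by (simp add: l'_def)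
  from \<open>l' \<noteq> 0\<close> obtain \<mu> where \<mu>: "\<mu> \<in> Poly_Mapping.keys l'"
    by (metis in_keys_iff lookup_zero poly_mapping_eqI)
  with l'hom have "mdeg \<mu> = 1" by (simp add: homogeneous_def)
  then obtain i where i: "\<mu> = Poly_Mapping.single i 1" using mdeg_1_single by blast
  define c where "c = Poly_Mapping.lookup l' (Poly_Mapping.single i 1)"
  have "c \<noteq> 0" using \<mu> i by (simp add: c_def in_keys_iff)
  have "i \<notin> U" using lin(2)[OF l(1)] \<open>c \<noteq> 0\<close> by (auto simp: c_def l'_def)
  \<comment> \<open>the substitution that solves \<open>l' = 0\<close> for \<open>x\<^sub>i\<close>\<close>
  define g where "g v = (if v = i then mvar i - mconst (1 / c) * l' else mvar v)" for v
  define \<psi> where "\<psi> = msubst g"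
  have \<psi>_lin: "\<psi> h = h - mconst (Poly_Mapping.lookup h (Poly_Mapping.single i 1) / c) * l'"
    if "homogeneous 1 h" for h
  proof -
    let ?h = "\<lambda>v. Poly_Mapping.lookup h (Poly_Mapping.single v 1)"
    have "\<psi> h = \<psi> (\<Sum>v\<in>UNIV. mconst (?h v) * mvar v)"
      using linear_form_sum_vars[OF that] by simp
    also have "\<dots> = (\<Sum>v\<in>UNIV. mconst (?h v) * g v)"
      by (simp add: \<psi>_def msubst_sum msubst_mult)
    also have "\<dots> = (\<Sum>v\<in>UNIV. mconst (?h v) * mvar v - (if v = i then mconst (?h i / c) * l' else 0))"
    proof (rule sum.cong)
      fix v
      have "mconst (?h i) * (mconst (1 / c) * l') = mconst (?h i / c) * l'"
        by (simp add: mult_single flip: mult.assoc)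
      then show "mconst (?h v) * g v = mconst (?h v) * mvar v - (if v = i then mconst (?h i / c) * l' else 0)"
        by (simp add: g_def right_diff_distrib)
    qed simp
    also have "\<dots> = h - mconst (?h i / c) * l'"
      by (simp add: sum_subtractf flip: linear_form_sum_vars[OF that])
    finally show ?thesis .
  qed
  have \<psi>_red: "p - \<psi> p \<in> ideal_gen {l'}" for p
  proof (induction p rule: mpoly_induct)
    case (const a)
    then show ?case by (simp add: \<psi>_def ideal.span_zero)
  next
    case (var v)
    have "mvar v - \<psi> (mvar v) = mvar v - g v" by (simp add: \<psi>_def)
    also have "\<dots> = (if v = i then mconst (1 / c) * l' else 0)" by (simp add: g_def)
    also have "\<dots> \<in> ideal_gen {l'}" by (simp add: ideal.span_zero ideal.span_scale ideal.span_base)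
    finally show ?case .
  next
    case (add p q)
    have "p + q - \<psi> (p + q) = (p - \<psi> p) + (q - \<psi> q)" by (simp add: \<psi>_def msubst_add)
    with add show ?case by (metis ideal.span_add)
  next
    case (mult p q)
    have "p * q - \<psi> (p * q) = q * (p - \<psi> p) + \<psi> p * (q - \<psi> q)"
      by (simp add: \<psi>_def msubst_mult algebra_simps)
    then show ?case using mult by (simp add: ideal.span_add ideal.span_scale)
  qed
  let ?P = "ideal_gen (insert l P)"
  have PP: "P \<subseteq> ?P" "l \<in> ?P" using ideal.span_superset by blast+
  have "l' \<in> ?P"
  proof -
    have "l - (l - \<phi> l) \<in> ?P" using PP red[of l] by (blast intro: ideal.span_diff)
    then show ?thesis by (simp add: l'_def)
  qed
  then have l'P: "ideal_gen {l'} \<subseteq> ?P" by (simp add: ideal_gen_subset_iff)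
  have "eliminates (insert i U) (\<lambda>p. \<psi> (\<phi> p)) ?P"
    unfolding eliminates_def
  proof (intro conjI allI ballI impI)
    fix p q
    show "\<psi> (\<phi> (p + q)) = \<psi> (\<phi> p) + \<psi> (\<phi> q)" by (simp add: add \<psi>_def msubst_add)
    show "\<psi> (\<phi> (p * q)) = \<psi> (\<phi> p) * \<psi> (\<phi> q)" by (simp add: mult \<psi>_def msubst_mult)
    have "p - \<psi> (\<phi> p) = (p - \<phi> p) + (\<phi> p - \<psi> (\<phi> p))" by simp
    also have "\<dots> \<in> ?P"
      by (rule ideal.span_add) (use red[of p] \<psi>_red[of "\<phi> p"] PP l'P in blast)+
    finally show "p - \<psi> (\<phi> p) \<in> ?P" .
  next
    fix p assume "p \<in> ?P"
    have 0: "\<phi> 0 = 0" using add[of 0 0] by simp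
    have "is_ideal {p. \<psi> (\<phi> p) = 0}"
      by (rule is_idealI) (auto simp: 0 add mult \<psi>_def msubst_add msubst_mult)
    moreover have "insert l P \<subseteq> {p. \<psi> (\<phi> p) = 0}"
    proof -
      have "\<psi> l' = 0" using \<psi>_lin[OF l'hom] \<open>c \<noteq> 0\<close> by (simp add: c_def)
      then show ?thesis using ker by (auto simp: l'_def) (simp add: \<psi>_def)
    qed
    ultimately have "?P \<subseteq> {p. \<psi> (\<phi> p) = 0}" by (simp add: ideal_gen_subset_iff)
    with \<open>p \<in> ?P\<close> show "\<psi> (\<phi> p) = 0" by blast
  next
    fix h :: "('x, 'k) mpoly" assume h: "homogeneous 1 h"
    note h' = lin(1)[OF h]
    show "homogeneous 1 (\<psi> (\<phi> h))"
      unfolding \<psi>_lin[OF h'] using h' l'hom by (intro homogeneous_diff homogeneous_const_mult)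
    fix u assume "u \<in> insert i U"
    then show "Poly_Mapping.lookup (\<psi> (\<phi> h)) (Poly_Mapping.single u 1) = 0"
      unfolding \<psi>_lin[OF h'] using lin(2)[OF h, of u] lin(2)[OF l(1), of u] \<open>c \<noteq> 0\<close>
      by (auto simp: lookup_minus lookup_const_mult c_def l'_def)
  qed
  with \<open>i \<notin> U\<close> show ?thesis by blast
qed

text \<open>
Each step of the elimination uses up a variable, so the greedy choice of linear forms from \<open>L\<close> stops.
\<close>

lemma linear_ideal_extend_basis:
  fixes L :: "('x::finite, 'k::field) mpoly set"
  assumes "\<forall>l\<in>L. homogeneous 1 l" "set ls \<subseteq> L"
    and "\<forall>p<length ls. ls ! p \<notin> ideal_gen (set (take p ls))"
    and "eliminates U \<phi> (ideal_gen (set ls))"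
  shows "\<exists>ls U \<phi>. set ls \<subseteq> L \<and> ideal_gen (set ls) = ideal_gen L \<and>
    (\<forall>p<length ls. ls ! p \<notin> ideal_gen (set (take p ls))) \<and> eliminates U \<phi> (ideal_gen L)"
  using assms(2-)
proof (induction "card (UNIV - U)" arbitrary: ls U \<phi> rule: less_induct)
  case less
  show ?case
  proof (cases "L \<subseteq> ideal_gen (set ls)")
    case True
    then have "ideal_gen (set ls) = ideal_gen L"
      using less.prems(1) by (intro subset_antisym ideal.span_mono ideal.span_minimal ideal.subspace_span)
    with less.prems show ?thesis by (intro exI[of _ ls] exI[of _ U] exI[of _ \<phi>]) simp
  next
    case False
    then obtain l where l: "l \<in> L" "l \<notin> ideal_gen (set ls)" by blast
    obtain i \<psi> where i: "i \<notin> U" and \<psi>: "eliminates (insert i U) \<psi> (ideal_gen (insert l (ideal_gen (set ls))))"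
      using eliminates_step[OF less.prems(3) ideal.subspace_span] l assms(1) by blast
    have "ideal_gen (insert l (ideal_gen (set ls))) = ideal_gen (set (ls @ [l]))"
      using ideal_gen_Un_eq[of "set ls" "{l}"] by simp
    with \<psi> have \<psi>': "eliminates (insert i U) \<psi> (ideal_gen (set (ls @ [l])))" by simp
    have "card (UNIV - insert i U) < card (UNIV - U)"
      using i by (intro psubset_card_mono) auto
    moreover have "set (ls @ [l]) \<subseteq> L" using l less.prems by simp
    moreover have "\<forall>p<length (ls @ [l]). (ls @ [l]) ! p \<notin> ideal_gen (set (take p (ls @ [l])))"
      using less.prems(2) l by (auto simp: nth_append less_Suc_eq)
    ultimately show ?thesis using less.hyps \<psi>' by blast
  qed
qed

definition linear_ideal :: "('v, 'k::comm_ring_1) mpoly set \<Rightarrow> bool" where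
  "linear_ideal P \<longleftrightarrow> (\<exists>L. (\<forall>l\<in>L. homogeneous 1 l) \<and> P = ideal_gen L)"

lemma linear_ideal_basis:
  fixes P :: "('x::finite, 'k::field) mpoly set"
  assumes "linear_ideal P"
  obtains ls U \<phi> where "\<forall>l\<in>set ls. homogeneous 1 l" "P = ideal_gen (set ls)"
    "\<forall>p<length ls. ls ! p \<notin> ideal_gen (set (take p ls))" "eliminates U \<phi> P"
proof -
  obtain L where L: "\<forall>l\<in>L. homogeneous 1 l" "P = ideal_gen L"
    using assms by (auto simp: linear_ideal_def)
  have "eliminates {} (\<lambda>p. p) (ideal_gen (set []) :: ('x, 'k) mpoly set)"
    by (simp add: eliminates_def)
  from linear_ideal_extend_basis[OF L(1) _ _ this] obtain ls U \<phi> where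
    "set ls \<subseteq> L" "ideal_gen (set ls) = ideal_gen L"
    "\<forall>p<length ls. ls ! p \<notin> ideal_gen (set (take p ls))" "eliminates U \<phi> (ideal_gen L)"
    by auto
  then show ?thesis
    using L by (intro that[of ls U \<phi>]) auto
qed

text \<open>
The quotient by \<open>P\<close> is embedded into the polynomial ring by the map of \<open>eliminates\<close>, hence a domain.
\<close>

lemma linear_ideal_prime:
  fixes P :: "('x::finite, 'k::field) mpoly set"
  assumes "monomial_order UNIV (lt :: 'x monomial \<Rightarrow> _)" and "linear_ideal P" "r * s \<in> P"
  shows "r \<in> P \<or> s \<in> P"
proof -
  obtain U \<phi> where "eliminates U \<phi> P" by (rule linear_ideal_basis[OF assms(2)])
  then have \<phi>: "\<phi> (r * s) = \<phi> r * \<phi> s" "r - \<phi> r \<in> P" "s - \<phi> s \<in> P" "\<phi> (r * s) = 0"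
    using assms(3) by (auto simp: eliminates_def)
  then have "\<phi> r = 0 \<or> \<phi> s = 0" using mpoly_no_zero_divisors[OF assms(1), of "\<phi> r" "\<phi> s"] by force
  with \<phi>(2,3) show ?thesis by auto
qed

lemma is_ideal_linear_ideal: "linear_ideal P \<Longrightarrow> is_ideal P"
  by (auto simp: linear_ideal_def)

lemma linear_ideal_insert:
  assumes "linear_ideal P" "homogeneous 1 l"
  shows "linear_ideal (ideal_gen (insert l P))"
proof -
  obtain L where L: "\<forall>l\<in>L. homogeneous 1 l" "P = ideal_gen L"
    using assms by (auto simp: linear_ideal_def)
  have "ideal_gen (insert l P) = ideal_gen (insert l L)"
    using ideal_gen_Un_eq[of L "{l}"] L by simp
  then show ?thesis
    unfolding linear_ideal_def using L(1) assms(2) by (intro exI[of _ "insert l L"]) auto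
qed

text \<open>
The form in which primeness is used: an element added to \<open>P\<close> is either redundant or has \<open>P\<close> itself
as its colon ideal.
\<close>

lemma linear_ideal_colon:
  fixes P :: "('x::finite, 'k::field) mpoly set"
  assumes "monomial_order UNIV (lt :: 'x monomial \<Rightarrow> _)" and "linear_ideal P"
  shows "colon P l = (if l \<in> P then UNIV else P)"
proof -
  have "r \<in> P \<Longrightarrow> r * l \<in> P" "l \<in> P \<Longrightarrow> r * l \<in> P" for r
    using is_ideal_linear_ideal[OF assms(2)] by (blast intro: ideal_mult_right ideal.subspace_scale)+
  then show ?thesis using linear_ideal_prime[OF assms] by (auto simp: colon_def)
qed

section \<open>Truncations of ideals with linear quotients\<close>

lemma ideal_gen_insert_ideal_gen: "ideal_gen (insert g (ideal_gen A)) = ideal_gen (insert g A)"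
  using ideal_gen_Un_eq[of A "{g}"] by simp

lemma mem_ideal_gen_insert: "is_ideal N \<Longrightarrow> p \<in> ideal_gen (insert g N) \<longleftrightarrow> (\<exists>k. p - k * g \<in> N)"
  by (simp add: ideal.span_insert ideal.span_eq_iff[THEN iffD2])

lemma mem_ideal_gen_vars:
  fixes p :: "('v, 'k::comm_ring_1) mpoly"
  assumes "Poly_Mapping.lookup p 0 = 0"
  shows "p \<in> ideal_gen (range mvar)"
proof -
  have "Poly_Mapping.single \<mu> a \<in> ideal_gen (range mvar)" if "\<mu> \<noteq> 0" for \<mu> :: "'v monomial" and a :: 'k
  proof -
    from that have "Poly_Mapping.keys \<mu> \<noteq> {}" by auto
    then obtain v where "v \<in> Poly_Mapping.keys \<mu>" by blast
    then have "\<mu> = (\<mu> - Poly_Mapping.single v 1) + Poly_Mapping.single v 1"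
      using monomial_remove_var by (metis add.commute)
    then have "Poly_Mapping.single \<mu> a = Poly_Mapping.single (\<mu> - Poly_Mapping.single v 1) a * mvar v"
      by (metis mult.right_neutral mult_single)
    then show ?thesis by (simp add: ideal.span_scale ideal.span_base)
  qed
  moreover have "\<mu> \<noteq> 0" if "\<mu> \<in> Poly_Mapping.keys p" for \<mu>
    using that assms by (auto simp: in_keys_iff)
  ultimately show ?thesis
    by (subst poly_mapping_sum_singles) (rule ideal.span_sum, blast)
qed

definition truncation :: "nat \<Rightarrow> ('v, 'k::zero) mpoly set \<Rightarrow> ('v, 'k) mpoly set" where
  "truncation j M = {p \<in> M. \<forall>\<mu>\<in>Poly_Mapping.keys p. j \<le> mdeg \<mu>}"

lemma keys_mult_mdeg_ge:
  fixes p q :: "('v, 'k::comm_ring_1) mpoly"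
  assumes "\<forall>\<mu>\<in>Poly_Mapping.keys p. j \<le> mdeg \<mu>"
  shows "\<forall>\<mu>\<in>Poly_Mapping.keys (q * p). j \<le> mdeg \<mu>"
  using keys_mult[of q p] assms by (fastforce intro: trans_le_add2)

lemma is_ideal_truncation:
  assumes "is_ideal M"
  shows "is_ideal (truncation j M)"
proof (rule is_idealI)
  show "0 \<in> truncation j M"
    using ideal.subspace_0[OF assms] by (simp add: truncation_def)
  show "p + q \<in> truncation j M" if "p \<in> truncation j M" "q \<in> truncation j M" for p q
    using that ideal.subspace_add[OF assms] keys_add[of p q] by (auto simp: truncation_def)
  show "r * p \<in> truncation j M" if "p \<in> truncation j M" for r p
    using that ideal.subspace_scale[OF assms] keys_mult_mdeg_ge[of p j r] by (auto simp: truncation_def)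
qed

lemma graded_ideal_insert:
  assumes "graded_ideal M" "homogeneous d g"
  shows "graded_ideal (ideal_gen (insert g M))"
proof -
  have M: "is_ideal M" using assms(1) by (simp add: graded_ideal_iff)
  show ?thesis
    unfolding graded_ideal_iff
  proof (intro conjI ballI allI)
    fix p e assume "p \<in> ideal_gen (insert g M)"
    then obtain k where "p - k * g \<in> M" using M by (auto simp: mem_ideal_gen_insert)
    then have "graded_part e 0 (p - k * g) \<in> M" using assms(1) by (simp add: graded_ideal_iff)
    moreover have "graded_part e 0 p = graded_part e 0 (p - k * g) + graded_part e 0 (k * g)"
      by (simp flip: graded_part_add)
    ultimately have "graded_part e 0 p - graded_part e d k * g \<in> M"
      using graded_part_mult[OF assms(2), of e 0 k] by simp
    then show "graded_part e 0 p \<in> ideal_gen (insert g M)"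
      using M by (auto simp: mem_ideal_gen_insert)
  qed simp
qed

text \<open>
A filtration from \<open>P\<close> up to \<open>Q\<close> whose successive quotients are cyclic, generated in degree \<open>j\<close> and
annihilated by exactly an ideal generated by linear forms. Unlike a list of generators, such chains
can be composed directly.
\<close>

inductive linear_chain :: "nat \<Rightarrow> ('v, 'k::comm_ring_1) mpoly set \<Rightarrow> ('v, 'k) mpoly set \<Rightarrow> bool" for j P where
  refl: "linear_chain j P P"
| step: "linear_chain j P Q \<Longrightarrow> homogeneous j g \<Longrightarrow> linear_ideal (colon Q g) \<Longrightarrow>
    linear_chain j P (ideal_gen (insert g Q))"

lemma linear_chain_trans:
  assumes "linear_chain j Q R" "linear_chain j P Q"
  shows "linear_chain j P R"
  using assms by (induction rule: linear_chain.induct) (auto intro: linear_chain.step)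

lemma linear_chain_list:
  assumes "linear_chain j P Q" "is_ideal P"
  shows "\<exists>hs. (\<forall>h\<in>set hs. homogeneous j h) \<and> Q = ideal_gen (P \<union> set hs) \<and>
    (\<forall>i<length hs. linear_ideal (colon (ideal_gen (P \<union> set (take i hs))) (hs ! i)))"
  using assms
proof (induction rule: linear_chain.induct)
  case refl
  then show ?case by (intro exI[of _ "[]"]) (simp add: ideal.span_eq_iff[THEN iffD2])
next
  case (step Q g)
  then obtain hs where hs: "\<forall>h\<in>set hs. homogeneous j h" "Q = ideal_gen (P \<union> set hs)"
    "\<forall>i<length hs. linear_ideal (colon (ideal_gen (P \<union> set (take i hs))) (hs ! i))" by blast
  have "ideal_gen (insert g Q) = ideal_gen (P \<union> set (hs @ [g]))"
    by (simp add: hs(2) ideal_gen_insert_ideal_gen)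
  with hs step.hyps show ?case
    by (intro exI[of _ "hs @ [g]"]) (auto simp: nth_append less_Suc_eq)
qed

text \<open>
Adding \<open>x g\<close> to \<open>N\<close> adds exactly \<open>x\<close> to the annihilator of \<open>g\<close> modulo \<open>N\<close>.
\<close>

lemma colon_insert_multiple:
  assumes "is_ideal N"
  shows "colon (ideal_gen (insert (x * g) N)) g = ideal_gen (insert x (colon N g))"
proof -
  have "r * g - k * (x * g) \<in> N \<longleftrightarrow> r - k * x \<in> colon N g" for r k
    by (simp add: colon_def algebra_simps)
  then show ?thesis
    using assms is_ideal_colon[OF assms, of g]
    by (auto simp: colon_def[of "ideal_gen _"] mem_ideal_gen_insert)
qed

lemma truncation_insert_top_degree:
  assumes M: "is_ideal M" and g: "homogeneous j g"
  shows "truncation j (ideal_gen (insert g M)) = ideal_gen (insert g (truncation j M))" (is "?A = ?B")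
proof
  have kg: "\<forall>\<mu>\<in>Poly_Mapping.keys (k * g). j \<le> mdeg \<mu>" for k
    by (rule keys_mult_mdeg_ge) (use g in \<open>simp add: homogeneous_def\<close>)
  have "truncation j M \<subseteq> ?A"
    using ideal.span_superset[of "insert g M"] by (auto simp: truncation_def)
  moreover have "g \<in> ?A"
    using ideal.span_superset[of "insert g M"] kg[of 1] by (auto simp: truncation_def)
  ultimately show "?B \<subseteq> ?A"
    by (simp add: ideal_gen_subset_iff is_ideal_truncation)
  show "?A \<subseteq> ?B"
  proof
    fix p assume p: "p \<in> ?A"
    then obtain k where k: "p - k * g \<in> M"
      using M by (auto simp: truncation_def mem_ideal_gen_insert)
    have "p - k * g \<in> truncation j M"
      using k p kg[of k] keys_diff[of p "k * g"]
      by (auto simp: truncation_def in_keys_iff lookup_minus)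
    then show "p \<in> ?B" using M by (auto simp: mem_ideal_gen_insert is_ideal_truncation)
  qed
qed

text \<open>
Above the degree of \<open>g\<close>, the multiples of \<open>g\<close> and the multiples of the \<open>x\<^sub>v g\<close> agree modulo \<open>M\<close>: in a
sum \<open>k g + m\<close> without terms in degree \<open>d\<close>, the constant term of \<open>k\<close> contributes \<open>k\<^sub>0 g\<close> to degree
\<open>d\<close>, which \<open>m\<close> has to cancel, so that \<open>k\<^sub>0 g\<close> lies in the graded ideal \<open>M\<close>.
\<close>

lemma truncation_insert_below_degree:
  fixes M :: "('v, 'k::comm_ring_1) mpoly set"
  assumes M: "graded_ideal M" and g: "homogeneous d g" and "d < j"
  shows "truncation j (ideal_gen (insert g M)) = truncation j (ideal_gen (M \<union> (\<lambda>v. mvar v * g) ` UNIV))"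
    (is "truncation j ?A = truncation j ?B")
proof -
  have ideal_M: "is_ideal M" using M by (simp add: graded_ideal_iff)
  have sup: "M \<subseteq> ?B" "mvar v * g \<in> ?B" for v
    by (blast intro: ideal.span_base)+
  have "M \<subseteq> ?A" "g \<in> ?A" by (blast intro: ideal.span_base)+
  then have "M \<union> range (\<lambda>v. mvar v * g) \<subseteq> ?A" by (blast intro: ideal.span_scale)
  then have "?B \<subseteq> ?A" by (rule ideal.span_minimal) (rule ideal.subspace_span)
  moreover have "p \<in> ?B" if p: "p \<in> truncation j ?A" for p
  proof -
    obtain k where k: "p - k * g \<in> M"
      using p ideal_M by (auto simp: truncation_def mem_ideal_gen_insert)
    \<comment> \<open>the constant term of \<open>k\<close>\<close>
    define k0 where "k0 = graded_part d d k"
    have "graded_part d 0 p = 0"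
      by (rule graded_part_eq_0) (use p \<open>d < j\<close> in \<open>auto simp: truncation_def\<close>)
    then have "graded_part d 0 (p - k * g) = - (k0 * g)"
      using graded_part_add[of d 0 "p - k * g" "k * g"] graded_part_mult[OF g, of d 0 k]
      by (simp add: k0_def eq_neg_iff_add_eq_0)
    then have "- (k0 * g) \<in> M" using k M by (metis graded_ideal_iff)
    then have "(p - k * g) - (- (k0 * g)) \<in> M" using k by (rule ideal.subspace_diff[OF ideal_M, rotated])
    then have 1: "p - (k - k0) * g \<in> ?B" using sup(1) by (auto simp: algebra_simps)
    have "Poly_Mapping.lookup (k - k0) 0 = 0" by (simp add: k0_def lookup_minus lookup_graded_part)
    then have "k - k0 \<in> ideal_gen (range mvar)" by (rule mem_ideal_gen_vars)
    moreover have "ideal_gen (range mvar) \<subseteq> colon ?B g"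
      using sup(2) by (intro ideal.span_minimal is_ideal_colon ideal.subspace_span) (auto simp: colon_def)
    ultimately have "(k - k0) * g \<in> ?B" by (auto simp: colon_def)
    with 1 show ?thesis using ideal.span_add by fastforce
  qed
  ultimately show ?thesis by (auto simp: truncation_def)
qed

context
  fixes lt :: "'x::finite monomial \<Rightarrow> 'x monomial \<Rightarrow> bool"
  assumes order: "monomial_order UNIV lt"
begin

text \<open>
Induction on \<open>j - d\<close>. If \<open>d = j\<close>, one step of the chain suffices. Otherwise \<open>g\<close> is replaced by the
products \<open>x\<^sub>v g\<close>, which are added to \<open>M\<close> one variable after the other. While this goes on, the
annihilator of \<open>g\<close> stays a linear ideal, and as this ideal is prime, the annihilator of the next
product \<open>x\<^sub>v g\<close> is the same linear ideal (or \<open>x\<^sub>v g\<close> is already there). The induction hypothesis applies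
to each of these products, whose degree is closer to \<open>j\<close>.
\<close>

lemma linear_chain_truncation_insert:
  fixes M :: "('x, 'k::field) mpoly set"
  assumes "graded_ideal M" "homogeneous d g" "d \<le> j" "linear_ideal (colon M g)"
  shows "linear_chain j (truncation j M) (truncation j (ideal_gen (insert g M)))"
  using assms
proof (induction "j - d" arbitrary: d g M)
  case 0
  then have [simp]: "d = j" by simp
  have M: "is_ideal M" using 0 by (simp add: graded_ideal_iff)
  have "colon (truncation j M) g = colon M g"
    using 0(3) keys_mult_mdeg_ge[of g j] by (auto simp: colon_def truncation_def homogeneous_def)
  then have "linear_chain j (truncation j M) (ideal_gen (insert g (truncation j M)))"
    using 0 by (intro linear_chain.intros) auto
  then show ?case using 0 M by (simp add: truncation_insert_top_degree)
next
  case (Suc e)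
  then have "d < j" by simp
  define N where "N V = ideal_gen (M \<union> (\<lambda>v. mvar v * g) ` V)" for V
  have M: "is_ideal M" using Suc.prems by (simp add: graded_ideal_iff)
  have "graded_ideal (N V) \<and> linear_ideal (colon (N V) g) \<and> linear_chain j (truncation j M) (truncation j (N V))" for V
    using finite[of V]
  proof (induction V rule: finite_induct)
    case empty
    have "N {} = M" using M by (simp add: N_def ideal.span_eq_iff[THEN iffD2])
    then show ?case using Suc.prems by (auto intro: linear_chain.intros)
  next
    case (insert v V)
    let ?g = "mvar v * g"
    have N: "is_ideal (N V)" "graded_ideal (N V)" using insert by (auto simp: graded_ideal_iff)
    have ins: "N (insert v V) = ideal_gen (insert ?g (N V))"
      by (simp add: N_def ideal_gen_insert_ideal_gen)
    have hom: "homogeneous (d + 1) ?g"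
      using homogeneous_mult[OF homogeneous_var Suc.prems(2), of v] by (simp add: add.commute)
    have 1: "graded_ideal (N (insert v V))"
      unfolding ins using N(2) hom by (rule graded_ideal_insert)
    have 2: "linear_ideal (colon (N (insert v V)) g)"
      unfolding ins colon_insert_multiple[OF N(1)] using insert by (intro linear_ideal_insert) auto
    have "linear_chain j (truncation j (N V)) (truncation j (N (insert v V)))"
    proof (cases "mvar v \<in> colon (N V) g")
      case True
      then have "insert ?g (N V) = N V" by (auto simp: colon_def)
      then have "N (insert v V) = N V" using N(1) by (simp add: ins ideal.span_eq_iff[THEN iffD2])
      then show ?thesis by (auto intro: linear_chain.intros)
    next
      case False
      have "colon (N V) ?g = colon (colon (N V) g) (mvar v)"
        by (simp add: colon_def mult.assoc)
      also have "\<dots> = colon (N V) g"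
        using linear_ideal_colon[OF order, of "colon (N V) g" "mvar v"] insert False by simp
      finally have "linear_ideal (colon (N V) ?g)" using insert by simp
      then show ?thesis
        unfolding ins using Suc.hyps(2) \<open>d < j\<close> by (intro Suc.hyps(1)[OF _ N(2) hom]) auto
    qed
    with 1 2 insert show ?case by (blast intro: linear_chain_trans)
  qed
  then have "linear_chain j (truncation j M) (truncation j (N UNIV))" by blast
  then show ?case
    using truncation_insert_below_degree[OF Suc.prems(1,2) \<open>d < j\<close>] by (simp add: N_def)
qed

lemma linear_chain_truncation_list:
  fixes gs :: "('x, 'k::field) mpoly list"
  assumes hom: "\<forall>g\<in>set gs. \<exists>d\<le>j. homogeneous d g"
    and lq: "\<forall>i<length gs. linear_ideal (colon (ideal_gen (set (take i gs))) (gs ! i))"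
  shows "linear_chain j {0} (truncation j (ideal_gen (set gs)))"
proof -
  have "linear_chain j {0} (truncation j (ideal_gen (set (take n gs))))" if "n \<le> length gs" for n
    using that
  proof (induction n)
    case 0
    have "truncation j {0 :: ('x, 'k) mpoly} = {0}" by (auto simp: truncation_def)
    then show ?case by (auto intro: linear_chain.intros)
  next
    case (Suc n)
    then have n: "n < length gs" by simp
    then obtain d where d: "d \<le> j" "homogeneous d (gs ! n)" using hom nth_mem by blast
    let ?M = "ideal_gen (set (take n gs))"
    have "graded_ideal ?M" using hom by (intro graded_ideal_gen) (auto dest: in_set_takeD)
    then have "linear_chain j (truncation j ?M) (truncation j (ideal_gen (insert (gs ! n) ?M)))"
      using d lq n by (intro linear_chain_truncation_insert) auto
    moreover have "ideal_gen (insert (gs ! n) ?M) = ideal_gen (set (take (Suc n) gs))"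
      using n by (simp add: ideal_gen_insert_ideal_gen take_Suc_conv_app_nth)
    ultimately show ?case using Suc by (auto intro: linear_chain_trans)
  qed
  from this[of "length gs"] show ?thesis by simp
qed

end

section \<open>Minimal generators\<close>

text \<open>
In the component of the relation in the degree of \<open>gs ! j\<close>, the coefficient of \<open>gs ! j\<close> is the
constant term of \<open>c j\<close>. A nonzero constant would express \<open>gs ! j\<close> through the other generators.
\<close>

lemma min_hom_generators_relation:
  fixes gs :: "('v, 'k::field) mpoly list"
  assumes gs: "min_hom_generators gs A" and rel: "(\<Sum>i<length gs. c i * gs ! i) = 0" and j: "j < length gs"
  shows "Poly_Mapping.lookup (c j) 0 = 0"
proof (rule ccontr)
  assume nz: "Poly_Mapping.lookup (c j) 0 \<noteq> 0"
  have "\<forall>i<length gs. \<exists>d. homogeneous d (gs ! i)"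
    using gs by (auto simp: min_hom_generators_def)
  then obtain D where D: "\<And>i. i < length gs \<Longrightarrow> homogeneous (D i) (gs ! i)" by metis
  define a where "a = Poly_Mapping.lookup (c j) 0"
  define h where "h i = graded_part (D j) (D i) (c i)" for i
  have "h j = mconst (Poly_Mapping.lookup (h j) 0)"
    by (rule homogeneous_deg0_const) (simp add: h_def homogeneous_graded_part_weight)
  then have hj: "h j = mconst a" by (simp add: h_def lookup_graded_part a_def)
  have "0 = graded_part (D j) 0 (\<Sum>i<length gs. c i * gs ! i)" by (simp add: rel)
  also have "\<dots> = (\<Sum>i<length gs. h i * gs ! i)"
    unfolding graded_part_sum by (rule sum.cong) (simp_all add: graded_part_mult[OF D] h_def)
  also have "\<dots> = h j * gs ! j + (\<Sum>i\<in>{..<length gs} - {j}. h i * gs ! i)"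
    using j by (subst sum.remove[of _ j]) auto
  finally have "mconst a * gs ! j = - (\<Sum>i\<in>{..<length gs} - {j}. h i * gs ! i)"
    by (simp add: hj eq_neg_iff_add_eq_0)
  moreover have "mconst (1 / a) * (mconst a * gs ! j) = gs ! j"
    using nz by (simp add: a_def mult_single flip: mult.assoc)
  ultimately have "gs ! j = mconst (1 / a) * - (\<Sum>i\<in>{..<length gs} - {j}. h i * gs ! i)"
    by metis
  also have "\<dots> \<in> ideal_gen {gs ! i | i. i < length gs \<and> i \<noteq> j}"
    by (intro ideal.span_scale ideal.span_neg ideal.span_sum ideal.span_base) auto
  finally show False using gs j by (auto simp: min_hom_generators_def)
qed

lemma linear_quotients_iff:
  "linear_quotients gs \<longleftrightarrow> (\<forall>j<length gs. linear_ideal (colon (ideal_gen (set (take j gs))) (gs ! j)))"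
  by (simp add: linear_quotients_def linear_ideal_def)

lemma linear_quotients_snoc:
  "linear_quotients (gs @ [g]) \<longleftrightarrow> linear_quotients gs \<and> linear_ideal (colon (ideal_gen (set gs)) g)"
  by (auto simp: linear_quotients_iff nth_append less_Suc_eq)

text \<open>
The colon ideals are those of the full list. For a linear form \<open>l\<close> with
\<open>l g = \<Sum> h\<^sub>i g\<^sub>i\<close>, homogeneous of degree \<open>1 + deg g\<close>, the coefficients have no constant
term by minimality. Only generators of degree at most \<open>deg g\<close> can then occur, so \<open>l\<close> already
multiplies \<open>g\<close> into the ideal of the generators that are kept.
\<close>

lemma linear_quotients_filter_degree:
  fixes gs :: "('v, 'k::field) mpoly list"
  assumes gs: "min_hom_generators gs A" and lq: "linear_quotients gs"
  shows "linear_quotients (filter (\<lambda>g. \<exists>d\<le>j. homogeneous d g) gs)"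
proof -
  let ?P = "\<lambda>g. \<exists>d\<le>j. homogeneous d g"
  have "\<forall>i<length gs. \<exists>d. homogeneous d (gs ! i)"
    using gs by (auto simp: min_hom_generators_def)
  then obtain D where D: "\<And>i. i < length gs \<Longrightarrow> homogeneous (D i) (gs ! i)" by metis
  have "linear_quotients (filter ?P (take n gs))" if "n \<le> length gs" for n
    using that
  proof (induction n)
    case 0
    then show ?case by (simp add: linear_quotients_def)
  next
    case (Suc n)
    then have n: "n < length gs" and IH: "linear_quotients (filter ?P (take n gs))" by auto
    let ?g = "gs ! n" and ?F = "ideal_gen (set (filter ?P (take n gs)))"
    show ?case
    proof (cases "?P ?g")
      case False
      then have "filter ?P (take (Suc n) gs) = filter ?P (take n gs)"
        using n by (auto simp: take_Suc_conv_app_nth)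
      then show ?thesis using IH by simp
    next
      case True
      then obtain d where d: "d \<le> j" "homogeneous d ?g" by blast
      obtain L where L: "\<forall>l\<in>L. homogeneous 1 l" "colon (ideal_gen (set (take n gs))) ?g = ideal_gen L"
        using lq n by (auto simp: linear_quotients_def)
      have "l * ?g \<in> ?F" if "l \<in> L" for l
      proof -
        have "l \<in> ideal_gen L" using that by (rule ideal.span_base)
        then have "l * ?g \<in> ideal_gen ((!) gs ` {..<n})"
          using L(2) n set_take_conv_image[of n gs] by (auto simp: colon_def)
        then obtain h where h: "l * ?g = (\<Sum>i<n. h i * gs ! i)"
          using ideal_gen_image[of "{..<n}" "(!) gs"] by auto
        \<comment> \<open>the coefficients of the relation \<open>\<Sum> h\<^sub>i g\<^sub>i - l g = 0\<close>\<close>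
        define c where "c i = (if i < n then h i else if i = n then - l else 0)" for i
        have "(\<Sum>i<length gs. c i * gs ! i) = (\<Sum>i<Suc n. c i * gs ! i)"
          using n by (intro sum.mono_neutral_right) (auto simp: c_def)
        also have "\<dots> = 0" by (simp add: c_def h)
        finally have "Poly_Mapping.lookup (c i) 0 = 0" if "i < n" for i
          using min_hom_generators_relation[OF gs, of c i] that n by simp
        then have h0: "Poly_Mapping.lookup (h i) 0 = 0" if "i < n" for i
          using that by (simp add: c_def split: if_splits)
        have "homogeneous (1 + d) (l * ?g)" using L(1) that d(2) by (intro homogeneous_mult) auto
        then have "l * ?g = graded_part (1 + d) 0 (l * ?g)" by (simp add: graded_part_id)
        also have "\<dots> = (\<Sum>i<n. graded_part (1 + d) (D i) (h i) * gs ! i)"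
          unfolding h graded_part_sum
          by (rule sum.cong) (use n in \<open>simp_all add: graded_part_mult[OF D]\<close>)
        also have "\<dots> \<in> ?F"
        proof (rule ideal.span_sum)
          fix i assume i: "i \<in> {..<n}"
          show "graded_part (1 + d) (D i) (h i) * gs ! i \<in> ?F"
          proof (cases "D i \<le> j")
            case True
            have "gs ! i \<in> set (take n gs)" using i n by (auto simp: set_take_conv_image)
            then have "gs ! i \<in> set (filter ?P (take n gs))" using True D i n by auto
            then show ?thesis by (intro ideal.span_scale ideal.span_base)
          next
            case False
            have "graded_part (1 + d) (D i) (h i) = 0"
            proof (rule graded_part_eq_0, rule ballI)
              fix \<mu> assume "\<mu> \<in> Poly_Mapping.keys (h i)"
              then have "\<mu> \<noteq> 0" using h0 i by (auto simp: in_keys_iff)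
              then have "mdeg \<mu> \<noteq> 0" by simp
              then show "mdeg \<mu> + D i \<noteq> 1 + d" using False d(1) by linarith
            qed
            then show ?thesis by (simp add: ideal.span_zero)
          qed
        qed
        finally show ?thesis .
      qed
      then have "ideal_gen L \<subseteq> colon ?F ?g"
        by (intro ideal.span_minimal is_ideal_colon ideal.subspace_span) (auto simp: colon_def)
      moreover have "?F \<subseteq> ideal_gen (set (take n gs))"
        by (rule ideal.span_mono) auto
      then have "colon ?F ?g \<subseteq> ideal_gen L" unfolding L(2)[symmetric] by (auto simp: colon_def)
      ultimately have "colon ?F ?g = ideal_gen L" by blast
      then have "linear_ideal (colon ?F ?g)" using L(1) by (auto simp: linear_ideal_def)
      moreover have "filter ?P (take (Suc n) gs) = filter ?P (take n gs) @ [?g]"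
        using n True by (auto simp: take_Suc_conv_app_nth)
      ultimately show ?thesis using IH by (simp add: linear_quotients_snoc)
    qed
  qed
  from this[of "length gs"] show ?thesis by simp
qed

text \<open>
The ideal generated by the elements of \<open>A\<close> of degree \<open>j\<close> is the truncation of the ideal \<open>F\<close> of the
generators of degree at most \<open>j\<close>: such elements only involve these generators, and conversely the
truncation is generated in degree \<open>j\<close> by the chain constructed above.
\<close>

lemma component_linear_quotients:
  fixes gs :: "('x::finite, 'k::field) mpoly list" and lt :: "'x monomial \<Rightarrow> 'x monomial \<Rightarrow> bool"
  assumes order: "monomial_order UNIV lt"
    and gs: "min_hom_generators gs A" and lq: "linear_quotients gs"
  obtains hs where "\<forall>h\<in>set hs. homogeneous j h" "linear_quotients hs"
    "ideal_gen {p \<in> A. homogeneous j p} = ideal_gen (set hs)"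
proof -
  let ?P = "\<lambda>g. \<exists>d\<le>j. homogeneous d g"
  let ?F = "ideal_gen (set (filter ?P gs))"
  have A: "A = ideal_gen (set gs)" using gs by (simp add: min_hom_generators_def)
  have "\<forall>i<length gs. \<exists>d. homogeneous d (gs ! i)"
    using gs by (auto simp: min_hom_generators_def)
  then obtain D where D: "\<And>i. i < length gs \<Longrightarrow> homogeneous (D i) (gs ! i)" by metis
  have "linear_quotients (filter ?P gs)" using gs lq by (rule linear_quotients_filter_degree)
  then have "linear_chain j {0} (truncation j ?F)"
    by (intro linear_chain_truncation_list[OF order]) (auto simp: linear_quotients_iff)
  from linear_chain_list[OF this] obtain hs where hs: "\<forall>h\<in>set hs. homogeneous j h"
    "truncation j ?F = ideal_gen (insert 0 (set hs))"
    "\<forall>i<length hs. linear_ideal (colon (ideal_gen (insert 0 (set (take i hs)))) (hs ! i))"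
    by auto
  have ins0: "ideal_gen (insert 0 B) = ideal_gen B" for B :: "('x, 'k) mpoly set"
    using ideal_gen_Un_eq[of "{}" B] by simp
  have "ideal_gen {p \<in> A. homogeneous j p} = truncation j ?F"
  proof
    have "p \<in> truncation j ?F" if "p \<in> A" "homogeneous j p" for p
    proof -
      obtain h where h: "p = (\<Sum>i<length gs. h i * gs ! i)"
        using \<open>p \<in> A\<close> unfolding A ideal_gen_list by blast
      have "p = graded_part j 0 p" using that(2) by (simp add: graded_part_id)
      also have "\<dots> = (\<Sum>i<length gs. graded_part j (D i) (h i) * gs ! i)"
        unfolding h graded_part_sum by (rule sum.cong) (simp_all add: graded_part_mult[OF D])
      also have "\<dots> \<in> ?F"
      proof (rule ideal.span_sum)
        fix i assume i: "i \<in> {..<length gs}"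
        show "graded_part j (D i) (h i) * gs ! i \<in> ?F"
        proof (cases "D i \<le> j")
          case True
          then have "gs ! i \<in> set (filter ?P gs)" using D i by auto
          then show ?thesis by (intro ideal.span_scale ideal.span_base)
        qed (simp add: graded_part_less ideal.span_zero)
      qed
      finally show ?thesis using that(2) by (simp add: truncation_def homogeneous_def)
    qed
    then show "ideal_gen {p \<in> A. homogeneous j p} \<subseteq> truncation j ?F"
      by (subst ideal_gen_subset_iff) (auto simp: is_ideal_truncation)
    have "?F \<subseteq> A" unfolding A by (rule ideal.span_mono) auto
    moreover have "set hs \<subseteq> truncation j ?F" unfolding hs(2) using ideal.span_superset by blast
    ultimately have "set hs \<subseteq> {p \<in> A. homogeneous j p}"
      using hs(1) by (auto simp: truncation_def)
    then show "truncation j ?F \<subseteq> ideal_gen {p \<in> A. homogeneous j p}"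
      unfolding hs(2) ins0 by (rule ideal.span_mono)
  qed
  then show thesis
    using hs by (intro that[of hs]) (simp_all add: ins0 linear_quotients_iff)
qed

section \<open>Linear resolutions\<close>

text \<open>
Elements of free modules are functions from the positions of the coordinates, which spares a
bound on the positions. The columns of the matrix with \<open>N\<close> columns are \<open>W 0, \<dots>, W (N - 1)\<close>.
\<close>

definition lin_span :: "nat \<Rightarrow> (nat \<Rightarrow> nat \<Rightarrow> 'a::comm_ring_1) \<Rightarrow> (nat \<Rightarrow> 'a) set" where
  "lin_span N W = {v. \<exists>u. \<forall>r. v r = (\<Sum>c<N. u c * W c r)}"

definition relations :: "nat \<Rightarrow> (nat \<Rightarrow> nat \<Rightarrow> 'a::comm_ring_1) \<Rightarrow> (nat \<Rightarrow> 'a) set" where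
  "relations N W = {u. (\<forall>c\<ge>N. u c = 0) \<and> (\<forall>r. (\<Sum>c<N. u c * W c r) = 0)}"

text \<open>
For the module \<open>K\<close> of relations of a list of generators, this is the colon ideal of the \<open>n\<close>-th generator by
its predecessors: a relation without terms beyond \<open>n\<close> expresses a multiple of that generator
through the earlier ones.
\<close>

definition last_coords :: "(nat \<Rightarrow> 'a::zero) set \<Rightarrow> nat \<Rightarrow> 'a set" where
  "last_coords K n = {v n | v. v \<in> K \<and> (\<forall>i>n. v i = 0)}"

definition linear_quotient_family :: "nat \<Rightarrow> (nat \<Rightarrow> nat \<Rightarrow> ('v, 'k::comm_ring_1) mpoly) \<Rightarrow> bool" where
  "linear_quotient_family N W \<longleftrightarrow> (\<forall>p<N. linear_ideal (last_coords (relations N W) p))"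

lemma last_coords_relations_Suc:
  "last_coords (relations (Suc N) W) N = {r. (\<lambda>i. r * W N i) \<in> lin_span N W}" (is "?A = ?B")
proof
  show "?A \<subseteq> ?B"
  proof
    fix r assume "r \<in> ?A"
    then obtain u where u: "r = u N" "\<And>i. (\<Sum>c<Suc N. u c * W c i) = 0"
      by (auto simp: last_coords_def relations_def)
    have "r * W N i = (\<Sum>c<N. - u c * W c i)" for i
      using u(2)[of i] by (simp add: u(1) sum_negf eq_neg_iff_add_eq_0 add.commute)
    then show "r \<in> ?B" unfolding lin_span_def by (intro CollectI exI[of _ "\<lambda>c. - u c"]) auto
  qed
  show "?B \<subseteq> ?A"
  proof
    fix r assume "r \<in> ?B"
    then obtain u where u: "\<And>i. r * W N i = (\<Sum>c<N. u c * W c i)"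
      by (auto simp: lin_span_def)
    define u' where "u' c = (if c < N then - u c else if c = N then r else 0)" for c
    have "(\<Sum>c<Suc N. u' c * W c i) = 0" for i
      using u[of i] by (simp add: u'_def sum_negf)
    then have "u' \<in> relations (Suc N) W" by (simp add: relations_def u'_def)
    moreover have "u' N = r" "\<forall>i>N. u' i = 0" by (simp_all add: u'_def)
    ultimately show "r \<in> ?A" unfolding last_coords_def by blast
  qed
qed

lemma last_coords_relations_less:
  assumes "p < N"
  shows "last_coords (relations (Suc N) W) p = last_coords (relations N W) p"
proof -
  have "u \<in> relations (Suc N) W \<longleftrightarrow> u \<in> relations N W" if "\<forall>i>p. u i = 0" for u
    using that assms by (auto simp: relations_def Suc_le_eq order.order_iff_strict)
  then show ?thesis by (auto simp: last_coords_def)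
qed

lemma lin_span_cong: "(\<And>c. c < N \<Longrightarrow> W c = W' c) \<Longrightarrow> lin_span N W = lin_span N W'"
  by (simp add: lin_span_def)

lemma relations_cong: "(\<And>c. c < N \<Longrightarrow> W c = W' c) \<Longrightarrow> relations N W = relations N W'"
  by (simp add: relations_def)

text \<open>
The linear entries make the columns \<open>W c\<close> the matrix of the next map of a linear resolution, and the
linear quotients allow the resolution to be continued from there.
\<close>

definition linear_presentable :: "(nat \<Rightarrow> ('v, 'k::comm_ring_1) mpoly) set \<Rightarrow> bool" where
  "linear_presentable X \<longleftrightarrow> (\<exists>N W. (\<forall>c<N. \<forall>r. homogeneous 1 (W c r)) \<and> X = lin_span N W \<and>
     linear_quotient_family N W)"

lemma linear_presentable_zero: "linear_presentable {\<lambda>_. 0}"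
  unfolding linear_presentable_def
  by (intro exI[of _ 0]) (auto simp: lin_span_def linear_quotient_family_def)

lemma linear_presentable_extend:
  assumes X: "linear_presentable X" and w: "\<And>i. homogeneous 1 (w i)"
    and quot: "linear_ideal {r. (\<lambda>i. r * w i) \<in> X}"
  shows "linear_presentable {v. \<exists>k. (\<lambda>i. v i - k * w i) \<in> X}"
proof -
  obtain N W where W: "\<forall>c<N. \<forall>r. homogeneous 1 (W c r)" "X = lin_span N W"
    "linear_quotient_family N W"
    using X by (auto simp: linear_presentable_def)
  define W' where "W' = W(N := w)"
  have span: "lin_span N W' = lin_span N W" and rel: "relations N W' = relations N W"
    by (rule lin_span_cong relations_cong, simp add: W'_def)+
  have "{v. \<exists>k. (\<lambda>i. v i - k * w i) \<in> X} = lin_span (Suc N) W'" (is "?A = ?B")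
  proof
    show "?A \<subseteq> ?B"
    proof
      fix v assume "v \<in> ?A"
      then obtain k u where ku: "\<And>i. v i - k * w i = (\<Sum>c<N. u c * W c i)"
        by (auto simp: W(2) lin_span_def)
      have "v i = (\<Sum>c<Suc N. (u(N := k)) c * W' c i)" for i
        using ku[of i] by (simp add: W'_def algebra_simps)
      then show "v \<in> ?B" unfolding lin_span_def by blast
    qed
    show "?B \<subseteq> ?A"
    proof
      fix v assume "v \<in> ?B"
      then obtain u where u: "\<And>i. v i = (\<Sum>c<Suc N. u c * W' c i)" by (auto simp: lin_span_def)
      have "v i - u N * w i = (\<Sum>c<N. u c * W c i)" for i
        using u[of i] by (simp add: W'_def)
      then show "v \<in> ?A" by (auto simp: W(2) lin_span_def)
    qed
  qed
  moreover have "W' N = w" by (simp add: W'_def)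
  then have "linear_quotient_family (Suc N) W'"
    using W(3) quot last_coords_relations_Suc[of N W'] last_coords_relations_less[of _ N W']
    by (auto simp: linear_quotient_family_def less_Suc_eq span rel W(2))
  moreover have "\<forall>c<Suc N. \<forall>r. homogeneous 1 (W' c r)"
    using W(1) w by (auto simp: W'_def less_Suc_eq)
  ultimately show ?thesis unfolding linear_presentable_def by blast
qed

context
  fixes lt :: "'x::finite monomial \<Rightarrow> 'x monomial \<Rightarrow> bool"
  assumes order: "monomial_order UNIV lt"
begin

text \<open>
\<open>K\<close> is filtered by the position of the last nonzero coordinate. Each ideal of last coordinates is
generated by linearly independent linear forms; lifting them to elements of \<open>K\<close> with linear entries
and adding the lifts one by one, the colon ideals are those of these forms in the polynomial
ring, which are linear by primeness.
\<close>

lemma linear_presentable_graded_submodule: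
  fixes K :: "(nat \<Rightarrow> ('x, 'k::field) mpoly) set"
  assumes K0: "(\<lambda>_. 0) \<in> K" and Kadd: "\<And>v w. v \<in> K \<Longrightarrow> w \<in> K \<Longrightarrow> (\<lambda>i. v i + w i) \<in> K"
    and Kscale: "\<And>r v. v \<in> K \<Longrightarrow> (\<lambda>i. r * v i) \<in> K"
    and Kgraded: "\<And>v. v \<in> K \<Longrightarrow> (\<lambda>i. graded_part 1 0 (v i)) \<in> K"
    and bound: "\<And>v i. v \<in> K \<Longrightarrow> s \<le> i \<Longrightarrow> v i = 0"
    and lin: "\<And>n. n < s \<Longrightarrow> linear_ideal (last_coords K n)"
  shows "linear_presentable K"
proof -
  have "linear_presentable {v \<in> K. \<forall>i\<ge>n. v i = 0}" if "n \<le> s" for n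
    using that
  proof (induction n)
    case 0
    have "{v \<in> K. \<forall>i\<ge>0. v i = 0} = {\<lambda>_. 0}" using K0 by auto
    then show ?case by (simp add: linear_presentable_zero)
  next
    case (Suc n)
    obtain ls U \<phi> where ls: "\<forall>l\<in>set ls. homogeneous 1 l" "last_coords K n = ideal_gen (set ls)"
      "\<forall>p<length ls. ls ! p \<notin> ideal_gen (set (take p ls))"
      using linear_ideal_basis[OF lin[of n]] Suc.prems by (metis Suc_le_eq)
    \<comment> \<open>Between \<open>X 0\<close>, with last coordinate before \<open>n\<close>, and all of the part with last coordinate up to \<open>n\<close>,
      the \<open>n\<close>-th coordinate is released one linear form at a time.\<close>
    define X where "X p = {v \<in> K. (\<forall>i>n. v i = 0) \<and> v n \<in> ideal_gen (set (take p ls))}" for p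
    have "linear_presentable (X p)" if "p \<le> length ls" for p
      using that
    proof (induction p)
      case 0
      have "X 0 = {v \<in> K. \<forall>i\<ge>n. v i = 0}" by (auto simp: X_def order.order_iff_strict)
      then show ?case using Suc by simp
    next
      case (Suc p)
      then have p: "p < length ls" and IH: "linear_presentable (X p)" by auto
      let ?P = "ideal_gen (set (take p ls))"
      have "ls ! p \<in> last_coords K n" unfolding ls(2) using p by (intro ideal.span_base) simp
      then obtain w0 where w0: "w0 \<in> K" "\<forall>i>n. w0 i = 0" "w0 n = ls ! p"
        by (auto simp: last_coords_def)
      define w where "w i = graded_part 1 0 (w0 i)" for i
      have w: "w \<in> K" "\<And>i. i > n \<Longrightarrow> w i = 0" "w n = ls ! p" "\<And>i. homogeneous 1 (w i)"
      proof -
        show "w \<in> K" using Kgraded[OF w0(1)] by (simp add: w_def[abs_def])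
        show "w i = 0" if "i > n" for i using that w0(2) by (simp add: w_def)
        have "homogeneous 1 (ls ! p)" using ls(1) p by simp
        then show "w n = ls ! p" by (simp add: w_def w0(3) graded_part_id)
        show "homogeneous 1 (w i)" for i by (simp add: w_def homogeneous_graded_part_weight)
      qed
      have lin_P: "linear_ideal ?P"
        unfolding linear_ideal_def using ls(1) by (intro exI[of _ "set (take p ls)"]) (auto dest: in_set_takeD)
      have "{r. (\<lambda>i. r * w i) \<in> X p} = colon ?P (ls ! p)"
        using w Kscale[OF w(1)] by (auto simp: X_def colon_def)
      also have "\<dots> = ?P" using linear_ideal_colon[OF order lin_P] ls(3) p by simp
      finally have "linear_ideal {r. (\<lambda>i. r * w i) \<in> X p}" using lin_P by simp
      from linear_presentable_extend[OF IH w(4) this]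
      have "linear_presentable {v. \<exists>k. (\<lambda>i. v i - k * w i) \<in> X p}" .
      also have "{v. \<exists>k. (\<lambda>i. v i - k * w i) \<in> X p} = X (Suc p)"
      proof -
        have take: "set (take (Suc p) ls) = insert (ls ! p) (set (take p ls))"
          using p by (simp add: take_Suc_conv_app_nth)
        have 1: "(\<lambda>i. v i - k * w i) \<in> X p \<longleftrightarrow>
            v \<in> K \<and> (\<forall>i>n. v i = 0) \<and> v n - k * ls ! p \<in> ?P" for v k
        proof -
          have "(\<lambda>i. v i - k * w i) \<in> K \<longleftrightarrow> v \<in> K"
          proof
            assume "(\<lambda>i. v i - k * w i) \<in> K"
            from Kadd[OF this Kscale[OF w(1), of k]] show "v \<in> K" by simp
          next
            assume "v \<in> K"
            from Kadd[OF this Kscale[OF w(1), of "- k"]] show "(\<lambda>i. v i - k * w i) \<in> K" by simp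
          qed
          then show ?thesis using w by (auto simp: X_def)
        qed
        show ?thesis
          unfolding 1 by (auto simp: X_def take ideal.span_insert)
      qed
      finally show ?case .
    qed
    then have "linear_presentable (X (length ls))" by blast
    also have "X (length ls) = {v \<in> K. \<forall>i\<ge>Suc n. v i = 0}"
    proof -
      have "v n \<in> ideal_gen (set ls)" if "v \<in> K" "\<forall>i>n. v i = 0" for v
        using that unfolding ls(2)[symmetric] last_coords_def by blast
      then show ?thesis by (auto simp: X_def Suc_le_eq)
    qed
    finally show ?case .
  qed
  from this[of s] have "linear_presentable {v \<in> K. \<forall>i\<ge>s. v i = 0}" by simp
  also have "{v \<in> K. \<forall>i\<ge>s. v i = 0} = K" using bound by blast
  finally show ?thesis .
qed

text \<open>
The syzygies of a homogeneous family with linear quotients are generated by linear syzygies that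
have linear quotients themselves, so the construction can be repeated.
\<close>

lemma linear_presentable_relations:
  fixes W :: "nat \<Rightarrow> nat \<Rightarrow> ('x, 'k::field) mpoly"
  assumes hom: "\<forall>c<N. \<forall>r. homogeneous e (W c r)" and lq: "linear_quotient_family N W"
  shows "linear_presentable (relations N W)"
proof (rule linear_presentable_graded_submodule[where s = N])
  show "(\<lambda>_. 0) \<in> relations N W" by (simp add: relations_def)
  show "(\<lambda>i. v i + w i) \<in> relations N W" if "v \<in> relations N W" "w \<in> relations N W" for v w
    using that by (simp add: relations_def distrib_right sum.distrib)
  show "(\<lambda>i. r * v i) \<in> relations N W" if "v \<in> relations N W" for r v
    using that by (simp add: relations_def mult.assoc flip: sum_distrib_left)
  show "(\<lambda>i. graded_part 1 0 (v i)) \<in> relations N W" if v: "v \<in> relations N W" for v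
  proof -
    have "(\<Sum>c<N. graded_part 1 0 (v c) * W c r) = 0" for r
    proof -
      have "graded_part 1 0 (v c) = graded_part (1 + e) e (v c)" for c
        by (rule poly_mapping_eqI) (simp add: lookup_graded_part)
      then have "(\<Sum>c<N. graded_part 1 0 (v c) * W c r) = (\<Sum>c<N. graded_part (1 + e) 0 (v c * W c r))"
        using hom by (intro sum.cong) (auto simp: graded_part_mult[of e])
      also have "\<dots> = graded_part (1 + e) 0 (\<Sum>c<N. v c * W c r)"
        by (simp add: graded_part_sum)
      also have "\<dots> = 0" using v by (simp add: relations_def)
      finally show ?thesis .
    qed
    then show ?thesis using v by (simp add: relations_def)
  qed
  show "v i = 0" if "v \<in> relations N W" "N \<le> i" for v i
    using that by (simp add: relations_def)
  show "linear_ideal (last_coords (relations N W) n)" if "n < N" for n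
    using that lq by (simp add: linear_quotient_family_def)
qed

lemma linear_syzygy_sequence:
  fixes W0 :: "nat \<Rightarrow> nat \<Rightarrow> ('x, 'k::field) mpoly"
  assumes "\<forall>c<N0. \<forall>r. homogeneous e (W0 c r)" and "linear_quotient_family N0 W0"
  shows "\<exists>N W. N 0 = N0 \<and> W 0 = W0 \<and>
    (\<forall>i. \<forall>c<N (Suc i). \<forall>r. homogeneous 1 (W (Suc i) c r)) \<and>
    (\<forall>i. relations (N i) (W i) = lin_span (N (Suc i)) (W (Suc i)))"
proof -
  define P where "P i x = (case x of (N, W) \<Rightarrow> linear_quotient_family N W \<and>
      (if i = 0 then N = N0 \<and> W = W0 else (\<forall>c<N. \<forall>r. homogeneous 1 (W c r))))"
    for i :: nat and x :: "nat \<times> (nat \<Rightarrow> nat \<Rightarrow> ('x, 'k) mpoly)"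
  define Q where "Q i x y = (relations (fst x) (snd x) = lin_span (fst y) (snd y))"
    for i :: nat and x y :: "nat \<times> (nat \<Rightarrow> nat \<Rightarrow> ('x, 'k) mpoly)"
  have "\<exists>f. \<forall>n. P n (f n) \<and> Q n (f n) (f (Suc n))"
  proof (rule dependent_nat_choice)
    show "\<exists>x. P 0 x" using assms by (auto simp: P_def)
  next
    fix x i assume x: "P i x"
    obtain N W where NW: "x = (N, W)" by fastforce
    have "linear_presentable (relations N W)"
    proof (cases "i = 0")
      case True
      then show ?thesis using x assms NW by (auto simp: P_def intro!: linear_presentable_relations)
    next
      case False
      then show ?thesis using x NW by (intro linear_presentable_relations[of N 1]) (auto simp: P_def)
    qed
    then obtain N' W' where "\<forall>c<N'. \<forall>r. homogeneous 1 (W' c r)" "relations N W = lin_span N' W'"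
      "linear_quotient_family N' W'"
      by (auto simp: linear_presentable_def)
    then show "\<exists>y. P (Suc i) y \<and> Q i x y"
      by (intro exI[of _ "(N', W')"]) (simp add: P_def Q_def NW)
  qed
  then obtain f where f: "\<And>n. P n (f n)" "\<And>n. Q n (f n) (f (Suc n))" by blast
  show ?thesis
  proof (intro exI[of _ "\<lambda>i. fst (f i)"] exI[of _ "\<lambda>i. snd (f i)"] conjI)
    show "fst (f 0) = N0" "snd (f 0) = W0" using f(1)[of 0] by (auto simp: P_def split: prod.splits)
    show "\<forall>i. relations (fst (f i)) (snd (f i)) = lin_span (fst (f (Suc i))) (snd (f (Suc i)))"
      using f(2) by (simp add: Q_def)
    show "\<forall>i. \<forall>c<fst (f (Suc i)). \<forall>r. homogeneous 1 (snd (f (Suc i)) c r)"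
    proof
      show "\<forall>c<fst (f (Suc i)). \<forall>r. homogeneous 1 (snd (f (Suc i)) c r)" for i
        using f(1)[of "Suc i"] by (simp add: P_def case_prod_unfold)
    qed
  qed
qed

end

definition columns_mat :: "nat \<Rightarrow> nat \<Rightarrow> (nat \<Rightarrow> nat \<Rightarrow> 'a) \<Rightarrow> 'a mat" where
  "columns_mat m N W = mat m N (\<lambda>(r, c). W c r)"

lemma columns_mat_mult_vec:
  assumes "v \<in> carrier_vec N" "r < m"
  shows "(columns_mat m N W *\<^sub>v v) $ r = (\<Sum>c<N. v $ c * W c r :: 'a::comm_ring_1)"
proof -
  have "(columns_mat m N W *\<^sub>v v) $ r = (\<Sum>c\<in>{0..<N}. W c r * v $ c)"
    using assms unfolding columns_mat_def by (auto simp: scalar_prod_def intro!: sum.cong)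
  then show ?thesis by (simp add: atLeast0LessThan mult.commute)
qed

text \<open>
Vectors of length \<open>N\<close> correspond to functions that vanish from \<open>N\<close> on, and the rows from \<open>m\<close> on impose
no condition because they vanish.
\<close>

lemma mat_kernel_columns_mat:
  fixes W :: "nat \<Rightarrow> nat \<Rightarrow> 'a::comm_ring_1"
  assumes zero: "\<And>c r. c < N \<Longrightarrow> m \<le> r \<Longrightarrow> W c r = 0"
    and exact: "relations N W = lin_span N' W'"
  shows "mat_kernel (columns_mat m N W) = {columns_mat N N' W' *\<^sub>v v | v. v \<in> carrier_vec N'}"
proof -
  define fn where "fn v c = (if c < N then v $ c else 0)" for v :: "'a vec" and c
  have mem: "v \<in> mat_kernel (columns_mat m N W) \<longleftrightarrow> fn v \<in> relations N W" if v: "v \<in> carrier_vec N" for v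
  proof -
    have sum: "(\<Sum>c<N. fn v c * W c r) = (\<Sum>c<N. v $ c * W c r)" for r
      by (rule sum.cong) (auto simp: fn_def)
    have "columns_mat m N W *\<^sub>v v = 0\<^sub>v m \<longleftrightarrow> (\<forall>r<m. (\<Sum>c<N. v $ c * W c r) = 0)"
      using columns_mat_mult_vec[OF v, of _ m W] by (auto simp: vec_eq_iff columns_mat_def)
    also have "\<dots> \<longleftrightarrow> (\<forall>r. (\<Sum>c<N. v $ c * W c r) = 0)"
    proof -
      have "(\<Sum>c<N. v $ c * W c r) = 0" if "m \<le> r" for r using zero that by simp
      then show ?thesis by (metis not_le)
    qed
    finally show ?thesis
      using v by (simp add: mat_kernel_def relations_def sum fn_def[of _ _] columns_mat_def)
  qed
  show ?thesis
  proof (intro subset_antisym subsetI)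
    fix v assume v: "v \<in> mat_kernel (columns_mat m N W)"
    then have vN: "v \<in> carrier_vec N" by (simp add: mat_kernel_def columns_mat_def)
    then have "fn v \<in> lin_span N' W'" using v mem exact by simp
    then obtain u where u: "\<And>r. fn v r = (\<Sum>c<N'. u c * W' c r)" by (auto simp: lin_span_def)
    have "v = columns_mat N N' W' *\<^sub>v vec N' u"
    proof (rule eq_vecI)
      show "dim_vec v = dim_vec (columns_mat N N' W' *\<^sub>v vec N' u)" using vN by (simp add: columns_mat_def)
      fix r assume "r < dim_vec (columns_mat N N' W' *\<^sub>v vec N' u)"
      then have r: "r < N" by (simp add: columns_mat_def)
      have "v $ r = (\<Sum>c<N'. u c * W' c r)" using u[of r] r by (simp add: fn_def)
      then show "v $ r = (columns_mat N N' W' *\<^sub>v vec N' u) $ r"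
        using r by (simp add: columns_mat_mult_vec)
    qed
    then show "v \<in> {columns_mat N N' W' *\<^sub>v v | v. v \<in> carrier_vec N'}" by auto
  next
    fix v assume "v \<in> {columns_mat N N' W' *\<^sub>v v | v. v \<in> carrier_vec N'}"
    then obtain u where u: "u \<in> carrier_vec N'" "v = columns_mat N N' W' *\<^sub>v u" by blast
    have vN: "v \<in> carrier_vec N"
      unfolding u(2) by (rule mult_mat_vec_carrier[OF _ u(1)]) (simp add: columns_mat_def)
    let ?w = "\<lambda>r. \<Sum>c<N'. u $ c * W' c r"
    have "?w \<in> relations N W" unfolding exact lin_span_def by auto
    moreover have "fn v = ?w"
    proof
      fix r
      have "?w r = 0" if "N \<le> r" using \<open>?w \<in> relations N W\<close> that by (simp add: relations_def)
      then show "fn v r = ?w r" using u by (simp add: fn_def columns_mat_mult_vec)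
    qed
    ultimately show "v \<in> mat_kernel (columns_mat m N W)" using mem[OF vN] by simp
  qed
qed

text \<open>
The generators form a matrix with a single row. Its family has the linear quotients of the list,
and the sequence of linear syzygies gives the other matrices.
\<close>

lemma linear_quotients_imp_linear_resolution:
  fixes hs :: "('x::finite, 'k::field) mpoly list" and lt :: "'x monomial \<Rightarrow> 'x monomial \<Rightarrow> bool"
  assumes order: "monomial_order UNIV lt"
    and hom: "\<forall>h\<in>set hs. homogeneous d h" and lq: "linear_quotients hs"
  shows "has_linear_resolution (ideal_gen (set hs))"
proof -
  let ?n = "length hs"
  define W0 where "W0 c r = (if r = 0 \<and> c < ?n then hs ! c else 0)" for c r :: nat
  have W0_hom: "\<forall>c<?n. \<forall>r. homogeneous d (W0 c r)" using hom by (simp add: W0_def)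
  have "last_coords (relations ?n W0) p = colon (ideal_gen (set (take p hs))) (hs ! p)" if p: "p < ?n" for p
  proof -
    have "relations k W0 = {u. (\<forall>c\<ge>k. u c = 0) \<and> (\<Sum>c<k. u c * hs ! c) = 0}" if "k \<le> ?n" for k
    proof -
      have "(\<Sum>c<k. u c * W0 c r) = (if r = 0 then \<Sum>c<k. u c * hs ! c else 0)" for u r
        using that by (auto simp: W0_def intro!: sum.cong)
      then show ?thesis by (simp add: relations_def)
    qed
    have restrict: "last_coords (relations ?n W0) p = last_coords (relations (Suc p) W0) p"
    proof -
      have "last_coords (relations k W0) p = last_coords (relations (Suc p) W0) p" if "Suc p \<le> k" for k
        using that
      proof (induction k rule: dec_induct)
        case (step k)
        then show ?case using last_coords_relations_less[of p k W0] by simp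
      qed simp
      from this[of ?n] p show ?thesis by simp
    qed
    have "last_coords (relations (Suc p) W0) p = {r. (\<lambda>i. r * W0 p i) \<in> lin_span p W0}"
      by (rule last_coords_relations_Suc)
    also have "\<dots> = {r. \<exists>u. r * hs ! p = (\<Sum>c<p. u c * hs ! c)}"
    proof -
      have "(\<forall>i. r * W0 p i = (\<Sum>c<p. u c * W0 c i)) \<longleftrightarrow> r * hs ! p = (\<Sum>c<p. u c * hs ! c)" for r u
      proof -
        have "(\<Sum>c<p. u c * W0 c i) = (if i = 0 then \<Sum>c<p. u c * hs ! c else 0)" for i
          using p by (auto simp: W0_def intro!: sum.cong)
        moreover have "r * W0 p i = (if i = 0 then r * hs ! p else 0)" for i
          using p by (simp add: W0_def)
        ultimately show ?thesis by auto
      qed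
      then show ?thesis by (simp add: lin_span_def)
    qed
    also have "\<dots> = colon (ideal_gen (set (take p hs))) (hs ! p)"
      using p by (auto simp: set_take_conv_image ideal_gen_image colon_def)
    finally show ?thesis using restrict by simp
  qed
  then have "linear_quotient_family ?n W0"
    using lq by (simp add: linear_quotient_family_def linear_quotients_iff)
  from linear_syzygy_sequence[OF order W0_hom this] obtain N W where
    NW: "N 0 = ?n" "W 0 = W0" and lin: "\<And>i c r. c < N (Suc i) \<Longrightarrow> homogeneous 1 (W (Suc i) c r)"
    and exact: "\<And>i. relations (N i) (W i) = lin_span (N (Suc i)) (W (Suc i))"
    by blast
  define m where "m i = (case i of 0 \<Rightarrow> 1 | Suc i \<Rightarrow> N i)" for i
  define D where "D i = columns_mat (m i) (N i) (W i)" for i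
  have zero: "W i c r = 0" if "c < N i" "m i \<le> r" for i c r
  proof (cases i)
    case 0
    then show ?thesis using that NW by (simp add: W0_def m_def)
  next
    case (Suc i')
    have "W i c \<in> lin_span (N i) (W i)"
      unfolding lin_span_def
    proof (intro CollectI exI[of _ "\<lambda>c'. if c' = c then 1 else 0"] allI)
      fix r
      have "(\<Sum>c'<N i. (if c' = c then 1 else 0) * W i c' r) = (\<Sum>c'<N i. if c' = c then W i c r else 0)"
        by (rule sum.cong) auto
      then show "W i c r = (\<Sum>c'<N i. (if c' = c then 1 else 0) * W i c' r)" using that by simp
    qed
    then have "W i c \<in> relations (N i') (W i')" using exact Suc by simp
    then show ?thesis using that Suc by (simp add: relations_def m_def)
  qed
  have kernel: "mat_kernel (D i) = {D (Suc i) *\<^sub>v v | v. v \<in> carrier_vec (N (Suc i))}" for i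
  proof -
    have "m (Suc i) = N i" by (simp add: m_def)
    then show ?thesis
      using mat_kernel_columns_mat[of "N i" "m i" "W i", OF zero exact] by (simp add: D_def)
  qed
  have image: "{(D 0 *\<^sub>v v) $ 0 | v. v \<in> carrier_vec (N 0)} = ideal_gen (set hs)"
  proof -
    have val: "(D 0 *\<^sub>v v) $ 0 = (\<Sum>c<?n. v $ c * hs ! c)" if "v \<in> carrier_vec (N 0)" for v
      using that NW by (simp add: D_def m_def columns_mat_mult_vec W0_def)
    show ?thesis
    proof (intro subset_antisym subsetI)
      fix p assume "p \<in> {(D 0 *\<^sub>v v) $ 0 | v. v \<in> carrier_vec (N 0)}"
      then show "p \<in> ideal_gen (set hs)" using val unfolding ideal_gen_list by auto
    next
      fix p assume "p \<in> ideal_gen (set hs)"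
      then obtain c where c: "p = (\<Sum>i<?n. c i * hs ! i)" unfolding ideal_gen_list by blast
      have "(D 0 *\<^sub>v vec (N 0) c) $ 0 = p" using NW by (simp add: val c)
      then show "p \<in> {(D 0 *\<^sub>v v) $ 0 | v. v \<in> carrier_vec (N 0)}"
        by (metis (mono_tags, lifting) mem_Collect_eq vec_carrier)
    qed
  qed
  have entry: "D i $$ (r, c) = W i c r" if "r < m i" "c < N i" for i r c
    using that by (simp add: D_def columns_mat_def)
  have linear_entry: "homogeneous 1 (D (Suc i) $$ (r, c))" if "r < N i" "c < N (Suc i)" for i r c
    using that entry[of r "Suc i" c] lin[of c i r] by (simp add: m_def)
  have "min_graded_free_resolution (ideal_gen (set hs)) N (\<lambda>i c. d + i) D"
    unfolding min_graded_free_resolution_def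
  proof (intro conjI allI impI)
    show "D 0 \<in> carrier_mat 1 (N 0)" by (simp add: D_def columns_mat_def m_def)
    show "D (Suc i) \<in> carrier_mat (N i) (N (Suc i))" for i by (simp add: D_def columns_mat_def m_def)
    show "{(D 0 *\<^sub>v v) $ 0 | v. v \<in> carrier_vec (N 0)} = ideal_gen (set hs)" by (rule image)
    show "mat_kernel (D i) = {D (Suc i) *\<^sub>v v | v. v \<in> carrier_vec (N (Suc i))}" for i by (rule kernel)
    show "homogeneous (d + 0) (D 0 $$ (0, c))" if "c < N 0" for c
      using that entry[of 0 0 c] W0_hom NW by (simp add: m_def)
    fix i r c assume rc: "r < N i" "c < N (Suc i)"
    show "D (Suc i) $$ (r, c) = 0 \<or> (\<exists>e. d + Suc i = d + i + e \<and> homogeneous e (D (Suc i) $$ (r, c)))"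
      using linear_entry[OF rc] by (intro disjI2 exI[of _ 1]) simp
    show "Poly_Mapping.lookup (D (Suc i) $$ (r, c)) 0 = 0"
      using linear_entry[OF rc] by (metis homogeneous_def in_keys_iff mdeg_0 zero_neq_one)
  qed
  then show ?thesis unfolding has_linear_resolution_def by blast
qed

theorem linear_quotients_imp_componentwise_linear:
  fixes gs :: "('x::finite, 'k::field) mpoly list" and lt :: "'x monomial \<Rightarrow> 'x monomial \<Rightarrow> bool"
  assumes order: "monomial_order UNIV lt"
    and gs: "min_hom_generators gs A" and lq: "linear_quotients gs"
  shows "componentwise_linear A"
  unfolding componentwise_linear_def
proof (intro conjI allI)
  show "graded_ideal A" using gs graded_ideal_gen[of "set gs"] by (auto simp: min_hom_generators_def)
  fix j
  obtain hs where "\<forall>h\<in>set hs. homogeneous j h" "linear_quotients hs"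
    "ideal_gen {p \<in> A. homogeneous j p} = ideal_gen (set hs)"
    by (rule component_linear_quotients[OF order gs lq])
  then show "has_linear_resolution (ideal_gen {p \<in> A. homogeneous j p})"
    using linear_quotients_imp_linear_resolution[OF order] by simp
qed

section \<open>Minimality from relations with vanishing constant terms\<close>

lemma lookup_mult_0:
  fixes p q :: "('v, 'k::comm_ring_1) mpoly"
  assumes "Poly_Mapping.lookup q 0 = 0"
  shows "Poly_Mapping.lookup (p * q) 0 = 0"
proof (rule ccontr)
  assume "Poly_Mapping.lookup (p * q) 0 \<noteq> 0"
  then obtain a b where ab: "0 = a + b" "b \<in> Poly_Mapping.keys q"
    using keys_mult[of p q] by (auto simp: in_keys_iff)
  then have "mdeg a + mdeg b = 0" by (metis mdeg_0 mdeg_plus)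
  then have "b = 0" by simp
  with ab assms show False by (simp add: in_keys_iff)
qed

lemma is_ideal_no_const: "is_ideal {p :: ('v, 'k::comm_ring_1) mpoly. Poly_Mapping.lookup p 0 = 0}"
  by (rule is_idealI) (simp_all add: lookup_add lookup_mult_0)

text \<open>
The product of the graded maximal ideal with the ideal generated by \<open>G\<close>.
\<close>

definition irrelevant_mult :: "('v, 'k::comm_ring_1) mpoly set \<Rightarrow> ('v, 'k) mpoly set" where
  "irrelevant_mult G = ideal_gen {z * g | z g. Poly_Mapping.lookup z 0 = 0 \<and> g \<in> G}"

lemma irrelevant_mult_mem:
  assumes "Poly_Mapping.lookup z 0 = 0" "p \<in> ideal_gen G"
  shows "z * p \<in> irrelevant_mult G"
  using assms(2)
proof (induction rule: ideal.span_induct_alt)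
  case base
  then show ?case by (simp add: irrelevant_mult_def ideal.span_zero)
next
  case (step c g q)
  have "z * (c * g + q) = (c * z) * g + z * q" by (simp add: algebra_simps)
  moreover have "(c * z) * g \<in> irrelevant_mult G"
    unfolding irrelevant_mult_def using step(1) assms(1)
    by (intro ideal.span_base CollectI exI[of _ "c * z"] exI[of _ g]) (simp add: lookup_mult_0)
  ultimately show ?case
    using step(2) unfolding irrelevant_mult_def by (simp add: ideal.span_add)
qed

lemma irrelevant_mult_image:
  assumes "finite B" "p \<in> irrelevant_mult (f ` B)"
  shows "\<exists>z. p = (\<Sum>b\<in>B. z b * f b) \<and> (\<forall>b. Poly_Mapping.lookup (z b) 0 = 0)"
  using assms(2) unfolding irrelevant_mult_def
proof (induction rule: ideal.span_induct_alt)
  case base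
  then show ?case by (intro exI[of _ "\<lambda>_. 0"]) simp
next
  case (step c x q)
  then obtain w b z where *: "x = w * f b" "Poly_Mapping.lookup w 0 = 0" "b \<in> B"
    "q = (\<Sum>b\<in>B. z b * f b)" "\<forall>b. Poly_Mapping.lookup (z b) 0 = 0"
    by auto
  have "c * x = (\<Sum>b'\<in>B. if b' = b then c * w * f b else 0)"
    using assms(1) *(1,3) by (simp add: mult.assoc)
  then have "c * x + q = (\<Sum>b'\<in>B. (if b' = b then c * w * f b else 0) + z b' * f b')"
    by (simp only: *(4) sum.distrib)
  also have "\<dots> = (\<Sum>b'\<in>B. (if b' = b then c * w + z b' else z b') * f b')"
    by (rule sum.cong) (auto simp: algebra_simps)
  finally have "c * x + q = (\<Sum>b'\<in>B. (if b' = b then c * w + z b' else z b') * f b')" .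
  with *(2,5) show ?case
    by (intro exI[of _ "\<lambda>b'. if b' = b then c * w + z b' else z b'"]) (simp add: lookup_add lookup_mult_0)
qed

text \<open>
All coefficients of a relation between the generators have constant term 0: the last one by
assumption, and its term can be rewritten through the earlier generators with coefficients without
constant term, which leaves a shorter relation. A generator in the ideal of the others would
be a relation with coefficient \<open>-1\<close>.
\<close>

lemma irredundant_if_irrelevant_quotients:
  fixes gs :: "('v, 'k::field) mpoly list"
  assumes "\<And>j r. j < length gs \<Longrightarrow> r * gs ! j \<in> ideal_gen (set (take j gs)) \<Longrightarrow>
      Poly_Mapping.lookup r 0 = 0 \<and> r * gs ! j \<in> irrelevant_mult (set (take j gs))"
    and j: "j < length gs"
  shows "gs ! j \<notin> ideal_gen {gs ! i | i. i < length gs \<and> i \<noteq> j}"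
proof
  have rel: "\<forall>i<n. Poly_Mapping.lookup (c i) 0 = 0" if "n \<le> length gs" "(\<Sum>i<n. c i * gs ! i) = 0" for n c
    using that
  proof (induction n arbitrary: c)
    case (Suc n)
    then have n: "n < length gs" by simp
    have "c n * gs ! n = (\<Sum>i<n. - c i * gs ! i)"
      using Suc.prems(2) by (simp add: sum_negf eq_neg_iff_add_eq_0 add.commute)
    also have "\<dots> \<in> ideal_gen (set (take n gs))"
      using n by (intro ideal.span_sum ideal.span_scale ideal.span_base) (simp add: set_take_conv_image)
    finally have cn: "Poly_Mapping.lookup (c n) 0 = 0" "c n * gs ! n \<in> irrelevant_mult ((!) gs ` {..<n})"
      using assms(1)[OF n] n by (simp_all add: set_take_conv_image)
    then obtain z where z: "c n * gs ! n = (\<Sum>i<n. z i * gs ! i)" "\<forall>i. Poly_Mapping.lookup (z i) 0 = 0"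
      using irrelevant_mult_image[of "{..<n}" "c n * gs ! n" "(!) gs"] by auto
    have "(\<Sum>i<n. (c i + z i) * gs ! i) = 0"
      using Suc.prems(2) z(1) by (simp add: distrib_right sum.distrib)
    then have "\<forall>i<n. Poly_Mapping.lookup (c i + z i) 0 = 0"
      using Suc.prems(1) by (intro Suc.IH) auto
    with z(2) cn(1) show ?case by (simp add: lookup_add less_Suc_eq)
  qed simp
  assume "gs ! j \<in> ideal_gen {gs ! i | i. i < length gs \<and> i \<noteq> j}"
  also have "{gs ! i | i. i < length gs \<and> i \<noteq> j} = (!) gs ` ({..<length gs} - {j})" by auto
  finally obtain c where c: "gs ! j = (\<Sum>i\<in>{..<length gs} - {j}. c i * gs ! i)"
    by (auto simp: ideal_gen_image)
  define c' where "c' = c(j := - 1)"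
  have "(\<Sum>i<length gs. c' i * gs ! i) = c' j * gs ! j + (\<Sum>i\<in>{..<length gs} - {j}. c' i * gs ! i)"
    using j by (simp add: sum.remove)
  also have "(\<Sum>i\<in>{..<length gs} - {j}. c' i * gs ! i) = gs ! j"
    unfolding c by (rule sum.cong) (auto simp: c'_def)
  finally have "(\<Sum>i<length gs. c' i * gs ! i) = 0" by (simp add: c'_def)
  from rel[OF order.refl this] j have "Poly_Mapping.lookup (c' j) 0 = 0" by blast
  then show False by (simp add: c'_def lookup_minus)
qed

section \<open>Powers of ideals\<close>

definition y_monomials :: "nat \<Rightarrow> nat \<Rightarrow> nat monomial set" where
  "y_monomials m k = {b. Poly_Mapping.keys b \<subseteq> {..<m} \<and> mdeg b = k}"

abbreviation gen_product :: "'a::comm_ring_1 list \<Rightarrow> nat monomial \<Rightarrow> 'a" where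
  "gen_product fs \<equiv> monomial_value ((!) fs)"

lemma finite_y_monomials [simp]: "finite (y_monomials m k)"
  by (rule finite_subset[OF _ finite_monomials[of "{..<m}" k]]) (auto simp: y_monomials_def)

lemma y_monomials_0: "y_monomials m 0 = {0}"
  by (auto simp: y_monomials_def)

lemma y_monomials_1: "y_monomials m 1 = (\<lambda>j. Poly_Mapping.single j 1) ` {..<m}"
  by (auto simp: y_monomials_def dest!: mdeg_1_single)

lemma y_monomials_plus: "b \<in> y_monomials m k \<Longrightarrow> b' \<in> y_monomials m k' \<Longrightarrow> b + b' \<in> y_monomials m (k + k')"
  by (simp add: y_monomials_def keys_plus_nat)

lemma ideal_mult_ideal_gen:
  "ideal_mult (ideal_gen F) (ideal_gen G) = ideal_gen {f * g | f g. f \<in> F \<and> g \<in> G}" (is "_ = ?R")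
proof
  have 1: "f * q \<in> ?R" if "f \<in> F" "q \<in> ideal_gen G" for f q
  proof -
    have "G \<subseteq> colon ?R f"
      using that(1) by (auto simp: colon_def intro!: ideal.span_base) (metis mult.commute)
    then have "ideal_gen G \<subseteq> colon ?R f"
      by (intro ideal.span_minimal is_ideal_colon ideal.subspace_span)
    then show ?thesis using that(2) by (auto simp: colon_def mult.commute)
  qed
  have "p * q \<in> ?R" if "p \<in> ideal_gen F" "q \<in> ideal_gen G" for p q
  proof -
    have "ideal_gen F \<subseteq> colon ?R q"
      using 1 that(2) by (intro ideal.span_minimal is_ideal_colon ideal.subspace_span) (auto simp: colon_def)
    then show ?thesis using that(1) by (auto simp: colon_def)
  qed
  then show "ideal_mult (ideal_gen F) (ideal_gen G) \<subseteq> ?R"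
    unfolding ideal_mult_def by (intro ideal.span_minimal ideal.subspace_span) auto
  show "?R \<subseteq> ideal_mult (ideal_gen F) (ideal_gen G)"
    unfolding ideal_mult_def by (rule ideal.span_mono) (blast intro: ideal.span_base)
qed

lemma ideal_power_ideal_gen:
  "ideal_power (ideal_gen (set fs)) k = ideal_gen (gen_product fs ` y_monomials (length fs) k)"
proof (induction k)
  case 0
  have "ideal_gen {1 :: 'a} = UNIV"
    by (rule ideal_eq_UNIV) (simp_all add: ideal.span_base)
  then show ?case by (simp add: y_monomials_0)
next
  case (Suc k)
  have "{f * g | f g. f \<in> set fs \<and> g \<in> gen_product fs ` y_monomials (length fs) k}
      = gen_product fs ` y_monomials (length fs) (Suc k)" (is "?L = ?R")
  proof
    show "?L \<subseteq> ?R"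
    proof
      fix p assume "p \<in> ?L"
      then obtain j b where jb: "j < length fs" "b \<in> y_monomials (length fs) k" "p = fs ! j * gen_product fs b"
        by (auto simp: in_set_conv_nth)
      then have "Poly_Mapping.single j 1 + b \<in> y_monomials (length fs) (1 + k)"
        by (intro y_monomials_plus) (auto simp: y_monomials_1)
      moreover have "p = gen_product fs (Poly_Mapping.single j 1 + b)"
        using jb(3) by (simp add: monomial_value_plus)
      ultimately show "p \<in> ?R" by (metis Suc_eq_plus1_left image_eqI)
    qed
    show "?R \<subseteq> ?L"
    proof
      fix p assume "p \<in> ?R"
      then obtain b where b: "Poly_Mapping.keys b \<subseteq> {..<length fs}" "mdeg b = Suc k" "p = gen_product fs b"
        by (auto simp: y_monomials_def)
      then have "Poly_Mapping.keys b \<noteq> {}" by auto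
      then obtain j where j: "j \<in> Poly_Mapping.keys b" by blast
      define b' where "b' = b - Poly_Mapping.single j 1"
      have bb: "b = Poly_Mapping.single j 1 + b'" using monomial_remove_var[OF j] by (simp add: b'_def)
      then have "b' \<in> y_monomials (length fs) k"
        using b(1,2) by (auto simp: y_monomials_def keys_plus_nat)
      moreover have "fs ! j \<in> set fs" using j b(1) by auto
      moreover have "p = fs ! j * gen_product fs b'"
        unfolding b(3) bb monomial_value_plus by simp
      ultimately show "p \<in> ?L" by blast
    qed
  qed
  then show ?case using Suc by (simp add: ideal_mult_ideal_gen)
qed

section \<open>The Rees algebra\<close>

definition combine :: "'x monomial \<Rightarrow> 'y monomial \<Rightarrow> ('x + 'y) monomial" where
  "combine a b = Abs_poly_mapping (case_sum (Poly_Mapping.lookup a) (Poly_Mapping.lookup b))"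

abbreviation xpart :: "('x + 'y) monomial \<Rightarrow> 'x monomial" where
  "xpart \<equiv> Poly_Mapping.map_key Inl"

abbreviation ypart :: "('x + 'y) monomial \<Rightarrow> 'y monomial" where
  "ypart \<equiv> Poly_Mapping.map_key Inr"

lemma lookup_combine:
  "Poly_Mapping.lookup (combine a b) = case_sum (Poly_Mapping.lookup a) (Poly_Mapping.lookup b)"
proof -
  have "{v. case_sum (Poly_Mapping.lookup a) (Poly_Mapping.lookup b) v \<noteq> 0}
      \<subseteq> Inl ` Poly_Mapping.keys a \<union> Inr ` Poly_Mapping.keys b"
  proof
    fix v assume "v \<in> {v. case_sum (Poly_Mapping.lookup a) (Poly_Mapping.lookup b) v \<noteq> 0}"
    then show "v \<in> Inl ` Poly_Mapping.keys a \<union> Inr ` Poly_Mapping.keys b"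
      by (cases v) (simp_all add: in_keys_iff)
  qed
  then have "finite {v. case_sum (Poly_Mapping.lookup a) (Poly_Mapping.lookup b) v \<noteq> 0}"
    by (rule finite_subset) simp
  then show ?thesis unfolding combine_def by (rule lookup_Abs_poly_mapping)
qed

lemma lookup_xpart [simp]: "Poly_Mapping.lookup (xpart \<mu>) i = Poly_Mapping.lookup \<mu> (Inl i)"
  and lookup_ypart [simp]: "Poly_Mapping.lookup (ypart \<mu>) j = Poly_Mapping.lookup \<mu> (Inr j)"
  by (simp_all add: map_key.rep_eq)

lemma xpart_combine [simp]: "xpart (combine a b) = a"
  and ypart_combine [simp]: "ypart (combine a b) = b"
  by (rule poly_mapping_eqI, simp add: lookup_combine)+

lemma combine_parts [simp]: "combine (xpart \<mu>) (ypart \<mu>) = \<mu>"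
  by (rule poly_mapping_eqI) (simp add: lookup_combine split: sum.splits)

lemma keys_combine:
  "Poly_Mapping.keys (combine a b) = Inl ` Poly_Mapping.keys a \<union> Inr ` Poly_Mapping.keys b"
proof (rule Set.set_eqI)
  fix v
  show "v \<in> Poly_Mapping.keys (combine a b) \<longleftrightarrow> v \<in> Inl ` Poly_Mapping.keys a \<union> Inr ` Poly_Mapping.keys b"
    by (cases v) (auto simp: in_keys_iff lookup_combine)
qed

lemma inj_combine: "inj (\<lambda>a. combine a b)"
  by (metis injI xpart_combine)

lemma mdeg_parts: "mdeg \<mu> = mdeg (xpart \<mu>) + mdeg (ypart \<mu>)"
proof -
  have "mdeg \<mu> = mdeg (combine (xpart \<mu>) (ypart \<mu>))" by simp
  also have "\<dots> = mdeg (xpart \<mu>) + mdeg (ypart \<mu>)"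
    unfolding mdeg_def keys_combine
    by (subst sum.union_disjoint) (auto simp: sum.reindex lookup_combine)
  finally show ?thesis .
qed

lemma xpart_plus: "xpart (\<mu> + \<nu>) = xpart \<mu> + xpart \<nu>"
  and ypart_plus: "ypart (\<mu> + \<nu>) = ypart \<mu> + ypart \<nu>"
  for \<mu> \<nu> :: "('x + 'y) monomial"
  by (simp_all add: map_key_plus)

lemma mem_monomials_in_rees_vars:
  "\<mu> \<in> monomials_in (rees_vars m) \<longleftrightarrow> ypart \<mu> \<in> monomials_in {..<m}"
proof -
  have "Poly_Mapping.keys \<mu> = Inl ` Poly_Mapping.keys (xpart \<mu>) \<union> Inr ` Poly_Mapping.keys (ypart \<mu>)"
    by (simp flip: keys_combine)
  then show ?thesis by (auto simp: monomials_in_def rees_vars_def)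
qed

text \<open>
The coefficient of \<open>y^b\<close> when \<open>p\<close> is read as a polynomial in the \<open>y\<close> over the polynomial ring in the \<open>x\<close>.
\<close>

definition y_coeff :: "('x + 'y, 'k::zero) mpoly \<Rightarrow> 'y monomial \<Rightarrow> ('x, 'k) mpoly" where
  "y_coeff p b = Poly_Mapping.map_key (\<lambda>a. combine a b) p"

lemma lookup_y_coeff: "Poly_Mapping.lookup (y_coeff p b) a = Poly_Mapping.lookup p (combine a b)"
  unfolding y_coeff_def by (simp add: map_key.rep_eq[OF inj_combine])

lemma y_coeff_eq_0: "b \<notin> ypart ` Poly_Mapping.keys p \<Longrightarrow> y_coeff p b = 0"
  by (rule poly_mapping_eqI) (metis image_eqI in_keys_iff lookup_y_coeff lookup_zero ypart_combine)

lemma y_coeff_nonzeroD: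
  assumes "y_coeff p b \<noteq> 0"
  shows "\<exists>\<mu>\<in>Poly_Mapping.keys p. ypart \<mu> = b"
  using assms y_coeff_eq_0[of b p] by blast

lemma prod_monom:
  "finite A \<Longrightarrow> (\<Prod>i\<in>A. Polynomial.monom (f i) (d i)) = Polynomial.monom (\<Prod>i\<in>A. f i) (\<Sum>i\<in>A. d i)"
  for f :: "'i \<Rightarrow> 'a::comm_ring_1"
  by (induction A rule: finite_induct) (simp_all add: mult_monom monom_0 one_pCons)

lemma sum_monom:
  "(\<Sum>i\<in>A. Polynomial.monom (f i) d) = Polynomial.monom (\<Sum>i\<in>A. f i) d"
  by (induction A rule: infinite_finite_induct) (simp_all add: add_monom)

lemma rees_term:
  fixes fs :: "('x, 'k::comm_ring_1) mpoly list"
  shows "[:mconst c:] * (\<Prod>v\<in>Poly_Mapping.keys \<mu>.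
      (case v of Inl i \<Rightarrow> [:mvar i:] | Inr j \<Rightarrow> Polynomial.monom (fs ! j) 1) ^ Poly_Mapping.lookup \<mu> v)
    = Polynomial.monom (Poly_Mapping.single (xpart \<mu>) c * gen_product fs (ypart \<mu>)) (mdeg (ypart \<mu>))"
proof -
  define a b where "a = xpart \<mu>" and "b = ypart \<mu>"
  have \<mu>: "\<mu> = combine a b" by (simp add: a_def b_def)
  let ?g = "\<lambda>v. (case v of Inl i \<Rightarrow> [:mvar i:] | Inr j \<Rightarrow> Polynomial.monom (fs ! j) 1)
      ^ Poly_Mapping.lookup \<mu> v"
  have "(\<Prod>v\<in>Poly_Mapping.keys \<mu>. ?g v) =
      (\<Prod>v\<in>Inl ` Poly_Mapping.keys a. ?g v) * (\<Prod>v\<in>Inr ` Poly_Mapping.keys b. ?g v)"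
    unfolding \<mu> keys_combine by (rule prod.union_disjoint) auto
  also have "(\<Prod>v\<in>Inl ` Poly_Mapping.keys a. ?g v) =
      (\<Prod>i\<in>Poly_Mapping.keys a. Polynomial.monom (mvar i ^ Poly_Mapping.lookup a i) 0)"
    by (simp add: prod.reindex \<mu> lookup_combine monom_power flip: monom_0)
  also have "\<dots> = Polynomial.monom (monomial_value mvar a) 0"
    by (simp add: prod_monom monomial_value_def)
  also have "(\<Prod>v\<in>Inr ` Poly_Mapping.keys b. ?g v) =
      (\<Prod>j\<in>Poly_Mapping.keys b. Polynomial.monom ((fs ! j) ^ Poly_Mapping.lookup b j) (Poly_Mapping.lookup b j))"
    by (simp add: prod.reindex \<mu> lookup_combine monom_power)
  also have "\<dots> = Polynomial.monom (gen_product fs b) (mdeg b)"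
    by (simp add: prod_monom monomial_value_def mdeg_def)
  finally have "[:mconst c:] * (\<Prod>v\<in>Poly_Mapping.keys \<mu>. ?g v) =
      Polynomial.monom (mconst c * monomial_value mvar a * gen_product fs b) (mdeg b)"
    by (simp add: mult_monom mult.assoc flip: monom_0)
  then show ?thesis
    by (simp add: a_def b_def flip: single_conv_vars)
qed

lemma rees_map_conv:
  fixes fs :: "('x, 'k::comm_ring_1) mpoly list"
  shows "rees_map fs p =
    (\<Sum>b\<in>ypart ` Poly_Mapping.keys p. Polynomial.monom (y_coeff p b * gen_product fs b) (mdeg b))"
proof -
  let ?t = "\<lambda>\<mu>. Polynomial.monom (Poly_Mapping.single (xpart \<mu>) (Poly_Mapping.lookup p \<mu>)
      * gen_product fs (ypart \<mu>)) (mdeg (ypart \<mu>))"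
  have coeff: "(\<Sum>\<mu>\<in>{\<mu> \<in> Poly_Mapping.keys p. ypart \<mu> = b}. Poly_Mapping.single (xpart \<mu>) (Poly_Mapping.lookup p \<mu>))
      = y_coeff p b" for b
  proof (rule poly_mapping_eqI)
    fix a
    have "Poly_Mapping.lookup (\<Sum>\<mu>\<in>{\<mu> \<in> Poly_Mapping.keys p. ypart \<mu> = b}.
        Poly_Mapping.single (xpart \<mu>) (Poly_Mapping.lookup p \<mu>)) a
      = (\<Sum>\<mu>\<in>{\<mu> \<in> Poly_Mapping.keys p. ypart \<mu> = b}. if \<mu> = combine a b then Poly_Mapping.lookup p (combine a b) else 0)"
      unfolding lookup_sum by (rule sum.cong) (auto simp: lookup_single when_def)
    also have "\<dots> = Poly_Mapping.lookup p (combine a b)"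
      by (simp add: in_keys_iff)
    finally show "Poly_Mapping.lookup (\<Sum>\<mu>\<in>{\<mu> \<in> Poly_Mapping.keys p. ypart \<mu> = b}.
        Poly_Mapping.single (xpart \<mu>) (Poly_Mapping.lookup p \<mu>)) a = Poly_Mapping.lookup (y_coeff p b) a"
      by (simp add: lookup_y_coeff)
  qed
  have "rees_map fs p = (\<Sum>\<mu>\<in>Poly_Mapping.keys p. ?t \<mu>)"
    unfolding rees_map_def by (rule sum.cong[OF HOL.refl]) (rule rees_term)
  also have "\<dots> = (\<Sum>b\<in>ypart ` Poly_Mapping.keys p. \<Sum>\<mu>\<in>{\<mu> \<in> Poly_Mapping.keys p. ypart \<mu> = b}. ?t \<mu>)"
    by (rule sum.image_gen) simp
  also have "\<dots> = (\<Sum>b\<in>ypart ` Poly_Mapping.keys p. Polynomial.monom (y_coeff p b * gen_product fs b) (mdeg b))"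
  proof (rule sum.cong[OF HOL.refl])
    fix b
    have "(\<Sum>\<mu>\<in>{\<mu> \<in> Poly_Mapping.keys p. ypart \<mu> = b}. ?t \<mu>) =
        (\<Sum>\<mu>\<in>{\<mu> \<in> Poly_Mapping.keys p. ypart \<mu> = b}. Polynomial.monom (Poly_Mapping.single (xpart \<mu>) (Poly_Mapping.lookup p \<mu>)
          * gen_product fs b) (mdeg b))"
      by (rule sum.cong) auto
    also have "\<dots> = Polynomial.monom (y_coeff p b * gen_product fs b) (mdeg b)"
      by (simp add: sum_monom coeff flip: sum_distrib_right)
    finally show "(\<Sum>\<mu>\<in>{\<mu> \<in> Poly_Mapping.keys p. ypart \<mu> = b}. ?t \<mu>) =
        Polynomial.monom (y_coeff p b * gen_product fs b) (mdeg b)" .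
  qed
  finally show ?thesis .
qed

text \<open>
The coefficient of \<open>t^k\<close> in the image of \<open>p\<close> collects the monomials of degree \<open>k\<close> in \<open>y\<close>. So membership
in the defining ideal means one relation between the products \<open>f^b\<close> for every \<open>k\<close>.
\<close>

lemma mem_rees_ideal_iff:
  fixes fs :: "('x, 'k::comm_ring_1) mpoly list"
  shows "p \<in> rees_ideal fs \<longleftrightarrow> p \<in> polys_in (rees_vars (length fs)) \<and>
    (\<forall>k. (\<Sum>b\<in>y_monomials (length fs) k. y_coeff p b * gen_product fs b) = 0)"
proof (cases "p \<in> polys_in (rees_vars (length fs))")
  case True
  have "coeff (rees_map fs p) k = (\<Sum>b\<in>y_monomials (length fs) k. y_coeff p b * gen_product fs b)" for k
  proof -
    have keys: "Poly_Mapping.keys (ypart \<mu>) \<subseteq> {..<length fs}" if "\<mu> \<in> Poly_Mapping.keys p" for \<mu>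
    proof -
      have "\<mu> \<in> monomials_in (rees_vars (length fs))" using that True by (auto simp: polys_in_def)
      then show ?thesis unfolding mem_monomials_in_rees_vars by (simp add: monomials_in_def)
    qed
    have "coeff (rees_map fs p) k =
        (\<Sum>b\<in>ypart ` Poly_Mapping.keys p. if mdeg b = k then y_coeff p b * gen_product fs b else 0)"
      by (simp add: rees_map_conv Polynomial.coeff_sum)
    also have "\<dots> = (\<Sum>b\<in>{b \<in> ypart ` Poly_Mapping.keys p. mdeg b = k}. y_coeff p b * gen_product fs b)"
      by (simp add: sum.inter_filter)
    also have "\<dots> = (\<Sum>b\<in>y_monomials (length fs) k. y_coeff p b * gen_product fs b)"
    proof (rule sum.mono_neutral_left)
      show "{b \<in> ypart ` Poly_Mapping.keys p. mdeg b = k} \<subseteq> y_monomials (length fs) k"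
        using keys by (auto simp: y_monomials_def)
      show "\<forall>b\<in>y_monomials (length fs) k - {b \<in> ypart ` Poly_Mapping.keys p. mdeg b = k}.
          y_coeff p b * gen_product fs b = 0"
      proof
        fix b assume "b \<in> y_monomials (length fs) k - {b \<in> ypart ` Poly_Mapping.keys p. mdeg b = k}"
        then have "b \<notin> ypart ` Poly_Mapping.keys p" by (auto simp: y_monomials_def)
        then show "y_coeff p b * gen_product fs b = 0" by (simp add: y_coeff_eq_0)
      qed
    qed simp
    finally show ?thesis .
  qed
  then show ?thesis using True by (simp add: rees_ideal_def poly_eq_iff)
qed (simp add: rees_ideal_def)

lemma ex_mpoly_with_y_coeffs:
  fixes c :: "'y monomial \<Rightarrow> ('x, 'k::zero) mpoly"
  assumes "finite B"
  shows "\<exists>p. \<forall>b. y_coeff p b = (if b \<in> B then c b else 0)"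
proof -
  define f where "f \<mu> = (if ypart \<mu> \<in> B then Poly_Mapping.lookup (c (ypart \<mu>)) (xpart \<mu>) else 0)" for \<mu>
  have "{\<mu>. f \<mu> \<noteq> 0} \<subseteq> (\<Union>b\<in>B. (\<lambda>a. combine a b) ` Poly_Mapping.keys (c b))"
  proof
    fix \<mu> assume "\<mu> \<in> {\<mu>. f \<mu> \<noteq> 0}"
    then have "ypart \<mu> \<in> B" "xpart \<mu> \<in> Poly_Mapping.keys (c (ypart \<mu>))"
      by (auto simp: f_def in_keys_iff split: if_splits)
    then show "\<mu> \<in> (\<Union>b\<in>B. (\<lambda>a. combine a b) ` Poly_Mapping.keys (c b))"
      by (intro UN_I[of "ypart \<mu>"] image_eqI[of _ _ "xpart \<mu>"]) simp_all
  qed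
  then have "finite {\<mu>. f \<mu> \<noteq> 0}" by (rule finite_subset) (use assms in simp)
  then have "Poly_Mapping.lookup (Abs_poly_mapping f) = f" by (rule lookup_Abs_poly_mapping)
  then show ?thesis
    by (intro exI[of _ "Abs_poly_mapping f"] allI poly_mapping_eqI) (simp add: lookup_y_coeff f_def)
qed

lemma monomial_in_ideal_gen_in:
  fixes N :: "'v monomial set"
  assumes "Poly_Mapping.single \<mu> (1::'k::comm_ring_1) \<in> ideal_gen_in V {Poly_Mapping.single \<nu> 1 | \<nu>. \<nu> \<in> N}"
  shows "\<exists>\<nu>\<in>N. \<exists>\<rho>. \<mu> = \<rho> + \<nu>"
proof -
  obtain F c where F: "F \<subseteq> {Poly_Mapping.single \<nu> (1::'k) | \<nu>. \<nu> \<in> N}"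
    and eq: "Poly_Mapping.single \<mu> (1::'k) = (\<Sum>g\<in>F. c g * g)"
    using assms by (auto simp: ideal_gen_in_def)
  have "\<mu> \<in> Poly_Mapping.keys (\<Sum>g\<in>F. c g * g)" by (simp flip: eq)
  then have "Poly_Mapping.lookup (\<Sum>g\<in>F. c g * g) \<mu> \<noteq> 0" by (simp add: in_keys_iff)
  then obtain g where g: "g \<in> F" "Poly_Mapping.lookup (c g * g) \<mu> \<noteq> 0"
    unfolding lookup_sum by (meson sum.not_neutral_contains_not_neutral)
  obtain \<nu> where \<nu>: "\<nu> \<in> N" "g = Poly_Mapping.single \<nu> 1" using F g(1) by blast
  have "\<mu> \<in> Poly_Mapping.keys (c g * g)" using g(2) by (simp add: in_keys_iff)
  then obtain \<rho> \<nu>' where "\<mu> = \<rho> + \<nu>'" "\<nu>' \<in> Poly_Mapping.keys g" using keys_mult[of "c g" g] by blast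
  then show ?thesis using \<nu> by auto
qed

lemma monomial_in_ideal_gen_inI:
  fixes N :: "'v monomial set"
  assumes "\<mu> \<in> N"
  shows "Poly_Mapping.single \<mu> (1::'k::comm_ring_1) \<in> ideal_gen_in V {Poly_Mapping.single \<nu> 1 | \<nu>. \<nu> \<in> N}"
  unfolding ideal_gen_in_def
proof (rule CollectI, intro exI conjI)
  show "Poly_Mapping.single \<mu> (1::'k) = (\<Sum>g\<in>{Poly_Mapping.single \<mu> 1}. 1 * g)" by simp
  show "{Poly_Mapping.single \<mu> (1::'k)} \<subseteq> {Poly_Mapping.single \<nu> 1 | \<nu>. \<nu> \<in> N}" using assms by blast
qed (auto simp: polys_in_def monomials_in_def)

lemma initial_ideal_conv:
  "initial_ideal V lt J = ideal_gen_in V {Poly_Mapping.single \<nu> 1 | \<nu>. \<nu> \<in> initial_monomial lt ` {p \<in> J. p \<noteq> 0}}"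
  unfolding initial_ideal_def by (rule arg_cong[of _ _ "ideal_gen_in V"]) auto

text \<open>
A quadratic generator dividing the initial monomial of \<open>p\<close> lies in the initial ideal, hence is itself
divisible by the initial monomial of some \<open>q\<close> in \<open>J\<close>.
\<close>

lemma quadratic_initial_divisor:
  fixes J :: "('v, 'k::comm_ring_1) mpoly set"
  assumes quad: "generated_by_quadratic_monomials V (initial_ideal V lt J)" and p: "p \<in> J" "p \<noteq> 0"
  shows "\<exists>q\<in>J. q \<noteq> 0 \<and> mdeg (initial_monomial lt q) \<le> 2 \<and>
    (\<exists>\<rho>. initial_monomial lt p = \<rho> + initial_monomial lt q)"
proof -
  obtain Q where Q: "Q \<subseteq> {\<mu> \<in> monomials_in V. mdeg \<mu> = 2}"
    "initial_ideal V lt J = ideal_gen_in V {Poly_Mapping.single \<mu> 1 | \<mu>. \<mu> \<in> Q}"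
    using quad by (auto simp: generated_by_quadratic_monomials_def)
  let ?N = "initial_monomial lt ` {p \<in> J. p \<noteq> 0}"
  have "Poly_Mapping.single (initial_monomial lt p) 1 \<in> initial_ideal V lt J"
    unfolding initial_ideal_conv using p by (intro monomial_in_ideal_gen_inI) blast
  then obtain \<mu> \<rho> where \<mu>: "\<mu> \<in> Q" "initial_monomial lt p = \<rho> + \<mu>"
    unfolding Q(2) using monomial_in_ideal_gen_in by blast
  have "Poly_Mapping.single \<mu> 1 \<in> initial_ideal V lt J"
    unfolding Q(2) using \<mu>(1) by (rule monomial_in_ideal_gen_inI)
  then obtain q \<rho>' where q: "q \<in> J" "q \<noteq> 0" "\<mu> = \<rho>' + initial_monomial lt q"
    unfolding initial_ideal_conv using monomial_in_ideal_gen_in by blast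
  have "mdeg \<mu> = 2" using \<mu>(1) Q(1) by blast
  then have "mdeg (initial_monomial lt q) \<le> 2" using q(3) by simp
  moreover have "initial_monomial lt p = (\<rho> + \<rho>') + initial_monomial lt q"
    using \<mu>(2) q(3) by (simp add: add.assoc)
  ultimately show ?thesis using q by blast
qed

section \<open>The linear relations provided by the initial ideal\<close>

lemma induced_order_strict:
  fixes ltx :: "'x monomial \<Rightarrow> 'x monomial \<Rightarrow> bool"
  assumes "monomial_order UNIV ltx" "monomial_order {..<m} lty"
  shows "irreflp_on (monomials_in (rees_vars m)) (induced_order lty ltx)"
    and "transp_on (monomials_in (rees_vars m)) (induced_order lty ltx)"
    and "totalp_on (monomials_in (rees_vars m)) (induced_order lty ltx)"
proof -
  note x = monomial_order_strict[OF assms(1), simplified] and y = monomial_order_strict[OF assms(2)]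
  show "irreflp_on (monomials_in (rees_vars m)) (induced_order lty ltx)"
  proof (rule irreflp_onI)
    fix \<mu> :: "('x + nat) monomial"
    assume "\<mu> \<in> monomials_in (rees_vars m)"
    then show "\<not> induced_order lty ltx \<mu> \<mu>"
      using irreflp_onD[OF x(1), of "xpart \<mu>"] irreflp_onD[OF y(1), of "ypart \<mu>"]
      by (simp add: mem_monomials_in_rees_vars induced_order_def Let_def)
  qed
  show "transp_on (monomials_in (rees_vars m)) (induced_order lty ltx)"
  proof (rule transp_onI)
    fix \<kappa> \<mu> \<nu> :: "('x + nat) monomial"
    assume "\<kappa> \<in> monomials_in (rees_vars m)" "\<mu> \<in> monomials_in (rees_vars m)" "\<nu> \<in> monomials_in (rees_vars m)"
      and le: "induced_order lty ltx \<kappa> \<mu>" "induced_order lty ltx \<mu> \<nu>"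
    then have "lty (ypart \<kappa>) (ypart \<mu>) \<Longrightarrow> lty (ypart \<mu>) (ypart \<nu>) \<Longrightarrow> lty (ypart \<kappa>) (ypart \<nu>)"
      unfolding mem_monomials_in_rees_vars by (blast intro: transp_onD[OF y(2)])
    moreover have "ltx (xpart \<kappa>) (xpart \<mu>) \<Longrightarrow> ltx (xpart \<mu>) (xpart \<nu>) \<Longrightarrow> ltx (xpart \<kappa>) (xpart \<nu>)"
      using transp_onD[OF x(2)] by blast
    ultimately show "induced_order lty ltx \<kappa> \<nu>"
      using le by (auto simp: induced_order_def Let_def)
  qed
  show "totalp_on (monomials_in (rees_vars m)) (induced_order lty ltx)"
  proof (rule totalp_onI)
    fix \<mu> \<nu> :: "('x + nat) monomial"
    assume "\<mu> \<in> monomials_in (rees_vars m)" "\<nu> \<in> monomials_in (rees_vars m)" "\<mu> \<noteq> \<nu>"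
    moreover from this have "ypart \<mu> = ypart \<nu> \<Longrightarrow> xpart \<mu> \<noteq> xpart \<nu>" by (metis combine_parts)
    ultimately show "induced_order lty ltx \<mu> \<nu> \<or> induced_order lty ltx \<nu> \<mu>"
      using totalp_onD[OF x(3), of "xpart \<mu>" "xpart \<nu>"] totalp_onD[OF y(3), of "ypart \<mu>" "ypart \<nu>"]
      by (cases "ypart \<mu> = ypart \<nu>") (auto simp: mem_monomials_in_rees_vars induced_order_def Let_def)
  qed
qed

context
  fixes fs :: "('x::finite, 'k::field) mpoly list" and I :: "('x, 'k) mpoly set"
    and ltx :: "'x monomial \<Rightarrow> 'x monomial \<Rightarrow> bool" and lty :: "nat monomial \<Rightarrow> nat monomial \<Rightarrow> bool"
  assumes gens: "min_hom_generators fs I"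
    and ltx: "monomial_order UNIV ltx" and lty: "monomial_order {..<length fs} lty"
    and quad: "generated_by_quadratic_monomials (rees_vars (length fs))
           (initial_ideal (rees_vars (length fs)) (induced_order lty ltx) (rees_ideal fs))"
begin

definition lower_monomials :: "nat \<Rightarrow> nat monomial \<Rightarrow> nat monomial set" where
  "lower_monomials k b = {b' \<in> y_monomials (length fs) k. lty b' b}"

lemma y_monomials_in: "b \<in> y_monomials (length fs) k \<Longrightarrow> b \<in> monomials_in {..<length fs}"
  by (simp add: y_monomials_def monomials_in_def)

lemma lty_irrefl: "b \<in> y_monomials (length fs) k \<Longrightarrow> \<not> lty b b"
  using irreflp_onD[OF monomial_order_strict(1)[OF lty]] y_monomials_in by blast

lemma lty_trans:
  "lty a b \<Longrightarrow> lty b c \<Longrightarrow> a \<in> y_monomials (length fs) k \<Longrightarrow> b \<in> y_monomials (length fs) k \<Longrightarrow>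
    c \<in> y_monomials (length fs) k \<Longrightarrow> lty a c"
  using transp_onD[OF monomial_order_strict(2)[OF lty]] y_monomials_in by blast

lemma lower_monomials_plus:
  assumes "b' \<in> lower_monomials k b" "b \<in> y_monomials (length fs) k" "\<beta> \<in> y_monomials (length fs) k'"
  shows "b' + \<beta> \<in> lower_monomials (k + k') (b + \<beta>)"
proof -
  have b': "b' \<in> y_monomials (length fs) k" "lty b' b" using assms(1) by (auto simp: lower_monomials_def)
  have "lty (b' + \<beta>) (b + \<beta>)"
    using monomial_order_plus_right[OF lty b'(2)] b'(1) assms(2,3) y_monomials_in by blast
  then show ?thesis using b'(1) assms(3) by (simp add: lower_monomials_def y_monomials_plus)
qed

lemma relation_of_rees_element:
  assumes p: "p \<in> rees_ideal fs" "p \<noteq> 0"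
  defines a_def: "a \<equiv> xpart (initial_monomial (induced_order lty ltx) p)"
    and b_def: "b \<equiv> ypart (initial_monomial (induced_order lty ltx) p)"
  shows "b \<in> y_monomials (length fs) (mdeg b)"
    and "a \<in> Poly_Mapping.keys (y_coeff p b)"
    and "\<And>\<nu>. \<nu> \<in> Poly_Mapping.keys (y_coeff p b) \<Longrightarrow> \<nu> \<noteq> a \<Longrightarrow> ltx \<nu> a"
    and "\<And>b' k. b' \<noteq> b \<Longrightarrow> y_coeff p b' \<noteq> 0 \<Longrightarrow> lty b' b"
    and "(\<Sum>b'\<in>y_monomials (length fs) k. y_coeff p b' * gen_product fs b') = 0"
proof -
  let ?\<mu> = "initial_monomial (induced_order lty ltx) p"
  have keys: "Poly_Mapping.keys p \<subseteq> monomials_in (rees_vars (length fs))"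
    using p(1) by (simp add: mem_rees_ideal_iff polys_in_def)
  note init = initial_monomial[OF induced_order_strict[OF ltx lty] keys p(2)]
  have \<mu>: "?\<mu> = combine a b" by (simp add: a_def b_def)
  have "b \<in> monomials_in {..<length fs}"
    using init(1) keys unfolding b_def mem_monomials_in_rees_vars[symmetric] by blast
  then show "b \<in> y_monomials (length fs) (mdeg b)" by (simp add: y_monomials_def monomials_in_def)
  show "a \<in> Poly_Mapping.keys (y_coeff p b)"
    using init(1) by (simp add: in_keys_iff lookup_y_coeff flip: \<mu>)
  show "ltx \<nu> a" if "\<nu> \<in> Poly_Mapping.keys (y_coeff p b)" "\<nu> \<noteq> a" for \<nu>
  proof -
    have "combine \<nu> b \<in> Poly_Mapping.keys p" using that(1) by (simp add: in_keys_iff lookup_y_coeff)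
    moreover have "combine \<nu> b \<noteq> ?\<mu>" using that(2) unfolding \<mu> by (metis xpart_combine)
    ultimately have "induced_order lty ltx (combine \<nu> b) (combine a b)" using init(2) \<mu> by metis
    then show ?thesis
      using lty_irrefl[OF \<open>b \<in> y_monomials (length fs) (mdeg b)\<close>] by (simp add: induced_order_def Let_def)
  qed
  show "lty b' b" if b': "b' \<noteq> b" "y_coeff p b' \<noteq> 0" for b'
  proof -
    obtain \<nu> where \<nu>: "\<nu> \<in> Poly_Mapping.keys p" "ypart \<nu> = b'" using y_coeff_nonzeroD[OF b'(2)] by blast
    then have "\<nu> \<noteq> ?\<mu>" using b'(1) by (auto simp: b_def)
    then have "induced_order lty ltx \<nu> ?\<mu>" using init(2) \<nu>(1) by blast
    then show ?thesis using \<nu>(2) b'(1) by (simp add: induced_order_def Let_def b_def)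
  qed
  show "(\<Sum>b'\<in>y_monomials (length fs) k. y_coeff p b' * gen_product fs b') = 0"
    using p(1) by (simp add: mem_rees_ideal_iff)
qed

text \<open>
The element is \<open>r y^b - \<Sum> s\<^bsub>b'\<^esub> y^b'\<close> for a representation \<open>r f^b = \<Sum> s\<^bsub>b'\<^esub> f^b'\<close> through smaller monomials
\<open>y^b'\<close>. Its initial monomial sits at \<open>y^b\<close> because the order looks at the \<open>y\<close>-parts first.
\<close>

lemma rees_element_of_relation:
  assumes b: "b \<in> y_monomials (length fs) k" and r: "r \<noteq> 0"
    and mem: "r * gen_product fs b \<in> ideal_gen (gen_product fs ` lower_monomials k b)"
  shows "\<exists>p\<in>rees_ideal fs. p \<noteq> 0 \<and>
    initial_monomial (induced_order lty ltx) p = combine (initial_monomial ltx r) b"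
proof -
  let ?B = "y_monomials (length fs) k" and ?L = "lower_monomials k b"
  have L: "?L \<subseteq> ?B" "b \<notin> ?L" using lty_irrefl[OF b] by (auto simp: lower_monomials_def)
  then have "finite ?L" using finite_subset finite_y_monomials by blast
  then obtain s where s: "r * gen_product fs b = (\<Sum>b'\<in>?L. s b' * gen_product fs b')"
    using mem by (auto simp: ideal_gen_image)
  define c where "c b' = (if b' = b then r else if b' \<in> ?L then - s b' else 0)" for b'
  obtain p where p: "\<And>b'. y_coeff p b' = (if b' \<in> ?B then c b' else 0)"
    using ex_mpoly_with_y_coeffs[of ?B c] by auto
  have support: "ypart \<mu> \<in> ?B" if "\<mu> \<in> Poly_Mapping.keys p" for \<mu>
  proof (rule ccontr)
    assume "ypart \<mu> \<notin> ?B"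
    then have "Poly_Mapping.lookup (y_coeff p (ypart \<mu>)) (xpart \<mu>) = 0" by (simp add: p)
    then show False using that by (simp add: lookup_y_coeff in_keys_iff)
  qed
  have polys: "Poly_Mapping.keys p \<subseteq> monomials_in (rees_vars (length fs))"
    using support y_monomials_in mem_monomials_in_rees_vars by blast
  have "(\<Sum>b'\<in>y_monomials (length fs) k'. y_coeff p b' * gen_product fs b') = 0" for k'
  proof (cases "k' = k")
    case True
    have "(\<Sum>b'\<in>?B. y_coeff p b' * gen_product fs b') = (\<Sum>b'\<in>insert b ?L. c b' * gen_product fs b')"
      using L b by (intro sum.mono_neutral_cong_right) (auto simp: p c_def)
    also have "\<dots> = r * gen_product fs b + (\<Sum>b'\<in>?L. c b' * gen_product fs b')"
      using L \<open>finite ?L\<close> by (simp add: c_def)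
    also have "(\<Sum>b'\<in>?L. c b' * gen_product fs b') = (\<Sum>b'\<in>?L. - s b' * gen_product fs b')"
      using L by (intro sum.cong) (auto simp: c_def)
    finally show ?thesis using True by (simp add: s sum_negf)
  next
    case False
    then have "y_coeff p b' = 0" if "b' \<in> y_monomials (length fs) k'" for b'
      using that by (simp add: p y_monomials_def)
    then show ?thesis by simp
  qed
  then have "p \<in> rees_ideal fs" using polys by (simp add: mem_rees_ideal_iff polys_in_def)
  have "y_coeff p b = r" using b by (simp add: p c_def)
  note r_init = initial_monomial_UNIV[OF ltx r]
  have "p \<noteq> 0"
    using \<open>y_coeff p b = r\<close> r y_coeff_nonzeroD[of p b] by auto
  have "initial_monomial (induced_order lty ltx) p = combine (initial_monomial ltx r) b"
  proof (rule initial_monomial_eqI[OF induced_order_strict(1,2)[OF ltx lty] polys])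
    show "combine (initial_monomial ltx r) b \<in> Poly_Mapping.keys p"
      using r_init(1) \<open>y_coeff p b = r\<close> by (metis in_keys_iff lookup_y_coeff)
    fix \<nu> assume \<nu>: "\<nu> \<in> Poly_Mapping.keys p" "\<nu> \<noteq> combine (initial_monomial ltx r) b"
    have key: "xpart \<nu> \<in> Poly_Mapping.keys (y_coeff p (ypart \<nu>))"
      using \<nu>(1) by (simp add: in_keys_iff lookup_y_coeff)
    show "induced_order lty ltx \<nu> (combine (initial_monomial ltx r) b)"
    proof (cases "ypart \<nu> = b")
      case True
      then have "xpart \<nu> \<noteq> initial_monomial ltx r" using \<nu>(2) by (metis combine_parts)
      then show ?thesis
        using True key r_init(2) \<open>y_coeff p b = r\<close> by (simp add: induced_order_def Let_def)
    next
      case False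
      then have "ypart \<nu> \<in> ?L" using key by (auto simp: p c_def split: if_splits)
      then show ?thesis by (simp add: induced_order_def Let_def lower_monomials_def)
    qed
  qed
  with \<open>p \<in> rees_ideal fs\<close> \<open>p \<noteq> 0\<close> show ?thesis by blast
qed

text \<open>
The heart of the argument; here the hypothesis on the initial ideal is used. The divisor
\<open>x^a' y^b'\<close> of \<open>in(r) y^b\<close> of degree at most two is the initial monomial of some element \<open>p'\<close> of the
defining ideal, and the relation that \<open>p'\<close> gives in degree \<open>mdeg b'\<close>, multiplied by \<open>f^\<beta>\<close> with
\<open>b = b' + \<beta>\<close>, rewrites multiples of \<open>f^b\<close> through smaller products.
\<close>

lemma linear_relation:
  assumes b: "b \<in> y_monomials (length fs) k" and r: "r \<noteq> 0"
    and new: "gen_product fs b \<notin> ideal_gen (gen_product fs ` lower_monomials k b)"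
    and mem: "r * gen_product fs b \<in> ideal_gen (gen_product fs ` lower_monomials k b)"
  shows "\<exists>q. homogeneous 1 q \<and> q \<noteq> 0 \<and> (\<exists>a. initial_monomial ltx r = a + initial_monomial ltx q) \<and>
    q * gen_product fs b \<in> irrelevant_mult (gen_product fs ` lower_monomials k b)"
proof -
  let ?lt = "induced_order lty ltx"
  obtain p where p: "p \<in> rees_ideal fs" "p \<noteq> 0" "initial_monomial ?lt p = combine (initial_monomial ltx r) b"
    using rees_element_of_relation[OF b r mem] by blast
  obtain p' \<rho> where p': "p' \<in> rees_ideal fs" "p' \<noteq> 0" "mdeg (initial_monomial ?lt p') \<le> 2"
    and \<rho>: "initial_monomial ?lt p = \<rho> + initial_monomial ?lt p'"
    using quadratic_initial_divisor[OF quad p(1,2)] by blast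
  define a' b' \<beta> where "a' = xpart (initial_monomial ?lt p')" and "b' = ypart (initial_monomial ?lt p')"
    and "\<beta> = ypart \<rho>"
  define k' where "k' = mdeg b'"
  define c where "c = y_coeff p'"
  note rel = relation_of_rees_element[OF p'(1,2), folded a'_def b'_def c_def]
  have "xpart (initial_monomial ?lt p) = xpart \<rho> + a'" "ypart (initial_monomial ?lt p) = \<beta> + b'"
    by (simp_all add: \<rho> xpart_plus ypart_plus a'_def b'_def \<beta>_def)
  then have split: "initial_monomial ltx r = xpart \<rho> + a'" "b = b' + \<beta>"
    by (simp_all add: p(3) add.commute)
  have b': "b' \<in> y_monomials (length fs) k'" using rel(1) by (simp add: k'_def)
  have \<beta>: "\<beta> \<in> y_monomials (length fs) (mdeg \<beta>)" and k: "k = k' + mdeg \<beta>"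
    using b by (auto simp: split(2) y_monomials_def keys_plus_nat k'_def)
  have deg: "mdeg a' + mdeg b' \<le> 2" using p'(3) mdeg_parts[of "initial_monomial ?lt p'"] by (simp add: a'_def b'_def)
  have lower: "b'' + \<beta> \<in> lower_monomials k b" if "b'' \<in> lower_monomials k' b'" for b''
    using lower_monomials_plus[OF that b' \<beta>] by (simp add: k split(2))
  have finite_lower: "finite (lower_monomials k' b')" by (simp add: lower_monomials_def)
  have lead: "h b' * gen_product fs b' = (\<Sum>b''\<in>lower_monomials k' b'. - h b'' * gen_product fs b'')"
    if "(\<Sum>b''\<in>y_monomials (length fs) k'. h b'' * gen_product fs b'') = 0" "\<And>b''. c b'' = 0 \<Longrightarrow> h b'' = 0" for h
  proof -
    have "(\<Sum>b''\<in>y_monomials (length fs) k'. h b'' * gen_product fs b'')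
        = (\<Sum>b''\<in>insert b' (lower_monomials k' b'). h b'' * gen_product fs b'')"
    proof (rule sum.mono_neutral_right)
      show "insert b' (lower_monomials k' b') \<subseteq> y_monomials (length fs) k'"
        using b' by (auto simp: lower_monomials_def)
      show "\<forall>b''\<in>y_monomials (length fs) k' - insert b' (lower_monomials k' b'). h b'' * gen_product fs b'' = 0"
      proof
        fix b'' assume "b'' \<in> y_monomials (length fs) k' - insert b' (lower_monomials k' b')"
        then have "c b'' = 0" using rel(4) by (auto simp: lower_monomials_def)
        then show "h b'' * gen_product fs b'' = 0" using that(2) by simp
      qed
    qed simp
    moreover have "b' \<notin> lower_monomials k' b'" using lty_irrefl[OF b'] by (simp add: lower_monomials_def)
    ultimately have "h b' * gen_product fs b' + (\<Sum>b''\<in>lower_monomials k' b'. h b'' * gen_product fs b'') = 0"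
      using that(1) finite_lower by simp
    then show ?thesis by (simp add: sum_negf eq_neg_iff_add_eq_0)
  qed
  have lead_mult: "h b' * gen_product fs b = (\<Sum>b''\<in>lower_monomials k' b'. - h b'' * gen_product fs (b'' + \<beta>))"
    if "(\<Sum>b''\<in>y_monomials (length fs) k'. h b'' * gen_product fs b'') = 0" "\<And>b''. c b'' = 0 \<Longrightarrow> h b'' = 0" for h
  proof -
    have "h b' * gen_product fs b = (h b' * gen_product fs b') * gen_product fs \<beta>"
      by (simp add: split(2) monomial_value_plus mult.assoc)
    also have "\<dots> = (\<Sum>b''\<in>lower_monomials k' b'. - h b'' * gen_product fs (b'' + \<beta>))"
      by (subst lead[OF that], assumption, subst sum_distrib_right, rule sum.cong) (simp_all add: monomial_value_plus mult.assoc)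
    finally show ?thesis .
  qed
  \<comment> \<open>A divisor in the \<open>y\<close> alone has a constant as coefficient, since 1 is the smallest monomial; dividing
    by it would make \<open>f^b\<close> redundant.\<close>
  have "a' \<noteq> 0"
  proof
    assume "a' = 0"
    define e where "e = Poly_Mapping.lookup (c b') 0"
    have "e \<noteq> 0" using rel(2) \<open>a' = 0\<close> by (simp add: e_def in_keys_iff)
    have "\<nu> = 0" if "\<nu> \<in> Poly_Mapping.keys (c b')" for \<nu>
    proof (rule ccontr)
      assume "\<nu> \<noteq> 0"
      then have "ltx \<nu> 0" "ltx 0 \<nu>" using rel(3)[OF that] \<open>a' = 0\<close> ltx by (auto simp: monomial_order_def)
      then show False using order_trans_UNIV[OF ltx] order_irrefl_UNIV[OF ltx] by blast
    qed
    then have "homogeneous 0 (c b')" by (simp add: homogeneous_def)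
    then have cb: "c b' = mconst e" unfolding e_def by (rule homogeneous_deg0_const)
    have "c b' * gen_product fs b = (\<Sum>b''\<in>lower_monomials k' b'. - c b'' * gen_product fs (b'' + \<beta>))"
      by (rule lead_mult[OF rel(5)])
    also have "\<dots> \<in> ideal_gen (gen_product fs ` lower_monomials k b)"
      by (intro ideal.span_sum ideal.span_scale ideal.span_base imageI lower)
    finally have "mconst (1 / e) * (c b' * gen_product fs b) \<in> ideal_gen (gen_product fs ` lower_monomials k b)"
      by (rule ideal.span_scale)
    moreover have "mconst (1 / e) * (c b' * gen_product fs b) = gen_product fs b"
      using \<open>e \<noteq> 0\<close> by (simp add: cb mult_single flip: mult.assoc)
    ultimately show False using new by simp
  qed
  \<comment> \<open>A divisor in the \<open>x\<close> alone would come from a nonzero polynomial in the \<open>x\<close> that maps to 0.\<close>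
  moreover have "b' \<noteq> 0"
  proof
    assume "b' = 0"
    then have "y_monomials (length fs) k' = {0}" by (simp add: k'_def y_monomials_0)
    then have "c b' = 0" using rel(5)[of k'] \<open>b' = 0\<close> by simp
    then show False using rel(2) by simp
  qed
  ultimately have "mdeg a' \<noteq> 0" "mdeg b' \<noteq> 0" by simp_all
  with deg have degs: "mdeg a' = 1" "k' = 1" unfolding k'_def by linarith+
  have "\<forall>i<length fs. \<exists>d. homogeneous d (fs ! i)"
    using gens by (auto simp: min_hom_generators_def)
  then obtain D where D: "\<And>i. i < length fs \<Longrightarrow> homogeneous (D i) (fs ! i)" by metis
  define yvar where "yvar j = Poly_Mapping.single j (1::nat)" for j :: nat
  have inj_yvar: "inj yvar"
    by (rule injI) (metis lookup_single_eq lookup_single_not_eq yvar_def zero_neq_one)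
  have B1: "y_monomials (length fs) k' = yvar ` {..<length fs}"
    by (simp add: degs(2) y_monomials_1 yvar_def)
  obtain l where l: "l < length fs" "b' = yvar l" using b' B1 by auto
  \<comment> \<open>Give \<open>y\<^sub>j\<close> the degree of \<open>f\<^sub>j\<close>. Then \<open>W\<close> is the degree of \<open>x\<^sub>i y\<^sub>l\<close>, and in the component of
    degree \<open>W\<close> the coefficient of \<open>y\<^sub>l\<close> is a linear form.\<close>
  define W where "W = 1 + D l"
  \<comment> \<open>the coefficient of \<open>y\<^sub>j\<close> in that component, where \<open>b''\<close> is the monomial \<open>y\<^sub>j\<close>\<close>
  define h where "h b'' = graded_part W (D (inv_into UNIV yvar b'')) (c b'')" for b''
  have h_yvar: "h (yvar j) = graded_part W (D j) (c (yvar j))" for j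
    by (simp add: h_def inj_yvar)
  have sum_yvar: "(\<Sum>b''\<in>y_monomials (length fs) k'. g b'' * gen_product fs b'')
      = (\<Sum>j<length fs. g (yvar j) * fs ! j)" for g
    unfolding B1 using inj_yvar by (subst sum.reindex) (auto simp: yvar_def inj_on_def)
  have "(\<Sum>j<length fs. h (yvar j) * fs ! j) = graded_part W 0 (\<Sum>j<length fs. c (yvar j) * fs ! j)"
    unfolding graded_part_sum by (rule sum.cong) (simp_all add: graded_part_mult[OF D] h_yvar)
  also have "\<dots> = 0" using rel(5)[of k'] by (simp add: sum_yvar)
  finally have h_rel: "(\<Sum>j<length fs. h (yvar j) * fs ! j) = 0" .
  have h_const: "Poly_Mapping.lookup (h b'') 0 = 0" if "b'' \<in> y_monomials (length fs) k'" for b''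
    using that min_hom_generators_relation[OF gens h_rel] by (auto simp: B1)
  have h_b': "h b' = graded_part W (D l) (c b')" by (simp add: l(2) h_yvar)
  have "homogeneous 1 (h b')" unfolding h_b' by (rule homogeneous_graded_part_weight) (simp add: W_def)
  moreover have a'_key: "a' \<in> Poly_Mapping.keys (h b')"
    using rel(2) degs(1) by (simp add: h_b' keys_graded_part W_def)
  moreover have "initial_monomial ltx (h b') = a'"
  proof (rule initial_monomial_eqI[OF monomial_order_strict(1,2)[OF ltx] _ a'_key])
    show "ltx \<nu> a'" if "\<nu> \<in> Poly_Mapping.keys (h b')" "\<nu> \<noteq> a'" for \<nu>
      using rel(3) that by (simp add: h_b' keys_graded_part)
  qed simp
  moreover have "h b' * gen_product fs b \<in> irrelevant_mult (gen_product fs ` lower_monomials k b)"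
  proof -
    have "h b' * gen_product fs b = (\<Sum>b''\<in>lower_monomials k' b'. - h b'' * gen_product fs (b'' + \<beta>))"
      by (rule lead_mult) (simp_all add: sum_yvar h_rel, simp add: h_def)
    also have "\<dots> \<in> irrelevant_mult (gen_product fs ` lower_monomials k b)"
      unfolding irrelevant_mult_def
    proof (rule ideal.span_sum, rule ideal.span_base)
      fix b'' assume b'': "b'' \<in> lower_monomials k' b'"
      then have "Poly_Mapping.lookup (- h b'') 0 = 0"
        using h_const by (simp add: lower_monomials_def)
      with lower[OF b''] show "- h b'' * gen_product fs (b'' + \<beta>) \<in>
          {z * g | z g. Poly_Mapping.lookup z 0 = 0 \<and> g \<in> gen_product fs ` lower_monomials k b}"
        by blast
    qed
    finally show ?thesis .
  qed
  moreover have "h b' \<noteq> 0" using a'_key by auto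
  ultimately show ?thesis using split(1) by blast
qed

section \<open>Linear quotients of powers\<close>

text \<open>
The monomials whose product is not skipped when the products \<open>f^b\<close> are added in increasing order.
\<close>

definition reduced_monomials :: "nat \<Rightarrow> nat monomial set" where
  "reduced_monomials k = {b \<in> y_monomials (length fs) k.
     gen_product fs b \<notin> ideal_gen (gen_product fs ` lower_monomials k b)}"

lemma gen_product_in_reduced:
  assumes "b \<in> y_monomials (length fs) k"
  shows "gen_product fs b \<in>
    ideal_gen (gen_product fs ` {b' \<in> reduced_monomials k. b' = b \<or> lty b' b})"
  using assms
proof (induction "card (lower_monomials k b)" arbitrary: b rule: less_induct)
  case less
  let ?R = "\<lambda>b. gen_product fs ` {b' \<in> reduced_monomials k. b' = b \<or> lty b' b}"
  show ?case
  proof (cases "b \<in> reduced_monomials k")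
    case True
    then show ?thesis by (intro ideal.span_base imageI) simp
  next
    case False
    have "gen_product fs b' \<in> ideal_gen (?R b)" if b': "b' \<in> lower_monomials k b" for b'
    proof -
      have B: "b' \<in> y_monomials (length fs) k" "lty b' b" using b' by (auto simp: lower_monomials_def)
      have "lower_monomials k b' \<subset> lower_monomials k b"
        using b' B lty_trans[OF _ B(2)] lty_irrefl[OF B(1)] less.prems by (auto simp: lower_monomials_def)
      then have "card (lower_monomials k b') < card (lower_monomials k b)"
        by (intro psubset_card_mono) (simp_all add: lower_monomials_def)
      from less.hyps[OF this B(1)] have "gen_product fs b' \<in> ideal_gen (?R b')" .
      moreover have "?R b' \<subseteq> ?R b"
        using B lty_trans[OF _ B(2)] less.prems by (auto simp: reduced_monomials_def)
      ultimately show ?thesis using ideal.span_mono by blast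
    qed
    then have "ideal_gen (gen_product fs ` lower_monomials k b) \<subseteq> ideal_gen (?R b)"
      by (intro ideal.span_minimal ideal.subspace_span) auto
    with False less.prems show ?thesis by (auto simp: reduced_monomials_def)
  qed
qed

lemma ideal_gen_reduced_lower:
  assumes "b \<in> y_monomials (length fs) k"
  shows "ideal_gen (gen_product fs ` {b' \<in> reduced_monomials k. lty b' b})
    = ideal_gen (gen_product fs ` lower_monomials k b)"
proof
  show "ideal_gen (gen_product fs ` {b' \<in> reduced_monomials k. lty b' b})
      \<subseteq> ideal_gen (gen_product fs ` lower_monomials k b)"
    by (intro ideal.span_mono) (auto simp: reduced_monomials_def lower_monomials_def)
  have "gen_product fs b' \<in> ideal_gen (gen_product fs ` {b' \<in> reduced_monomials k. lty b' b})"
    if "b' \<in> lower_monomials k b" for b'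
  proof -
    have B: "b' \<in> y_monomials (length fs) k" "lty b' b" using that by (auto simp: lower_monomials_def)
    have "{b'' \<in> reduced_monomials k. b'' = b' \<or> lty b'' b'} \<subseteq> {b' \<in> reduced_monomials k. lty b' b}"
      using B lty_trans[OF _ B(2)] assms by (auto simp: reduced_monomials_def)
    then have "ideal_gen (gen_product fs ` {b'' \<in> reduced_monomials k. b'' = b' \<or> lty b'' b'})
        \<subseteq> ideal_gen (gen_product fs ` {b' \<in> reduced_monomials k. lty b' b})"
      by (intro ideal.span_mono image_mono)
    then show ?thesis using gen_product_in_reduced[OF B(1)] by blast
  qed
  then show "ideal_gen (gen_product fs ` lower_monomials k b)
      \<subseteq> ideal_gen (gen_product fs ` {b' \<in> reduced_monomials k. lty b' b})"
    by (intro ideal.span_minimal ideal.subspace_span) auto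
qed

lemma ideal_gen_reduced:
  "ideal_gen (gen_product fs ` reduced_monomials k) = ideal_power I k"
proof -
  have "I = ideal_gen (set fs)" using gens by (simp add: min_hom_generators_def)
  then have "ideal_power I k = ideal_gen (gen_product fs ` y_monomials (length fs) k)"
    by (simp add: ideal_power_ideal_gen)
  also have "\<dots> = ideal_gen (gen_product fs ` reduced_monomials k)"
  proof
    show "ideal_gen (gen_product fs ` reduced_monomials k) \<subseteq> ideal_gen (gen_product fs ` y_monomials (length fs) k)"
      by (intro ideal.span_mono) (auto simp: reduced_monomials_def)
    have "gen_product fs b \<in> ideal_gen (gen_product fs ` reduced_monomials k)"
      if "b \<in> y_monomials (length fs) k" for b
    proof -
      have "ideal_gen (gen_product fs ` {b' \<in> reduced_monomials k. b' = b \<or> lty b' b})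
          \<subseteq> ideal_gen (gen_product fs ` reduced_monomials k)"
        by (intro ideal.span_mono image_mono) auto
      then show ?thesis using gen_product_in_reduced[OF that] by blast
    qed
    then show "ideal_gen (gen_product fs ` y_monomials (length fs) k) \<subseteq> ideal_gen (gen_product fs ` reduced_monomials k)"
      by (intro ideal.span_minimal ideal.subspace_span) auto
  qed
  finally show ?thesis ..
qed

text \<open>
Linearity comes from the initial monomials of the colon ideal; the second statement, which
minimality needs, holds for the linear forms that were found and passes to the ideal they
generate.
\<close>

lemma reduced_quotient:
  assumes "b \<in> reduced_monomials k"
  defines "P \<equiv> gen_product fs ` lower_monomials k b"
  shows "linear_ideal (colon (ideal_gen P) (gen_product fs b))"
    and "r \<in> colon (ideal_gen P) (gen_product fs b) \<Longrightarrow>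
      Poly_Mapping.lookup r 0 = 0 \<and> r * gen_product fs b \<in> irrelevant_mult P"
proof -
  have b: "b \<in> y_monomials (length fs) k" "gen_product fs b \<notin> ideal_gen P"
    using assms(1) by (auto simp: reduced_monomials_def P_def)
  let ?C = "colon (ideal_gen P) (gen_product fs b)"
  define L where "L = {q. homogeneous 1 q \<and> q * gen_product fs b \<in> irrelevant_mult P}"
  have irr: "irrelevant_mult P \<subseteq> ideal_gen P"
    unfolding irrelevant_mult_def
    by (intro ideal.span_minimal ideal.subspace_span) (auto intro: ideal.span_scale ideal.span_base)
  have C: "?C = ideal_gen L"
  proof (rule ideal_gen_of_leading_terms[OF ltx])
    show "is_ideal ?C" by (intro is_ideal_colon ideal.subspace_span)
    show "L \<subseteq> ?C" using irr by (auto simp: L_def colon_def)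
    show "\<forall>l\<in>L. \<exists>d. homogeneous d l" by (auto simp: L_def)
    show "\<exists>q\<in>L. q \<noteq> 0 \<and> (\<exists>a. initial_monomial ltx r = a + initial_monomial ltx q)"
      if "r \<in> ?C" "r \<noteq> 0" for r
      using linear_relation[OF b(1) that(2)] b(2) that(1) by (auto simp: L_def P_def colon_def)
  qed simp
  show "linear_ideal ?C"
    unfolding C linear_ideal_def by (intro exI[of _ L]) (simp add: L_def)
  assume r: "r \<in> ?C"
  have "L \<subseteq> {q. Poly_Mapping.lookup q 0 = 0}"
    unfolding L_def homogeneous_def by (auto simp: in_keys_iff dest: bspec[of _ _ 0])
  then have "ideal_gen L \<subseteq> {q. Poly_Mapping.lookup q 0 = 0}"
    by (intro ideal.span_minimal is_ideal_no_const)
  moreover have "ideal_gen L \<subseteq> colon (irrelevant_mult P) (gen_product fs b)"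
    unfolding irrelevant_mult_def
    by (intro ideal.span_minimal is_ideal_colon ideal.subspace_span)
       (auto simp: L_def colon_def irrelevant_mult_def)
  ultimately show "Poly_Mapping.lookup r 0 = 0 \<and> r * gen_product fs b \<in> irrelevant_mult P"
    using r unfolding C by (auto simp: colon_def)
qed

text \<open>
The products of the reduced monomials in increasing order.
\<close>

lemma power_linear_quotients:
  "\<exists>gs. min_hom_generators gs (ideal_power I k) \<and> linear_quotients gs"
proof -
  have "reduced_monomials k \<subseteq> monomials_in {..<length fs}"
    using y_monomials_in by (auto simp: reduced_monomials_def)
  moreover have "finite (reduced_monomials k)" by (simp add: reduced_monomials_def)
  ultimately obtain bs where bs: "set bs = reduced_monomials k" "sorted_wrt lty bs"
    using finite_strict_order_sorted_list[OF monomial_order_strict(2,3)[OF lty]] by blast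
  define gs where "gs = map (gen_product fs) bs"
  have bs_in: "bs ! j \<in> reduced_monomials k" "bs ! j \<in> y_monomials (length fs) k" if "j < length bs" for j
    using that bs(1) nth_mem by (auto simp: reduced_monomials_def)
  have take: "set (take j bs) = {b' \<in> reduced_monomials k. lty b' (bs ! j)}" if j: "j < length bs" for j
  proof
    show "set (take j bs) \<subseteq> {b' \<in> reduced_monomials k. lty b' (bs ! j)}"
      using bs j by (auto simp: set_take_conv_image sorted_wrt_iff_nth_less)
    show "{b' \<in> reduced_monomials k. lty b' (bs ! j)} \<subseteq> set (take j bs)"
    proof
      fix b' assume b': "b' \<in> {b' \<in> reduced_monomials k. lty b' (bs ! j)}"
      then obtain i where i: "i < length bs" "b' = bs ! i"
        using bs(1) by (metis (no_types, lifting) in_set_conv_nth mem_Collect_eq)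
      have "\<not> j \<le> i"
      proof
        assume "j \<le> i"
        then have "i = j \<or> lty (bs ! j) (bs ! i)"
          using bs(2) i(1) by (auto simp: sorted_wrt_iff_nth_less order.order_iff_strict)
        then have "lty (bs ! j) (bs ! j)"
          using b' i lty_trans bs_in(2)[OF i(1)] bs_in(2)[OF j] by blast
        then show False using lty_irrefl[OF bs_in(2)[OF j]] by blast
      qed
      then show "b' \<in> set (take j bs)" using i j by (auto simp: set_take_conv_image)
    qed
  qed
  have lower: "ideal_gen (set (take j gs)) = ideal_gen (gen_product fs ` lower_monomials k (bs ! j))"
    if "j < length bs" for j
    using ideal_gen_reduced_lower[OF bs_in(2)[OF that]] take[OF that] by (simp add: gs_def take_map)
  have "linear_quotients gs"
    unfolding linear_quotients_iff using lower reduced_quotient(1)[OF bs_in(1)] by (simp add: gs_def)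
  moreover have "min_hom_generators gs (ideal_power I k)"
    unfolding min_hom_generators_def
  proof (intro conjI ballI allI impI)
    fix g assume "g \<in> set gs"
    then obtain b where b: "b \<in> y_monomials (length fs) k" "g = gen_product fs b"
      using bs(1) by (auto simp: gs_def reduced_monomials_def)
    have "\<forall>i<length fs. \<exists>d. homogeneous d (fs ! i)"
      using gens by (auto simp: min_hom_generators_def)
    then obtain D where D: "\<And>i. i < length fs \<Longrightarrow> homogeneous (D i) (fs ! i)" by metis
    have "homogeneous (\<Sum>j\<in>Poly_Mapping.keys b. Poly_Mapping.lookup b j * D j) g"
      unfolding b(2) monomial_value_def
      using b(1) D by (intro homogeneous_prod homogeneous_power) (auto simp: y_monomials_def)
    then show "\<exists>d. homogeneous d g" ..
  next
    show "ideal_gen (set gs) = ideal_power I k"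
      using bs(1) ideal_gen_reduced by (simp add: gs_def)
  next
    fix j assume j: "j < length gs"
    show "gs ! j \<notin> ideal_gen {gs ! i | i. i < length gs \<and> i \<noteq> j}"
    proof (rule irredundant_if_irrelevant_quotients[OF _ j])
      fix j r assume j: "j < length gs" and r: "r * gs ! j \<in> ideal_gen (set (take j gs))"
      then have jb: "j < length bs" and gj: "gs ! j = gen_product fs (bs ! j)" by (simp_all add: gs_def)
      have "r \<in> colon (ideal_gen (gen_product fs ` lower_monomials k (bs ! j))) (gen_product fs (bs ! j))"
        using r lower[OF jb] by (simp add: colon_def gj)
      note * = reduced_quotient(2)[OF bs_in(1)[OF jb] this]
      have "irrelevant_mult (gen_product fs ` lower_monomials k (bs ! j)) \<subseteq> irrelevant_mult (set (take j gs))"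
      proof -
        have "z * g \<in> irrelevant_mult (set (take j gs))"
          if "Poly_Mapping.lookup z 0 = 0" "g \<in> gen_product fs ` lower_monomials k (bs ! j)" for z g
          using that lower[OF jb] by (intro irrelevant_mult_mem) (auto intro: ideal.span_base)
        then show ?thesis
          unfolding irrelevant_mult_def[of "gen_product fs ` lower_monomials k (bs ! j)"]
          by (intro ideal.span_minimal) (auto simp: irrelevant_mult_def)
      qed
      with * show "Poly_Mapping.lookup r 0 = 0 \<and> r * gs ! j \<in> irrelevant_mult (set (take j gs))"
        by (auto simp: gj)
    qed
  qed
  ultimately show ?thesis by blast
qed

end

theorem corollary1p2:
  fixes I :: "('x::finite, 'k::field) mpoly set"
    and fs :: "('x, 'k) mpoly list"
    and ltx :: "'x monomial \<Rightarrow> 'x monomial \<Rightarrow> bool"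
    and lty :: "nat monomial \<Rightarrow> nat monomial \<Rightarrow> bool"
    and k :: nat
  assumes "graded_ideal I"
    and "min_hom_generators fs I"
    and "monomial_order UNIV ltx"
    and "monomial_order {..<length fs} lty"
    and "generated_by_quadratic_monomials (rees_vars (length fs))
           (initial_ideal (rees_vars (length fs)) (induced_order lty ltx) (rees_ideal fs))"
    and "k \<ge> 1"
  shows "(\<exists>gs. min_hom_generators gs (ideal_power I k) \<and> linear_quotients gs) \<and>
         componentwise_linear (ideal_power I k)"
proof -
  obtain gs where gs: "min_hom_generators gs (ideal_power I k)" "linear_quotients gs"
    using power_linear_quotients[OF assms(2-5)] by blast
  with linear_quotients_imp_componentwise_linear[OF assms(3)] show ?thesis by blast
qed

end
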